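(* If $U$ is a finite index subgroup of the Houghton group $H_2$, then $d(U)=d(H_2)$. For $n\in\{3,4,\ldots\}$ and $U$ a finite index subgroup of the Houghton group $H_n$, we have $d(U)\in\{d(H_n),d(H_n)+1\}$. Furthermore, for such $n$ and $U$, let $\pi(U)=\langle c_2e_1,\ldots,c_ne_{n-1}\rangle$ with $c_2,\ldots,c_n\in\mathbb{N}$. Then $d(U)=d(H_n)+1$ if and only if both of the following conditions hold: (i) $\mathrm{FSym}(X_n)\le U$; and (ii) either one or zero of $c_2,\ldots,c_n$ (counted by index) are odd.
   Context: For a finitely generated group $G$, $d(G)$ denotes the minimal size of a generating set of $G$. $\mathbb{N}=\{1,2,\ldots\}$. Permutations act on the right, so products are composed left to right. For a set $X$, $\mathrm{FSym}(X)$ is the group of bijections of $X$ with finite support. For $n\ge 2$ let $X_n=\{1,\ldots,n\}\times\mathbb{N}$ and, for $k\in\{2,\ldots,n\}$, let $g_k\in\mathrm{Sym}(X_n)$ be defined by $(1,m)g_k=(1,m+1)$ for $m\in\mathbb{N}$; $(k,1)g_k=(1,1)$; $(k,m)g_k=(k,m-1)$ for $m\ge2$; and $(i,m)g_k=(i,m)$ for $i\notin\{1,k\}$. For $n\ge3$ the Houghton group is $H_n=\langle g_2,\ldots,g_n\rangle$; for $n=2$, $H_2=\langle ((1,1)\;(1,2)),\, g_2\rangle$, where $((1,1)\;(1,2))$ is the transposition swapping $(1,1)$ and $(1,2)$. One has $d(H_2)=2$ and $d(H_n)=n-1$ for $n\ge3$. One has $\mathrm{FSym}(X_n)\le H_n$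 for all $n\ge2$, and there is a surjective homomorphism $\pi:H_n\to\mathbb{Z}^{n-1}$ with kernel $\mathrm{FSym}(X_n)$ and $\pi(g_i)=e_{i-1}$ for $i=2,\ldots,n$, where $e_1,\ldots,e_{n-1}$ is the standard basis of $\mathbb{Z}^{n-1}$. *)

theory Defs
  imports
    "HOL-Algebra.Elementary_Groups"
    "HOL-Algebra.Product_Groups"
    "HOL-Combinatorics.Permutations"
    "HOL-Library.Extended_Nat"
begin

section \<open>Number of generators, finite index\<close>

text \<open>The value is \<open>\<infinity>\<close> (the infimum of the empty set) iff the group is not finitely generated.\<close>

definition min_generators :: "('a, 'b) monoid_scheme \<Rightarrow> enat" where
  "min_generators G =
     (INF S \<in> {S. S \<subseteq> carrier G \<and> finite S \<and> generate G S = carrier G}. enat (card S))"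

definition finite_index_subgroup :: "'a set \<Rightarrow> ('a, 'b) monoid_scheme \<Rightarrow> bool" where
  "finite_index_subgroup U G \<longleftrightarrow> subgroup U G \<and> finite (rcosets\<^bsub>G\<^esub> U)"

section \<open>Houghton groups\<close>

text \<open>
  A bijection of \<open>X\<close> is represented by its extension by the identity. Permutations act on the
  right, so the product \<open>p \<otimes> q\<close> applies \<open>p\<close> first.
\<close>

definition perm_group :: "'a set \<Rightarrow> ('a \<Rightarrow> 'a) monoid" where
  "perm_group X = \<lparr>carrier = {p. p permutes X}, monoid.mult = (\<lambda>p q. q \<circ> p), one = id\<rparr>"

definition fsym :: "'a set \<Rightarrow> ('a \<Rightarrow> 'a) set" where
  "fsym X = {p. p permutes X \<and> finite {x. p x \<noteq> x}}"

definition rays :: "nat \<Rightarrow> (nat \<times> nat) set" where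
  "rays n = {1..n} \<times> {1..}"

text \<open>The points \<open>(i, 0)\<close> lie outside every \<open>rays n\<close> and are fixed.\<close>

definition ray_shift :: "nat \<Rightarrow> nat \<times> nat \<Rightarrow> nat \<times> nat" where
  "ray_shift k = (\<lambda>(i, m).
     if m = 0 then (i, m)
     else if i = 1 then (1, m + 1)
     else if i = k then (if m = 1 then (1, 1) else (k, m - 1))
     else (i, m))"

definition houghton_gens :: "nat \<Rightarrow> (nat \<times> nat \<Rightarrow> nat \<times> nat) set" where
  "houghton_gens n =
     (if n = 2 then {transpose (1, 1) (1, 2), ray_shift 2} else ray_shift ` {2..n})"

definition houghton :: "nat \<Rightarrow> (nat \<times> nat \<Rightarrow> nat \<times> nat) monoid" where
  "houghton n = subgroup_generated (perm_group (rays n)) (houghton_gens n)"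

section \<open>The projection onto the free abelian group\<close>

definition int_power_group :: "nat \<Rightarrow> (nat \<Rightarrow> int) monoid" where
  "int_power_group r = product_group {1..r} (\<lambda>_. integer_group)"

definition std_basis :: "nat \<Rightarrow> nat \<Rightarrow> nat \<Rightarrow> int" where
  "std_basis r j = (\<lambda>i\<in>{1..r}. if i = j then 1 else 0)"

text \<open>
  On \<open>carrier (houghton n)\<close> such a map is unique for \<open>n \<ge> 3\<close>, since the \<open>ray_shift k\<close>
  generate the group. Existence is lemma \<open>houghton_projections_nonempty\<close>.
\<close>

definition houghton_projections :: "nat \<Rightarrow> ((nat \<times> nat \<Rightarrow> nat \<times> nat) \<Rightarrow> nat \<Rightarrow> int) set" where
  "houghton_projections n =
     {\<phi> \<in> epi (houghton n) (int_power_group (n - 1)).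
        kernel (houghton n) (int_power_group (n - 1)) \<phi> = fsym (rays n) \<and>
        (\<forall>k\<in>{2..n}. \<phi> (ray_shift k) = std_basis (n - 1) (k - 1))}"


subsection \<open>Existence of the projection\<close>

lemma group_perm_group: "group (perm_group X)"
proof (rule groupI)
  fix p assume "p \<in> carrier (perm_group X)"
  then show "\<exists>q\<in>carrier (perm_group X). q \<otimes>\<^bsub>perm_group X\<^esub> p = \<one>\<^bsub>perm_group X\<^esub>"
    by (intro bexI[of _ "inv_into UNIV p"]) (auto simp: perm_group_def permutes_inv permutes_inv_o)
qed (auto simp: perm_group_def permutes_compose permutes_id o_assoc)

lemma inv_perm_group:
  assumes "p permutes X"
  shows "inv\<^bsub>perm_group X\<^esub> p = inv_into UNIV p"
  by (rule group.inv_equality[OF group_perm_group])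
     (use assms in \<open>auto simp: perm_group_def permutes_inv permutes_inv_o\<close>)

lemma ray_shift_permutes:
  assumes "k \<in> {2..n}"
  shows "ray_shift k permutes rays n"
proof (rule bij_imp_permutes)
  let ?h = "\<lambda>(i, m). if m = 0 then (i, m) else if i = 1 then (if m = 1 then (k, 1) else (1, m - 1))
      else if i = k then (k, m + 1) else (i, m :: nat)"
  show "bij_betw (ray_shift k) (rays n) (rays n)"
    by (rule bij_betw_byWitness[where f' = ?h])
       (use assms in \<open>auto simp: ray_shift_def rays_def split: if_splits\<close>)
  show "ray_shift k x = x" if "x \<notin> rays n" for x
    using that assms by (auto simp: ray_shift_def rays_def split: prod.splits)
qed

lemma transpose_permutes:
  assumes "n \<ge> 2"
  shows "transpose (1, 1) (1, 2) permutes rays n"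
  by (rule permutes_swap_id) (use assms in \<open>auto simp: rays_def\<close>)

lemma houghton_gens_subset:
  assumes "n \<ge> 2"
  shows "houghton_gens n \<subseteq> carrier (perm_group (rays n))"
  using assms ray_shift_permutes transpose_permutes[of n]
  by (auto simp: houghton_gens_def perm_group_def)

lemma carrier_houghton:
  assumes "n \<ge> 2"
  shows "carrier (houghton n) = generate (perm_group (rays n)) (houghton_gens n)"
  using houghton_gens_subset[OF assms]
  by (simp add: houghton_def carrier_subgroup_generated Int_absorb1)

lemma houghton_subgroup:
  assumes "n \<ge> 2"
  shows "subgroup (carrier (houghton n)) (perm_group (rays n))"
  unfolding carrier_houghton[OF assms]
  by (rule group.generate_is_subgroup[OF group_perm_group houghton_gens_subset[OF assms]])

lemma group_houghton: "group (houghton n)"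
  unfolding houghton_def by (rule group.group_subgroup_generated[OF group_perm_group])

lemma houghton_mult [simp]: "p \<otimes>\<^bsub>houghton n\<^esub> q = q \<circ> p"
  by (simp add: houghton_def perm_group_def)

lemma houghton_permutes:
  assumes "n \<ge> 2" "p \<in> carrier (houghton n)"
  shows "p permutes rays n"
  using subgroup.mem_carrier[OF houghton_subgroup] assms by (auto simp: perm_group_def)

lemma houghton_comp:
  assumes "n \<ge> 2" "p \<in> carrier (houghton n)" "q \<in> carrier (houghton n)"
  shows "p \<circ> q \<in> carrier (houghton n)"
  using subgroup.m_closed[OF houghton_subgroup[OF assms(1)] assms(3,2)]
  by (simp add: perm_group_def)

lemma houghton_id:
  assumes "n \<ge> 2"
  shows "id \<in> carrier (houghton n)"
  using subgroup.one_closed[OF houghton_subgroup[OF assms]] by (simp add: perm_group_def)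

lemma houghton_inv:
  assumes "n \<ge> 2" "p \<in> carrier (houghton n)"
  shows "inv_into UNIV p \<in> carrier (houghton n)"
  using subgroup.m_inv_closed[OF houghton_subgroup[OF assms(1)] assms(2)]
    inv_perm_group[OF houghton_permutes[OF assms]] by simp

lemma ray_shift_in_houghton:
  assumes "n \<ge> 2" "k \<in> {2..n}"
  shows "ray_shift k \<in> carrier (houghton n)"
  unfolding carrier_houghton[OF assms(1)]
  by (rule generate.incl) (use assms in \<open>auto simp: houghton_gens_def\<close>)

lemma ray_shift_commutator:
  "ray_shift 3 \<circ> ray_shift 2 = transpose (1, 1) (1, 2) \<circ> (ray_shift 2 \<circ> ray_shift 3)"
  by (rule ext) (auto simp: ray_shift_def transpose_def split: if_splits)

lemma transpose_in_houghton:
  assumes "n \<ge> 2"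
  shows "transpose (1, 1) (1, 2) \<in> carrier (houghton n)"
proof (cases "n = 2")
  case True
  then show ?thesis
    unfolding carrier_houghton[OF assms]
    by (intro generate.incl) (simp add: houghton_gens_def)
next
  case False
  let ?q = "ray_shift 2 \<circ> ray_shift 3"
  have q: "?q \<in> carrier (houghton n)" and q': "ray_shift 3 \<circ> ray_shift 2 \<in> carrier (houghton n)"
    using False assms by (auto intro!: houghton_comp ray_shift_in_houghton)
  have "transpose (1, 1) (1, 2) = transpose (1, 1) (1, 2) \<circ> (?q \<circ> inv_into UNIV ?q)"
    using permutes_inv_o(1)[OF houghton_permutes[OF assms q]] by simp
  also have "\<dots> = (ray_shift 3 \<circ> ray_shift 2) \<circ> inv_into UNIV ?q"
    by (simp only: ray_shift_commutator o_assoc)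
  finally show ?thesis
    using houghton_comp[OF assms q' houghton_inv[OF assms q]] by simp
qed

lemma transpose_conj:
  assumes n: "n \<ge> 2" and p: "p \<in> carrier (houghton n)"
    and "transpose x y \<in> carrier (houghton n)"
  shows "transpose (p x) (p y) \<in> carrier (houghton n)"
proof -
  have perm: "p permutes rays n" by (rule houghton_permutes[OF n p])
  have "transpose (p x) (p y) = p \<circ> transpose x y \<circ> inv_into UNIV p"
  proof
    fix z
    obtain w where "z = p w" using permutes_surj[OF perm] by blast
    then show "transpose (p x) (p y) z = (p \<circ> transpose x y \<circ> inv_into UNIV p) z"
      using permutes_inverses(2)[OF perm, of w] permutes_inj[OF perm]
      by (auto simp: transpose_def inj_eq)
  qed
  then show ?thesis
    using houghton_comp[OF n houghton_comp[OF n p assms(3)] houghton_inv[OF n p]] by simp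
qed

lemma transpose_trans:
  assumes n: "n \<ge> 2" and "transpose x y \<in> carrier (houghton n)"
    and "transpose y z \<in> carrier (houghton n)"
  shows "transpose x z \<in> carrier (houghton n)"
proof (cases "z = x \<or> z = y")
  case True
  then show ?thesis using assms houghton_id[OF n] by (auto simp: id_def)
next
  case False
  then have "transpose y z x = x \<or> x = y" "transpose y z y = z"
    by (auto simp: transpose_def)
  then show ?thesis using transpose_conj[OF n assms(3,2)] assms(3) by auto
qed

lemma transpose_base_in_houghton:
  assumes n: "n \<ge> 2" and "x \<in> rays n"
  shows "transpose (1, 1) x \<in> carrier (houghton n)"
proof -
  have first: "transpose (1, 1) (1, Suc m) \<in> carrier (houghton n)" for m
  proof -
    have *: "transpose (1, Suc m) (1, Suc (Suc m)) \<in> carrier (houghton n)" for m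
    proof (induction m)
      case 0
      then show ?case using transpose_in_houghton[OF n] by (simp add: numeral_2_eq_2)
    next
      case (Suc m)
      then show ?case
        using transpose_conj[OF n ray_shift_in_houghton[OF n, of 2] Suc.IH] n
        by (simp add: ray_shift_def)
    qed
    show ?thesis
    proof (induction m)
      case 0
      then show ?case using houghton_id[OF n] by (simp add: id_def)
    next
      case (Suc m)
      then show ?case using transpose_trans[OF n Suc.IH *] by simp
    qed
  qed
  obtain k m where x: "x = (k, Suc m)" "k \<in> {1..n}"
    using assms(2) by (auto simp: rays_def) (metis Suc_pred' not_gr_zero not_less_eq_eq le_0_eq)
  show ?thesis
  proof (cases "k = 1")
    case True
    then show ?thesis using first x by simp
  next
    case False
    then have k: "k \<in> {2..n}" using x by auto
    let ?g = "ray_shift k"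
    have g: "?g \<in> carrier (houghton n)" by (rule ray_shift_in_houghton[OF n k])
    have inj: "inj ?g" by (rule permutes_inj[OF ray_shift_permutes[OF k]])
    have inv1: "inv_into UNIV ?g (1, 2) = (1, 1)"
      by (rule inv_f_eq[OF inj]) (simp add: ray_shift_def)
    have inv2: "inv_into UNIV ?g (1, 1) = (k, 1)"
      by (rule inv_f_eq[OF inj]) (use False in \<open>simp add: ray_shift_def\<close>)
    have inv3: "inv_into UNIV ?g (k, Suc m) = (k, Suc (Suc m))" for m
      by (rule inv_f_eq[OF inj]) (use False in \<open>simp add: ray_shift_def\<close>)
    have base: "transpose (1, 1) (k, 1) \<in> carrier (houghton n)"
      using transpose_conj[OF n houghton_inv[OF n g] transpose_in_houghton[OF n]]
      unfolding inv1 inv2 by (simp only: transpose_commute)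
    have *: "transpose (1, 1) (k, Suc m) \<in> carrier (houghton n)"
    proof (induction m)
      case 0
      then show ?case using base by simp
    next
      case (Suc m)
      have "transpose (k, 1) (k, Suc (Suc m)) \<in> carrier (houghton n)"
        using transpose_conj[OF n houghton_inv[OF n g] Suc.IH] unfolding inv2 inv3 .
      then show ?case by (rule transpose_trans[OF n base])
    qed
    then show ?thesis using x by simp
  qed
qed

lemma fsym_subset_houghton:
  assumes n: "n \<ge> 2"
  shows "fsym (rays n) \<subseteq> carrier (houghton n)"
proof
  fix p assume "p \<in> fsym (rays n)"
  then have p: "p permutes rays n" and fin: "finite {x. p x \<noteq> x}"
    by (auto simp: fsym_def)
  let ?S = "{x. p x \<noteq> x}"
  have S: "?S \<subseteq> rays n" using p by (auto simp: permutes_def)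
  have "p permutes ?S" using p by (auto simp: permutes_def)
  then show "p \<in> carrier (houghton n)"
    using fin
  proof (induction rule: permutes_induct)
    case id
    show ?case by (rule houghton_id[OF n])
  next
    case (swap a b p)
    have "transpose a (1, 1) \<in> carrier (houghton n)" "transpose (1, 1) b \<in> carrier (houghton n)"
      using transpose_base_in_houghton[OF n, of a] transpose_base_in_houghton[OF n, of b]
        subsetD[OF S swap(1)] subsetD[OF S swap(2)] by (simp_all add: transpose_commute)
    then have "transpose a b \<in> carrier (houghton n)" by (rule transpose_trans[OF n])
    then show ?case by (rule houghton_comp[OF n _ swap.IH])
  qed
qed

definition translates :: "(nat \<times> nat \<Rightarrow> nat \<times> nat) \<Rightarrow> nat \<Rightarrow> int \<Rightarrow> bool" where
  "translates p i t \<longleftrightarrow> (\<forall>\<^sub>F m in sequentially. fst (p (i, m)) = i \<and> int (snd (p (i, m))) = int m + t)"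

lemma translates_unique:
  assumes "translates p i s" "translates p i t"
  shows "s = t"
proof -
  have "\<forall>\<^sub>F m in sequentially. s = t"
    using assms unfolding translates_def by eventually_elim simp
  then show ?thesis by simp
qed

lemma translates_comp:
  assumes "translates p i s" "translates q i t"
  shows "translates (q \<circ> p) i (s + t)"
proof -
  from assms obtain M N
    where M: "\<And>m. m \<ge> M \<Longrightarrow> fst (p (i, m)) = i \<and> int (snd (p (i, m))) = int m + s"
      and N: "\<And>m. m \<ge> N \<Longrightarrow> fst (q (i, m)) = i \<and> int (snd (q (i, m))) = int m + t"
    by (auto simp: translates_def eventually_sequentially)
  have "fst ((q \<circ> p) (i, m)) = i \<and> int (snd ((q \<circ> p) (i, m))) = int m + (s + t)"
    if "m \<ge> M + N + nat \<bar>s\<bar>" for m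
  proof -
    obtain j l where jl: "p (i, m) = (j, l)" by (cases "p (i, m)")
    with M[of m] that have "j = i" "int l = int m + s" by auto
    moreover from this that have "l \<ge> N" by linarith
    ultimately show ?thesis using N[of l] jl by auto
  qed
  then show ?thesis by (auto simp: translates_def eventually_sequentially)
qed

lemma translates_inv:
  assumes "p permutes X" "translates p i t"
  shows "translates (inv_into UNIV p) i (- t)"
proof -
  from assms(2) obtain M
    where M: "\<And>m. m \<ge> M \<Longrightarrow> fst (p (i, m)) = i \<and> int (snd (p (i, m))) = int m + t"
    by (auto simp: translates_def eventually_sequentially)
  have "fst (inv_into UNIV p (i, m)) = i \<and> int (snd (inv_into UNIV p (i, m))) = int m + - t"
    if "m \<ge> M + nat \<bar>t\<bar>" for m
  proof -
    define l where "l = nat (int m - t)"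
    have l: "int l = int m - t" "l \<ge> M" using that by (auto simp: l_def)
    have "p (i, l) = (i, m)" using M[OF l(2)] l(1) by (simp add: prod_eq_iff)
    then have "inv_into UNIV p (i, m) = (i, l)" using permutes_inverses(2)[OF assms(1)] by metis
    then show ?thesis using l by simp
  qed
  then show ?thesis by (auto simp: translates_def eventually_sequentially)
qed

lemma translates_finite_support:
  assumes "finite {x. p x \<noteq> x}"
  shows "translates p i 0"
proof -
  have "finite (snd ` {x. p x \<noteq> x})" using assms by simp
  then obtain M where M: "\<And>m. m \<in> snd ` {x. p x \<noteq> x} \<Longrightarrow> m < M"
    by (meson finite_nat_set_iff_bounded)
  have "p (i, m) = (i, m)" if "m \<ge> M" for m
    using M[of m] that by (force simp: image_iff)
  then show ?thesis
    unfolding translates_def eventually_sequentially by (intro exI[of _ M]) simp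
qed

lemma translates_ray_shift:
  assumes "k \<ge> 2"
  shows "translates (ray_shift k) i (if i = 1 then 1 else if i = k then - 1 else 0)"
  unfolding translates_def eventually_sequentially
  by (rule exI[of _ 2]) (use assms in \<open>auto simp: ray_shift_def\<close>)

lemma houghton_translates:
  assumes n: "n \<ge> 2" and p: "p \<in> carrier (houghton n)"
  shows "\<exists>t. (\<forall>i. translates p i (t i)) \<and> (\<Sum>i=1..n. t i) = 0"
proof -
  let ?P = "\<lambda>p. \<exists>t. (\<forall>i. translates p i (t i)) \<and> (\<Sum>i=1..n. t i) = 0"
  have fin: "?P p" if "finite {x. p x \<noteq> x}" for p
    by (rule exI[of _ "\<lambda>_. 0"]) (use that translates_finite_support in auto)
  have gen: "?P p" if gen_p: "p \<in> houghton_gens n" for p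
  proof -
    consider "p = transpose (1, 1) (1, 2)" | k where "p = ray_shift k" "k \<in> {2..n}"
      using gen_p n by (auto simp: houghton_gens_def split: if_splits)
    then show ?thesis
    proof cases
      case 1
      have "{x. p x \<noteq> x} \<subseteq> {(1, 1), (1, 2)}" unfolding 1 by (auto simp: transpose_def)
      then show ?thesis by (intro fin) (rule finite_subset, auto)
    next
      case 2
      let ?t = "\<lambda>i. if i = 1 then 1 else if i = k then - 1 else (0::int)"
      have "(\<Sum>i=1..n. ?t i) = (\<Sum>i=1..n. (if i = 1 then 1 else 0) - (if i = k then 1 else 0))"
        by (rule sum.cong) (use 2 in auto)
      also have "\<dots> = 0" using 2 n by (simp add: sum_subtractf)
      finally show ?thesis using 2 translates_ray_shift[of k] by (intro exI[of _ ?t]) auto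
    qed
  qed
  have inverse_case: "?P (inv_into UNIV p)" if "p permutes rays n" "?P p" for p
  proof -
    from that(2) obtain t where "\<forall>i. translates p i (t i)" "(\<Sum>i=1..n. t i) = 0" by blast
    then show ?thesis
      by (intro exI[of _ "\<lambda>i. - t i"]) (use translates_inv[OF that(1)] in \<open>simp add: sum_negf\<close>)
  qed
  show ?thesis using p unfolding carrier_houghton[OF n]
  proof (induction rule: generate.induct)
    case one
    show ?case using fin[of id] by (simp add: perm_group_def id_def)
  next
    case (incl h)
    then show ?case by (rule gen)
  next
    case (inv h)
    have "h permutes rays n"
      using houghton_gens_subset[OF n] inv by (auto simp: perm_group_def)
    then show ?case using inv_perm_group inverse_case[OF _ gen[OF inv]] by metis
  next
    case (eng p q)
    from eng.IH obtain s t where "\<forall>i. translates p i (s i)" "(\<Sum>i=1..n. s i) = 0"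
      "\<forall>i. translates q i (t i)" "(\<Sum>i=1..n. t i) = 0" by blast
    then show ?case
      by (intro exI[of _ "\<lambda>i. s i + t i"]) (simp add: perm_group_def translates_comp[unfolded o_def] o_def sum.distrib)
  qed
qed

definition translation :: "(nat \<times> nat \<Rightarrow> nat \<times> nat) \<Rightarrow> nat \<Rightarrow> int" where
  "translation p i = (THE t. translates p i t)"

lemma translation_eq: "translates p i t \<Longrightarrow> translation p i = t"
  unfolding translation_def using translates_unique by blast

lemma translates_translation:
  assumes "n \<ge> 2" "p \<in> carrier (houghton n)"
  shows "translates p i (translation p i)"
  using houghton_translates[OF assms] translation_eq by metis

lemma sum_translation:
  assumes "n \<ge> 2" "p \<in> carrier (houghton n)"
  shows "(\<Sum>i=1..n. translation p i) = 0"
proof -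
  obtain t where t: "\<forall>i. translates p i (t i)" "(\<Sum>i=1..n. t i) = 0"
    using houghton_translates[OF assms] by blast
  then have "translation p = t" using translation_eq by blast
  with t show ?thesis by simp
qed

lemma group_int_power_group: "group (int_power_group r)"
  unfolding int_power_group_def by simp

lemma int_power_group_generated:
  assumes H: "subgroup H (int_power_group r)" and basis: "\<And>j. j \<in> {1..r} \<Longrightarrow> std_basis r j \<in> H"
  shows "H = carrier (int_power_group r)"
proof (rule antisym[OF subgroup.subset[OF H]], rule subsetI)
  interpret G: group "int_power_group r" by (rule group_int_power_group)
  have closed: "(\<lambda>i\<in>{1..r}. x i + y i) \<in> H" if "x \<in> H" "y \<in> H" for x y
    using subgroup.m_closed[OF H that] by (simp add: int_power_group_def product_group_def)
  have zero: "(\<lambda>i\<in>{1..r}. 0) \<in> H"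
    using subgroup.one_closed[OF H] by (simp add: int_power_group_def product_group_def)
  have neg: "(\<lambda>i\<in>{1..r}. - x i) \<in> H" if "x \<in> H" for x
  proof -
    have "x \<in> (\<Pi>\<^sub>E i\<in>{1..r}. carrier integer_group)"
      using subgroup.mem_carrier[OF H that] by (simp add: int_power_group_def)
    then have "inv\<^bsub>int_power_group r\<^esub> x = (\<lambda>i\<in>{1..r}. - x i)"
      unfolding int_power_group_def by (subst inv_product_group) auto
    then show ?thesis using subgroup.m_inv_closed[OF H that] by simp
  qed
  have nat_mult: "(\<lambda>i\<in>{1..r}. if i = j then int m else 0) \<in> H" if "j \<in> {1..r}" for j m
  proof (induction m)
    case 0
    have "(\<lambda>i\<in>{1..r}. if i = j then int 0 else 0) = (\<lambda>i\<in>{1..r}. 0)" by auto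
    then show ?case using zero by (simp only:)
  next
    case (Suc m)
    have "(\<lambda>i\<in>{1..r}. if i = j then int (Suc m) else 0)
        = (\<lambda>i\<in>{1..r}. (\<lambda>i\<in>{1..r}. if i = j then int m else 0) i + std_basis r j i)"
      by (auto simp: std_basis_def fun_eq_iff)
    then show ?case using closed[OF Suc.IH basis[OF that]] by (simp only:)
  qed
  have int_mult: "(\<lambda>i\<in>{1..r}. if i = j then c else 0) \<in> H" if "j \<in> {1..r}" for j c
  proof (cases "c \<ge> 0")
    case True
    then show ?thesis using nat_mult[OF that, of "nat c"] by (simp only: nat_0_le)
  next
    case False
    have "(\<lambda>i\<in>{1..r}. if i = j then c else 0)
        = (\<lambda>i\<in>{1..r}. - (\<lambda>i\<in>{1..r}. if i = j then int (nat (- c)) else 0) i)"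
      using False by (auto simp: fun_eq_iff)
    then show ?thesis using neg[OF nat_mult[OF that, of "nat (- c)"]] by (simp only:)
  qed
  fix z assume z: "z \<in> carrier (int_power_group r)"
  have "(\<lambda>i\<in>{1..r}. if i \<le> s then z i else 0) \<in> H" if "s \<le> r" for s
    using that
  proof (induction s)
    case 0
    have "(\<lambda>i\<in>{1..r}. if i \<le> 0 then z i else 0) = (\<lambda>i\<in>{1..r}. 0)" by auto
    then show ?case using zero by (simp only:)
  next
    case (Suc s)
    have "(\<lambda>i\<in>{1..r}. if i \<le> Suc s then z i else 0)
        = (\<lambda>i\<in>{1..r}. (\<lambda>i\<in>{1..r}. if i \<le> s then z i else 0) i
             + (\<lambda>i\<in>{1..r}. if i = Suc s then z (Suc s) else 0) i)"
      by (auto simp: fun_eq_iff le_Suc_eq)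
    moreover have "s \<le> r" "Suc s \<in> {1..r}" using Suc.prems by auto
    ultimately show ?case
      using closed[OF Suc.IH int_mult, of "Suc s" "z (Suc s)"] by (simp only:)
  qed
  from this[of r] have "(\<lambda>i\<in>{1..r}. if i \<le> r then z i else 0) \<in> H" by simp
  moreover have "(\<lambda>i\<in>{1..r}. if i \<le> r then z i else 0) = z"
    using z by (force simp: int_power_group_def PiE_def extensional_def fun_eq_iff)
  ultimately show "z \<in> H" by simp
qed

lemma houghton_projections_nonempty:
  assumes n: "n \<ge> 2"
  shows "houghton_projections n \<noteq> {}"
proof -
  define \<phi> where "\<phi> p = (\<lambda>j\<in>{1..n - 1}. - translation p (Suc j))" for p
  let ?H = "houghton n" and ?Z = "int_power_group (n - 1)"
  have hom: "\<phi> \<in> hom ?H ?Z"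
  proof (rule homI)
    fix p q assume pq: "p \<in> carrier ?H" "q \<in> carrier ?H"
    have "translation (q \<circ> p) i = translation p i + translation q i" for i
      using pq by (intro translation_eq translates_comp translates_translation[OF n])
    then show "\<phi> (p \<otimes>\<^bsub>?H\<^esub> q) = \<phi> p \<otimes>\<^bsub>?Z\<^esub> \<phi> q"
      by (auto simp: \<phi>_def int_power_group_def product_group_def fun_eq_iff)
  qed (auto simp: \<phi>_def int_power_group_def)
  have on_shifts: "\<phi> (ray_shift k) = std_basis (n - 1) (k - 1)" if "k \<in> {2..n}" for k
  proof -
    have "translation (ray_shift k) (Suc j) = (if j = k - 1 then - 1 else 0)" if "j \<ge> 1" for j
      using translation_eq[OF translates_ray_shift[of k "Suc j"]] that \<open>k \<in> {2..n}\<close> by auto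
    then show ?thesis by (auto simp: \<phi>_def std_basis_def fun_eq_iff)
  qed
  interpret group_hom ?H ?Z \<phi>
    using hom group_houghton group_int_power_group
    by (simp add: group_hom_def group_hom_axioms_def)
  have "\<phi> ` carrier ?H = carrier ?Z"
  proof (rule int_power_group_generated[OF img_is_subgroup])
    fix j assume "j \<in> {1..n - 1}"
    then have "Suc j \<in> {2..n}" by auto
    then show "std_basis (n - 1) j \<in> \<phi> ` carrier ?H"
      using on_shifts[of "Suc j"] ray_shift_in_houghton[OF n, of "Suc j"] by force
  qed
  moreover have "kernel ?H ?Z \<phi> = fsym (rays n)"
  proof (intro equalityI subsetI)
    fix p assume "p \<in> kernel ?H ?Z \<phi>"
    then have p: "p \<in> carrier ?H" and "\<phi> p = (\<lambda>j\<in>{1..n - 1}. 0)"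
      by (auto simp: kernel_def int_power_group_def product_group_def)
    then have *: "translation p (Suc j) = 0" if "j \<in> {1..n - 1}" for j
      using that by (metis (no_types, lifting) \<phi>_def neg_equal_0_iff_equal restrict_apply')
    have rest: "translation p i = 0" if "i \<in> {2..n}" for i
    proof -
      have "i - 1 \<in> {1..n - 1}" "Suc (i - 1) = i" using that by auto
      then show ?thesis using *[of "i - 1"] by simp
    qed
    have "{1..n} = insert 1 {2..n}" using n by auto
    then have "translation p 1 = 0"
      using sum_translation[OF n p] rest by simp
    then have zero: "translation p i = 0" if "i \<in> {1..n}" for i
      using rest[of i] that by (cases "i = 1") auto
    have "\<exists>M. \<forall>m\<ge>M. p (i, m) = (i, m)" if "i \<in> {1..n}" for i
      using translates_translation[OF n p, of i] zero[OF that]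
      by (simp add: translates_def eventually_sequentially prod_eq_iff)
    then obtain M where M: "\<And>i m. i \<in> {1..n} \<Longrightarrow> m \<ge> M i \<Longrightarrow> p (i, m) = (i, m)" by metis
    have perm: "p permutes rays n" by (rule houghton_permutes[OF n p])
    have "{x. p x \<noteq> x} \<subseteq> (SIGMA i:{1..n}. {..<M i})"
    proof
      fix x assume x: "x \<in> {x. p x \<noteq> x}"
      then have "x \<in> rays n" using permutes_not_in[OF perm, of x] by blast
      then show "x \<in> (SIGMA i:{1..n}. {..<M i})"
        using x M[of "fst x" "snd x"] by (cases x) (force simp: rays_def not_less)
    qed
    then have "finite {x. p x \<noteq> x}" by (rule finite_subset) auto
    then show "p \<in> fsym (rays n)" using perm by (simp add: fsym_def)
  next
    fix p assume p: "p \<in> fsym (rays n)"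
    then have "translation p i = 0" for i
      by (intro translation_eq translates_finite_support) (simp add: fsym_def)
    then show "p \<in> kernel ?H ?Z \<phi>"
      using p fsym_subset_houghton[OF n]
      by (auto simp: kernel_def int_power_group_def product_group_def \<phi>_def)
  qed
  ultimately show ?thesis using hom on_shifts by (auto simp: houghton_projections_def epi_def)
qed

end

(*
  Write X for the set of points of the n rays. A subgroup U of finite index contains every even finitary
  permutation: otherwise pigeonholing transpositions over the cosets of U would produce an element that
  breaks the equivalence relation "x and y lie on a common 3-cycle of U". Two elements whose supports
  meet in a single point have a 3-cycle as commutator, so a group containing suitably placed elements
  contains all 3-cycles.

  For n >= 3 take u, v, ... in U with triangular translation vectors that generate U modulo the finitary
  permutations. Multiplying u by an even finitary permutation removes all its finite orbits, and
  multiplying v by an even cycle supported far out on the orbits of u then forces the group generated by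
  u and v to contain the finitary alternating group. So n - 1 elements generate U, except possibly for
  one odd finitary permutation. That one is superfluous if some commutator of U is odd; the parity of a
  commutator is the scalar product of the translation vectors modulo 2, which gives condition (ii).
  Conversely, if U contains FSym(X) and all its commutators are even, then U modulo squares and even
  finitary permutations is elementary abelian of order 2^n, so n generators are needed.

  For n = 2 the rays form a line on which a power of the shift, possibly corrected by a transposition,
  and one finite cycle generate U.
*)
theory Submission
  imports Defs
begin

text \<open>Only even finitary permutations are known to lie in U, so every correction of a
  generator has to be even. Each construction therefore carries a spare move that changes nothing
  but a parity. For a cycle it is one more point, placed where it causes no new overlap of supports.
  For the removal of finite orbits it is the exchange of the forward tails of two orbits that leave
  along different rays. This is why the leading translation vector is made positive on all rays but
  the first, and why two rays are treated apart: a shift with a single infinite orbit has no second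
  tail, and a transposition correcting its parity splits off a finite orbit. Generators commute
  modulo finitary permutations, but their commutator is otherwise uncontrolled. Once the finite
  orbits are gone, there are finitely many orbits, all infinite, with room on each beyond the
  support of that commutator. A class of the 3-cycle relation that is stable under u and meets all
  orbits is then the whole of X. The lower bounds are counting arguments: a set of k generators
  bounds the number of functionals, or of classes modulo squares, by a power with exponent
  k.\<close>

abbreviation finv :: "('a \<Rightarrow> 'a) \<Rightarrow> 'a \<Rightarrow> 'a" where
  "finv \<equiv> inv_into UNIV"

section \<open>Groups of bijections and their 3-cycles\<close>

lemma conj_transpose:
  assumes "bij p"
  shows "p \<circ> transpose x y \<circ> finv p = transpose (p x) (p y)"
proof
  fix z
  obtain w where "z = p w" using assms by (meson bij_pointE)
  then show "(p \<circ> transpose x y \<circ> finv p) z = transpose (p x) (p y) z"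
    using assms by (auto simp: transpose_def bij_def inj_eq)
qed

text \<open>A subgroup of the symmetric group of \<open>X\<close>, kept as a bare set of functions.
  It serves for U, for an arbitrary group \<Gamma> containing given generators, and for sets of
  elements cut out by a property, where it replaces induction over a generated subgroup.\<close>

locale bij_group =
  fixes X :: "'a set" and \<Gamma> :: "('a \<Rightarrow> 'a) set"
  assumes permutes_mem: "p \<in> \<Gamma> \<Longrightarrow> p permutes X"
    and id_mem: "id \<in> \<Gamma>"
    and comp_mem: "p \<in> \<Gamma> \<Longrightarrow> q \<in> \<Gamma> \<Longrightarrow> p \<circ> q \<in> \<Gamma>"
    and inv_mem: "p \<in> \<Gamma> \<Longrightarrow> finv p \<in> \<Gamma>"
begin

lemma bij_mem: "p \<in> \<Gamma> \<Longrightarrow> bij p"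
  using permutes_mem permutes_bij by blast

text \<open>Functions compose right to left, so the product is the cycle \<open>x\<close> to
  \<open>y\<close> to \<open>z\<close> to \<open>x\<close>.\<close>

definition three :: "'a \<Rightarrow> 'a \<Rightarrow> 'a \<Rightarrow> bool" where
  "three x y z \<longleftrightarrow> distinct [x, y, z] \<and> transpose x y \<circ> transpose y z \<in> \<Gamma>"

definition conn :: "'a \<Rightarrow> 'a \<Rightarrow> bool" where
  "conn x y \<longleftrightarrow> x = y \<or> (\<exists>z. three x y z)"

lemma power_mem: "p \<in> \<Gamma> \<Longrightarrow> p ^^ k \<in> \<Gamma>"
  by (induction k) (auto simp: id_mem comp_mem)

lemma three_rotate: "three x y z \<Longrightarrow> three y z x"
proof -
  assume "three x y z"
  moreover from this have "transpose y z \<circ> transpose z x = transpose x y \<circ> transpose y z"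
    by (auto simp: three_def transpose_def fun_eq_iff)
  ultimately show ?thesis by (auto simp: three_def)
qed

text \<open>The square of a 3-cycle is its inverse.\<close>

lemma three_swap: "three x y z \<Longrightarrow> three y x z"
proof -
  assume *: "three x y z"
  then have "transpose y x \<circ> transpose x z
      = (transpose x y \<circ> transpose y z) \<circ> (transpose x y \<circ> transpose y z)"
    by (auto simp: three_def transpose_def fun_eq_iff)
  with * comp_mem show ?thesis by (auto simp: three_def)
qed

lemma three_conj:
  assumes "three x y z" "p \<in> \<Gamma>"
  shows "three (p x) (p y) (p z)"
proof -
  have b: "bij p" using assms bij_mem by blast
  have "p \<circ> (transpose x y \<circ> transpose y z) \<circ> finv p
      = (p \<circ> transpose x y \<circ> finv p) \<circ> (p \<circ> transpose y z \<circ> finv p)"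
    using b by (auto simp: fun_eq_iff bij_def)
  also have "\<dots> = transpose (p x) (p y) \<circ> transpose (p y) (p z)"
    by (simp only: conj_transpose[OF b])
  finally have "transpose (p x) (p y) \<circ> transpose (p y) (p z) \<in> \<Gamma>"
    using assms comp_mem inv_mem by (metis three_def)
  with assms b show ?thesis by (auto simp: three_def bij_def inj_eq)
qed

lemma three_conj_three:
  assumes "three x y z" "three a b c"
  defines "p \<equiv> (\<lambda>w. if w = a then b else if w = b then c else if w = c then a else w)"
  shows "three (p x) (p y) (p z)"
proof -
  have "p = transpose a b \<circ> transpose b c"
    using assms by (auto simp: three_def transpose_def fun_eq_iff)
  with assms(2) have "p \<in> \<Gamma>" by (simp add: three_def)
  with assms(1) show ?thesis by (rule three_conj)
qed

section \<open>The equivalence relation of lying on a common 3-cycle\<close>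

lemma conn_refl [simp]: "conn x x"
  by (simp add: conn_def)

lemma conn_sym: "conn x y \<Longrightarrow> conn y x"
  unfolding conn_def by (metis three_swap)

lemma conn_image: "conn x y \<Longrightarrow> p \<in> \<Gamma> \<Longrightarrow> conn (p x) (p y)"
  unfolding conn_def by (metis three_conj)

text \<open>Unless \<open>x\<close> and \<open>w\<close> already share one of the two cycles,
  conjugating the cycle through \<open>x\<close> and \<open>y\<close> by the one through
  \<open>y\<close> and \<open>w\<close> fixes \<open>x\<close> and carries \<open>y\<close> to
  \<open>w\<close>.\<close>

lemma conn_trans:
  assumes "conn x y" "conn y w"
  shows "conn x w"
proof (cases "x = y \<or> y = w \<or> x = w")
  case True
  with assms show ?thesis by auto
next
  case False
  with assms obtain z v where z: "three x y z" and v: "three y w v"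
    by (auto simp: conn_def)
  show ?thesis
  proof (cases "z = w \<or> v = x")
    case True
    then show ?thesis using z v three_rotate three_swap by (metis conn_def)
  next
    case False
    then have "three x w (if z = v then y else z)"
      using three_conj_three[OF z v] \<open>\<not> (x = y \<or> y = w \<or> x = w)\<close> z v
      by (auto simp: three_def split: if_splits)
    then show ?thesis by (auto simp: conn_def)
  qed
qed

text \<open>A cycle of \<Gamma> taking \<open>w\<close> to \<open>z\<close> conjugates the cycle of
  \<open>x\<close>, \<open>y\<close>, \<open>w\<close> into the wanted one if its third point
  \<open>u\<close> avoids \<open>x\<close> and \<open>y\<close>. If \<open>u\<close> is one of them,
  the conjugate has lost that point, and conjugating once more by the original cycle or its inverse
  brings it back with reversed orientation.\<close>

lemma three_of_conn:
  assumes "conn x y" "conn w z" "three x y w" "distinct [x, y, z]" "w \<noteq> z"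
  shows "three x y z"
proof -
  obtain u where u: "three w z u" using assms by (auto simp: conn_def)
  consider "u = x" | "u = y" | "u \<noteq> x" "u \<noteq> y" by blast
  then show ?thesis
  proof cases
    case 1
    have 2: "three w y z"
      using three_conj_three[OF assms(3) u] u 1 assms(3,4,5) by (auto simp: three_def split: if_splits)
    have "three y x z"
      using three_conj_three[OF 2 three_swap[OF assms(3)]] 2 assms(3-5)
      by (auto simp: three_def split: if_splits)
    then show ?thesis by (rule three_swap)
  next
    case 2
    have 3: "three x w z"
      using three_conj_three[OF assms(3) u] u 2 assms(3,4,5) by (auto simp: three_def split: if_splits)
    have "three y x z"
      using three_conj_three[OF 3 assms(3)] 3 assms(3-5)
      by (auto simp: three_def split: if_splits)
    then show ?thesis by (rule three_swap)
  next
    case 3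
    have "three x y z"
      using three_conj_three[OF assms(3) u] u 3 assms(3,4,5) by (auto simp: three_def split: if_splits)
    then show ?thesis .
  qed
qed

lemma three_all:
  assumes "\<forall>x\<in>X. \<forall>y\<in>X. conn x y"
    and "x \<in> X" "y \<in> X" "z \<in> X" "distinct [x, y, z]"
  shows "three x y z"
proof -
  obtain w where w: "three x y w" using assms by (auto simp: conn_def)
  then have "transpose x y \<circ> transpose y w permutes X" by (auto simp: three_def intro: permutes_mem)
  moreover have "(transpose x y \<circ> transpose y w) w \<noteq> w"
    using w by (auto simp: three_def transpose_def)
  ultimately have "w \<in> X" by (metis permutes_not_in)
  then show ?thesis
    using three_of_conn[of x y w z] w assms by auto
qed

text \<open>Induction on the size of the support: a 3-cycle sending \<open>p x\<close> back to
  \<open>x\<close> makes \<open>x\<close> a fixed point of the product and moves nothing outside the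
  support of \<open>p\<close>. A third point for the cycle exists because an even permutation other
  than the identity is not a transposition.\<close>

lemma finite_even_mem:
  assumes c: "\<forall>x\<in>X. \<forall>y\<in>X. conn x y"
    and "p \<in> fsym X" "evenperm p"
  shows "p \<in> \<Gamma>"
  using assms(2,3)
proof (induction "card {x. p x \<noteq> x}" arbitrary: p rule: less_induct)
  case less
  have pX: "p permutes X" and fin: "finite {x. p x \<noteq> x}" using less.prems by (auto simp: fsym_def)
  have perm: "permutation p" using fin pX permutes_bij permutation by blast
  show ?case
  proof (cases "p = id")
    case True then show ?thesis by (simp add: id_mem)
  next
    case False
    then obtain x where x: "p x \<noteq> x" by (auto simp: fun_eq_iff)
    define y where "y = p x"
    have inj: "inj p" using pX permutes_inj by blast
    have "\<exists>z. p z \<noteq> z \<and> z \<noteq> x \<and> z \<noteq> y"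
    proof (rule ccontr)
      assume "\<not> ?thesis"
      then have other: "p z = z" if "z \<noteq> x" "z \<noteq> y" for z using that by blast
      have py: "p y = x"
        by (metis x other inj inj_eq y_def)
      have "p = transpose x y"
      proof
        fix w
        show "p w = transpose x y w"
          using other[of w] py y_def[symmetric] unfolding transpose_def by presburger
      qed
      with less.prems(2) x show False by (metis evenperm_swap y_def)
    qed
    then obtain z where z: "p z \<noteq> z" "z \<noteq> x" "z \<noteq> y" by blast
    have py: "p y \<noteq> y" using x inj by (auto simp: y_def inj_eq)
    have X: "x \<in> X" "y \<in> X" "z \<in> X" using pX x py z by (metis permutes_not_in)+
    define q where "q = transpose y x \<circ> transpose x z"
    have "distinct [y, x, z]" using x z y_def by auto
    then have t: "three y x z" by (rule three_all[OF c X(2,1,3)])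
    then have q: "q \<in> \<Gamma>" by (simp add: q_def three_def)
    have tp: "permutation (transpose y x)" "permutation (transpose x z)"
      by (simp_all add: permutation_swap_id)
    have "evenperm q"
      unfolding q_def evenperm_comp[OF tp] evenperm_swap using x z(2) y_def by metis
    moreover have pq: "permutation q" unfolding q_def by (rule permutation_compose[OF tp])
    ultimately have ev: "evenperm (q \<circ> p)" using less.prems(2) evenperm_comp[OF pq perm] by blast
    have qX: "q permutes X" unfolding q_def using X by (intro permutes_compose permutes_swap_id)
    have sub: "{w. (q \<circ> p) w \<noteq> w} \<subseteq> {w. p w \<noteq> w} - {x}"
      using x py z unfolding q_def y_def by (auto simp: transpose_def split: if_splits)
    have "card {w. (q \<circ> p) w \<noteq> w} < card {w. p w \<noteq> w}"
      by (rule psubset_card_mono[OF fin]) (use sub x in auto)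
    moreover have "q \<circ> p \<in> fsym X"
      unfolding fsym_def using permutes_compose[OF pX qX] finite_subset[OF sub] fin by auto
    ultimately have "q \<circ> p \<in> \<Gamma>" using ev by (intro less.hyps)
    with q have "finv q \<circ> (q \<circ> p) \<in> \<Gamma>" using comp_mem inv_mem by blast
    moreover have "finv q \<circ> (q \<circ> p) = p"
      using bij_mem[OF q] by (auto simp: fun_eq_iff bij_def)
    ultimately show ?thesis by simp
  qed
qed

section \<open>3-cycles from supports that meet in one point\<close>

lemma conn_of_single_meet:
  assumes "\<alpha> \<in> \<Gamma>" "\<beta> \<in> \<Gamma>" and meet: "{x. \<alpha> x \<noteq> x} \<inter> {x. \<beta> x \<noteq> x} = {p}"
  shows "conn p (\<alpha> p)"
proof -
  define a b where "a = finv \<alpha>" and "b = finv \<beta>"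
  have b\<alpha>: "bij \<alpha>" "bij \<beta>" using assms bij_mem by auto
  have inv: "\<alpha> (a x) = x" "a (\<alpha> x) = x" "\<beta> (b x) = x" "b (\<beta> x) = x" for x
    using b\<alpha> by (auto simp: a_def b_def bij_def surj_f_inv_f)
  have p: "\<alpha> p \<noteq> p" "\<beta> p \<noteq> p" using meet by auto
  have m: "\<beta> x = x" if "\<alpha> x \<noteq> x" "x \<noteq> p" for x using meet that by auto
  \<comment> \<open>The commutator is the cycle \<open>p\<close> to \<open>\<alpha> p\<close> to
    \<open>\<beta> p\<close>; at every other point each map cancels against its inverse.\<close>
  have "\<alpha> \<circ> \<beta> \<circ> a \<circ> b = transpose p (\<alpha> p) \<circ> transpose (\<alpha> p) (\<beta> p)"
  proof
    fix x
    show "(\<alpha> \<circ> \<beta> \<circ> a \<circ> b) x = (transpose p (\<alpha> p) \<circ> transpose (\<alpha> p) (\<beta> p)) x"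
      unfolding transpose_def o_def by (smt (verit, ccfv_threshold) inv p m)
  qed
  moreover have "\<alpha> \<circ> \<beta> \<circ> a \<circ> b \<in> \<Gamma>" using assms by (auto simp: a_def b_def intro!: comp_mem inv_mem)
  moreover have "\<alpha> p \<noteq> \<beta> p" using p m inv by metis
  ultimately have "three p (\<alpha> p) (\<beta> p)" using p by (auto simp: three_def)
  then show ?thesis by (auto simp: conn_def)
qed

lemma conn_closed:
  assumes "\<alpha> \<in> \<Gamma>" "conn p (\<alpha> p)" "conn p x"
  shows "conn p (\<alpha> x)"
  using assms conn_image conn_trans by blast

lemma conn_invariant:
  assumes "u \<in> \<Gamma>" "conn p (u p)"
  shows "conn p (u x) \<longleftrightarrow> conn p x"
proof
  have inv: "finv u (u y) = y" for y using bij_mem[OF assms(1)] by (simp add: bij_def)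
  assume "conn p (u x)"
  moreover have "conn (finv u p) p"
    using conn_image[OF assms(2) inv_mem[OF assms(1)]] inv by simp
  ultimately show "conn p x"
    using conn_image[of p "u x" "finv u"] inv_mem[OF assms(1)] inv conn_sym conn_trans by metis
qed (metis assms conn_closed)

text \<open>The class of \<open>p\<close> is invariant under \<open>u\<close> in both directions.
  The assumption \<open>orbits\<close> expresses that the orbits of \<open>u\<close> through
  \<open>S\<close> exhaust \<open>X\<close>, phrased with invariant sets so that finite and infinite
  orbits are handled alike.\<close>

lemma finite_even_mem_of_class:
  assumes "u \<in> \<Gamma>" "conn p (u p)" "S \<subseteq> {x. conn p x}"
    and orbits: "\<And>C. S \<subseteq> C \<Longrightarrow> (\<And>x. u x \<in> C \<longleftrightarrow> x \<in> C) \<Longrightarrow> X \<subseteq> C"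
    and "f \<in> fsym X" "evenperm f"
  shows "f \<in> \<Gamma>"
proof -
  have "X \<subseteq> {x. conn p x}"
    using assms(3) conn_invariant[OF assms(1,2)] by (intro orbits) auto
  then have "\<forall>x\<in>X. \<forall>y\<in>X. conn x y" using conn_sym conn_trans by blast
  then show ?thesis using assms(5,6) by (rule finite_even_mem)
qed

end

section \<open>Cycles on finite sets\<close>

text \<open>For a permutation of a finite set this means a single cycle. The form with
  forward-closed sets is the induction principle by which a class of \<open>conn\<close> spreads
  over the support.\<close>

definition transitive_on :: "('a \<Rightarrow> 'a) \<Rightarrow> 'a set \<Rightarrow> bool" where
  "transitive_on s S \<longleftrightarrow> (\<forall>C. C \<inter> S \<noteq> {} \<longrightarrow> (\<forall>x\<in>C \<inter> S. s x \<in> C) \<longrightarrow> S \<subseteq> C)"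

lemma transitive_onD:
  "transitive_on s S \<Longrightarrow> x \<in> C \<Longrightarrow> x \<in> S \<Longrightarrow> (\<And>y. y \<in> C \<Longrightarrow> y \<in> S \<Longrightarrow> s y \<in> C) \<Longrightarrow> S \<subseteq> C"
  unfolding transitive_on_def by blast

lemma transitive_on_moves:
  assumes "transitive_on s S" "x \<in> S" "y \<in> S" "y \<noteq> x"
  shows "s x \<noteq> x"
  using transitive_onD[OF assms(1), of x "{x}"] assms by auto

text \<open>Composing with \<open>transpose a b\<close> splices \<open>a\<close> into the cycle: the
  predecessor of \<open>b\<close> now goes to \<open>a\<close>, and \<open>a\<close> goes to
  \<open>b\<close>. Each splice flips the parity.\<close>

lemma cycle_exists:
  assumes "finite S" "S \<noteq> {}"
  shows "\<exists>s. s permutes S \<and> (evenperm s \<longleftrightarrow> odd (card S)) \<and> transitive_on s S"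
  using assms
proof (induction S rule: finite_ne_induct)
  case (singleton x)
  show ?case by (rule exI[of _ id]) (auto simp: transitive_on_def permutes_id evenperm_id)
next
  case (insert a F)
  then obtain s where s: "s permutes F" "evenperm s \<longleftrightarrow> odd (card F)" "transitive_on s F" by blast
  obtain b where b: "b \<in> F" using insert by blast
  define t where "t = transpose a b \<circ> s"
  have sa: "s a = a" using s(1) insert by (simp add: permutes_not_in)
  have "t permutes insert a F"
    unfolding t_def using b s(1) by (intro permutes_compose permutes_swap_id) (auto intro: permutes_subset)
  moreover have "evenperm t \<longleftrightarrow> odd (card (insert a F))"
    unfolding t_def using s insert b
    by (subst evenperm_comp) (auto simp: permutation_swap_id evenperm_swap intro: permutes_imp_permutation)
  moreover have "transitive_on t (insert a F)"
    unfolding transitive_on_def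
  proof (intro allI impI)
    fix C assume C: "C \<inter> insert a F \<noteq> {}" and cl: "\<forall>x\<in>C \<inter> insert a F. t x \<in> C"
    have ta: "t a = b" by (simp add: t_def sa)
    have "\<exists>x\<in>C. x \<in> F" using C cl ta b by auto
    then obtain x where x: "x \<in> C" "x \<in> F" by blast
    have F: "F \<subseteq> C"
    proof (rule transitive_onD[OF s(3) x])
      fix y assume y: "y \<in> C" "y \<in> F"
      have sy: "s y \<in> F" using y s(1) by (simp add: permutes_in_image)
      have "t y \<in> C" using cl y by blast
      then show "s y \<in> C"
        using sy insert.hyps cl ta unfolding t_def
        by (auto simp: transpose_def split: if_splits)
    qed
    obtain y where "y \<in> F" "s y = b" using b s(1) by (metis permutes_def permutes_in_image)
    then have "t y = a" by (simp add: t_def)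
    then have "a \<in> C" using cl F \<open>y \<in> F\<close> by (metis IntI insertCI subsetD)
    with F show "insert a F \<subseteq> C" by blast
  qed
  ultimately show ?case by blast
qed

context bij_group begin

text \<open>The supports of \<open>s\<close> and of its conjugate by \<open>u\<close> are
  \<open>S\<close> and the image of \<open>S\<close>, which meet only in \<open>p\<close>; so the
  class of \<open>p\<close> spreads over \<open>S\<close>. The preimage of \<open>p\<close> under
  \<open>u\<close> lies in \<open>S\<close> too, which links \<open>p\<close> to \<open>u p\<close>
  and makes the class invariant.\<close>

lemma finite_even_mem_of_cycle:
  assumes "u \<in> \<Gamma>" "s \<in> \<Gamma>" "s permutes S" "transitive_on s S" "S \<inter> u ` S = {p}" "u p \<noteq> p"
    and orbits: "\<And>C. S \<subseteq> C \<Longrightarrow> (\<And>x. u x \<in> C \<longleftrightarrow> x \<in> C) \<Longrightarrow> X \<subseteq> C"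
    and "f \<in> fsym X" "evenperm f"
  shows "f \<in> \<Gamma>"
proof -
  have bu: "bij u" using assms bij_mem by blast
  obtain q where q: "q \<in> S" "p = u q" "p \<in> S" using assms(5) by blast
  then have "q \<noteq> p" using assms(6) bu by (metis bij_def inj_eq)
  have mv: "s x \<noteq> x" if "x \<in> S" for x
    using transitive_on_moves[OF assms(4) that] q \<open>q \<noteq> p\<close> by blast
  then have 1: "{x. s x \<noteq> x} = S" using assms(3) by (auto simp: permutes_def)
  have 2: "{x. (u \<circ> s \<circ> finv u) x \<noteq> x} = u ` S"
  proof (rule Set.set_eqI)
    fix x obtain y where y: "x = u y" using bu by (meson bij_pointE)
    have "(u \<circ> s \<circ> finv u) x = u (s y)" using bu by (simp add: y bij_def)
    then show "x \<in> {x. (u \<circ> s \<circ> finv u) x \<noteq> x} \<longleftrightarrow> x \<in> u ` S"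
      using bu 1 by (auto simp: y bij_def inj_eq inj_image_mem_iff)
  qed
  have "conn p (s p)"
    by (rule conn_of_single_meet[of s "u \<circ> s \<circ> finv u"])
       (use assms 1 2 in \<open>auto intro!: comp_mem inv_mem\<close>)
  then have S: "S \<subseteq> {x. conn p x}"
    by (intro transitive_onD[OF assms(4), of p]) (use q assms conn_closed in auto)
  then have "conn q p" using q conn_sym by blast
  then have "conn p (u p)" using conn_image[OF _ assms(1)] q by auto
  then show ?thesis
    using S by (rule finite_even_mem_of_class[OF assms(1)]) (use assms in auto)
qed

end

section \<open>Orbits\<close>

lemma funpow_inj_on_exponent:
  assumes "inj u" "\<And>k. k > 0 \<Longrightarrow> (u ^^ k) x \<noteq> x" "(u ^^ a) x = (u ^^ b) x"
  shows "a = b"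
proof -
  have *: "a = b" if "a \<le> b" "(u ^^ a) x = (u ^^ b) x" for a b
  proof (rule ccontr)
    assume "a \<noteq> b"
    have "(u ^^ a) ((u ^^ (b - a)) x) = (u ^^ b) x"
      using that(1) by (metis comp_apply funpow_add le_add_diff_inverse)
    then have "(u ^^ (b - a)) x = x"
      using that(2) inj_fn[OF assms(1), of a] by (metis inj_eq)
    then show False using assms(2)[of "b - a"] that(1) \<open>a \<noteq> b\<close> by simp
  qed
  show ?thesis using *[of a b] *[of b a] assms(3) by (cases "a \<le> b") auto
qed

lemma funpow_apply_add: "(u ^^ a) ((u ^^ b) x) = (u ^^ (a + b)) x"
  by (simp add: funpow_add)

text \<open>Every orbit of \<open>u\<close> is a copy of the integers with one base point in
  \<open>B\<close>, and \<open>x\<close> is reached from \<open>rep x\<close> by the power of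
  \<open>u\<close> with exponent \<open>pos x\<close>. Two natural exponents in
  \<open>rep_reach\<close> avoid negative powers.\<close>

locale orbit_coordinates =
  fixes X :: "'a set" and u :: "'a \<Rightarrow> 'a" and B :: "'a set" and rep :: "'a \<Rightarrow> 'a" and pos :: "'a \<Rightarrow> int"
  assumes u_permutes: "u permutes X"
    and fin_B: "finite B"
    and B_subset: "B \<subseteq> X"
    and rep_mem: "x \<in> X \<Longrightarrow> rep x \<in> B"
    and rep_step: "x \<in> X \<Longrightarrow> rep (u x) = rep x"
    and pos_step: "x \<in> X \<Longrightarrow> pos (u x) = pos x + 1"
    and coordinates_inj: "x \<in> X \<Longrightarrow> y \<in> X \<Longrightarrow> rep x = rep y \<Longrightarrow> pos x = pos y \<Longrightarrow> x = y"
    and rep_base: "b \<in> B \<Longrightarrow> rep b = b"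
    and pos_base: "b \<in> B \<Longrightarrow> pos b = 0"
    and rep_reach: "x \<in> X \<Longrightarrow> \<exists>i j. (u ^^ i) x = (u ^^ j) (rep x)"

lemma orbit_coordinates_exist:
  assumes u: "u permutes X" and F: "finite F" "F \<subseteq> X"
    and inf: "\<And>x k. x \<in> X \<Longrightarrow> k > 0 \<Longrightarrow> (u ^^ k) x \<noteq> x"
    and cover: "\<And>x. x \<in> X \<Longrightarrow> \<exists>b\<in>F. \<exists>i j. (u ^^ i) x = (u ^^ j) b"
  shows "\<exists>B rep pos. orbit_coordinates X u B rep pos"
proof -
  have inj: "inj u" using u permutes_inj by blast
  define same where "same x y \<longleftrightarrow> (\<exists>i j. (u ^^ i) x = (u ^^ j) y)" for x y
  have same_sym: "same x y \<Longrightarrow> same y x" for x y unfolding same_def by metis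
  have same_trans: "same x z" if "same x y" "same y z" for x y z
  proof -
    obtain i j k l where "(u ^^ i) x = (u ^^ j) y" "(u ^^ k) y = (u ^^ l) z"
      using \<open>same x y\<close> \<open>same y z\<close> unfolding same_def by blast
    then have "(u ^^ (k + i)) x = (u ^^ (j + l)) z"
      by (metis funpow_apply_add add.commute)
    then show ?thesis unfolding same_def by blast
  qed
  define rep where "rep x = (SOME b. b \<in> F \<and> same x b)" for x
  have rep: "rep x \<in> F \<and> same x (rep x)" if "x \<in> X" for x
  proof -
    have "\<exists>b. b \<in> F \<and> same x b" using cover[OF that] unfolding same_def by blast
    then show ?thesis unfolding rep_def by (rule someI_ex)
  qed
  have rep_eq: "rep x = rep y" if "same x y" for x y
  proof -
    \<comment> \<open>Equal predicates give the same value of the choice operator, so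
      \<open>rep\<close> is constant on orbits.\<close>
    have "same x = same y" using that same_sym same_trans by blast
    then show ?thesis by (simp add: rep_def)
  qed
  define pos where "pos x = (SOME k. \<exists>i j. (u ^^ i) x = (u ^^ j) (rep x) \<and> k = int j - int i)" for x
  have pos: "\<exists>i j. (u ^^ i) x = (u ^^ j) (rep x) \<and> pos x = int j - int i" if "x \<in> X" for x
  proof -
    have "\<exists>i j. (u ^^ i) x = (u ^^ j) (rep x)" using rep[OF that] by (simp add: same_def)
    then have "\<exists>k i j. (u ^^ i) x = (u ^^ j) (rep x) \<and> k = int j - int i" by blast
    then show ?thesis unfolding pos_def by (rule someI_ex)
  qed
  have repX: "rep x \<in> X" if "x \<in> X" for x using rep[OF that] F by blast
  have pos_eq: "pos x = int j - int i" if x: "x \<in> X" and ij: "(u ^^ i) x = (u ^^ j) (rep x)" for x i j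
  proof -
    obtain k l where kl: "(u ^^ k) x = (u ^^ l) (rep x)" "pos x = int l - int k"
      using pos[OF x] by blast
    have "(u ^^ (k + j)) (rep x) = (u ^^ (i + l)) (rep x)"
      by (metis ij kl(1) funpow_apply_add add.commute)
    then have "k + j = i + l" using inf[OF repX[OF x]] by (intro funpow_inj_on_exponent[OF inj]) auto
    then show ?thesis using kl by linarith
  qed
  have uX: "u x \<in> X" if "x \<in> X" for x using u that by (simp add: permutes_in_image)
  have step: "same x (u x)" for x unfolding same_def by (rule exI[of _ 1], rule exI[of _ 0]) simp
  \<comment> \<open>The chosen representatives form the base set, since \<open>F\<close> itself may
    contain several points of one orbit.\<close>
  have "orbit_coordinates X u (rep ` F) rep pos"
  proof
    fix x assume x: "x \<in> X"
    have rr: "rep (rep x) = rep x" using rep_eq rep[OF x] same_sym by metis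
    then show "rep x \<in> rep ` F" using rep[OF x] by (metis imageI)
    show r: "rep (u x) = rep x" using rep_eq step same_sym by metis
    show "\<exists>i j. (u ^^ i) x = (u ^^ j) (rep x)" using pos[OF x] by blast
    obtain i j where ij: "(u ^^ i) x = (u ^^ j) (rep x)" "pos x = int j - int i"
      using pos[OF x] by blast
    have "(u ^^ i) (u x) = (u ^^ Suc j) (rep (u x))"
      using ij(1) by (simp add: r flip: funpow_swap1)
    from pos_eq[OF uX[OF x] this] show "pos (u x) = pos x + 1" using ij(2) by simp
    fix y assume y: "y \<in> X" and eq: "rep x = rep y" "pos x = pos y"
    obtain k l where kl: "(u ^^ k) y = (u ^^ l) (rep y)" "pos y = int l - int k"
      using pos[OF y] by blast
    have e: "i + l = k + j" using eq ij kl by linarith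
    have "(u ^^ (l + i)) x = (u ^^ (j + k)) y"
      by (metis eq(1) ij(1) kl(1) funpow_apply_add add.commute)
    then have "(u ^^ (l + i)) x = (u ^^ (l + i)) y" using e by (simp add: add.commute)
    then show "x = y" using inj_fn[OF inj] by (metis inj_eq)
  next
    fix b assume "b \<in> rep ` F"
    then obtain f where f: "f \<in> F" "b = rep f" by blast
    then show rb: "rep b = b" using rep[of f] F rep_eq same_sym by (metis subsetD)
    have "b \<in> X" using f F repX by auto
    from pos_eq[OF this, of 0 0] rb show "pos b = 0" by simp
  qed (use u F repX in auto)
  then show ?thesis by blast
qed

context orbit_coordinates begin

lemma point_mem: "b \<in> B \<Longrightarrow> (u ^^ k) b \<in> X"
  using B_subset u_permutes by (induction k) (auto simp: permutes_in_image)

lemma rep_power: "x \<in> X \<Longrightarrow> (u ^^ k) x \<in> X \<and> rep ((u ^^ k) x) = rep x \<and> pos ((u ^^ k) x) = pos x + int k"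
  using u_permutes by (induction k) (auto simp: permutes_in_image rep_step pos_step)

lemma rep_point: "b \<in> B \<Longrightarrow> rep ((u ^^ k) b) = b"
  using rep_power[of b k] B_subset rep_base by auto

lemma pos_point: "b \<in> B \<Longrightarrow> pos ((u ^^ k) b) = int k"
  using rep_power[of b k] B_subset pos_base by auto

lemma invariant_covers:
  assumes "\<And>x. u x \<in> C \<longleftrightarrow> x \<in> C" "\<And>b. b \<in> B \<Longrightarrow> (u ^^ N) b \<in> C"
  shows "X \<subseteq> C"
proof
  fix x assume x: "x \<in> X"
  have pow: "(u ^^ k) y \<in> C \<longleftrightarrow> y \<in> C" for k y by (induction k) (auto simp: assms(1))
  obtain i j where "(u ^^ i) x = (u ^^ j) (rep x)" using rep_reach[OF x] by blast
  then show "x \<in> C" using pow assms(2)[OF rep_mem[OF x]] by metis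
qed

text \<open>
  The cycle \<open>\<sigma>\<close> lives far out on the orbits of \<open>u\<close>, and its support meets every orbit. Since the gaps
  on the orbit of \<open>b0\<close> are chosen sparse, the supports of \<open>\<alpha> = [\<sigma> \<circ> v, u]\<close> and of its conjugate by
  \<open>u ^^ (d - 1)\<close> meet in a single point.
\<close>

lemma second_generator:
  assumes v: "v permutes X" and fin: "finite {x. (v \<circ> u \<circ> finv v \<circ> finv u) x \<noteq> x}" and "B \<noteq> {}"
  shows "\<exists>\<sigma>. \<sigma> \<in> fsym X \<and> evenperm \<sigma> \<and>
    (\<forall>\<Gamma>. bij_group X \<Gamma> \<longrightarrow> u \<in> \<Gamma> \<longrightarrow> \<sigma> \<circ> v \<in> \<Gamma> \<longrightarrow> {f \<in> fsym X. evenperm f} \<subseteq> \<Gamma>)"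
proof -
  define \<kappa> where "\<kappa> = v \<circ> u \<circ> finv v \<circ> finv u"
  define K where "K = {x. \<kappa> x \<noteq> x}"
  have \<kappa>X: "\<kappa> permutes X" unfolding \<kappa>_def using v u_permutes
    by (intro permutes_compose permutes_inv)
  have KX: "K \<subseteq> X" using \<kappa>X by (auto simp: K_def permutes_def)
  have finK: "finite K" using fin by (simp add: K_def \<kappa>_def)
  have "\<exists>N::nat. \<forall>x\<in>K. \<bar>pos x\<bar> < int N"
  proof -
    have "finite ((\<lambda>x. nat \<bar>pos x\<bar>) ` K)" using finK by simp
    then obtain M where "\<forall>k\<in>(\<lambda>x. nat \<bar>pos x\<bar>) ` K. k < M" by (meson finite_nat_set_iff_bounded)
    then show ?thesis by (intro exI[of _ M]) (auto simp: nat_less_iff)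
  qed
  then obtain N :: nat where N: "\<And>x. x \<in> K \<Longrightarrow> \<bar>pos x\<bar> < int N" by blast
  \<comment> \<open>A shift by \<open>d - 1\<close> moves all positions between \<open>- N\<close>
    and \<open>N + 1\<close> clear of that window, and takes \<open>N + 1\<close> exactly to
    \<open>N + d\<close>.\<close>
  define d where "d = 2 * N + 6"
  obtain b0 where b0: "b0 \<in> B" using \<open>B \<noteq> {}\<close> by blast
  define pt where "pt b k = (u ^^ k) b" for b k
  have pt: "pt b k \<in> X" "rep (pt b k) = b" "pos (pt b k) = int k" if "b \<in> B" for b k
    using that by (auto simp: pt_def point_mem rep_point pos_point)
  \<comment> \<open>Position \<open>N\<close> makes the cycle meet every orbit just beyond the
    support of \<kappa>. Position \<open>N + d\<close> creates the single meeting point. Position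
    \<open>N + 3 * d + 1\<close> later upgrades invariance under \<open>u ^^ d\<close> to invariance
    under \<open>u\<close>.\<close>
  define S0 where "S0 = (\<lambda>b. pt b N) ` B \<union> {pt b0 (N + d), pt b0 (N + 3 * d + 1)}"
  \<comment> \<open>The point at \<open>N + 9 * d\<close> is the parity switch: an odd number of
    points makes the cycle even.\<close>
  define S where "S = (if odd (card S0) then S0 else insert (pt b0 (N + 9 * d)) S0)"
  have S_pos: "x \<in> X \<and> (pos x = int N \<or> rep x = b0 \<and>
      pos x \<in> {int (N + d), int (N + 3 * d + 1), int (N + 9 * d)})" if "x \<in> S" for x
    using that b0 by (auto simp: S_def S0_def pt split: if_splits)
  have "pos x \<in> {int N, int (N + d), int (N + 3 * d + 1)}" if "x \<in> S0" for x
    using that b0 pt(3) unfolding S0_def by blast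
  moreover have "pos (pt b0 (N + 9 * d)) \<notin> {int N, int (N + d), int (N + 3 * d + 1)}"
    using pt(3)[OF b0] by (simp add: d_def)
  ultimately have "pt b0 (N + 9 * d) \<notin> S0" by blast
  then have oddS: "odd (card S)" and finS: "finite S" using fin_B by (auto simp: S_def S0_def)
  have S_mem: "pt b0 (N + d) \<in> S" "pt b0 (N + 3 * d + 1) \<in> S" "\<And>b. b \<in> B \<Longrightarrow> pt b N \<in> S"
    by (auto simp: S_def S0_def)
  obtain \<sigma> where \<sigma>: "\<sigma> permutes S" "evenperm \<sigma>" "transitive_on \<sigma> S"
    using cycle_exists[OF finS] S_mem oddS by blast
  have SX: "S \<subseteq> X" using S_pos by blast
  have \<sigma>X: "\<sigma> permutes X" using \<sigma>(1) SX permutes_subset by blast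
  have \<sigma>_sym: "\<sigma> \<in> fsym X" using \<sigma>X finite_subset[of "{x. \<sigma> x \<noteq> x}" S] finS \<sigma>(1)
    by (auto simp: fsym_def permutes_def)
  have uX: "u x \<in> X" if "x \<in> X" for x using that u_permutes by (simp add: permutes_in_image)
  have inv_u: "finv u (u x) = x" "u (finv u x) = x" for x
    using u_permutes permutes_inverses by metis+
  have inv_\<sigma>: "finv \<sigma> (\<sigma> x) = x" "\<sigma> (finv \<sigma> x) = x" for x
    using \<sigma>X permutes_inverses by metis+
  have inv_v: "finv v (v x) = x" "v (finv v x) = x" for x
    using v permutes_inverses by metis+
  have SuS: "u x \<notin> S" "u x \<notin> K" "x \<notin> K" if "x \<in> S" for x
  proof -
    show "u x \<notin> S"
      using S_pos[OF that] S_pos[of "u x"] pos_step[of x] rep_step[of x] by (auto simp: d_def)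
    show "u x \<notin> K" using S_pos[OF that] pos_step[of x] N[of "u x"] by auto
    show "x \<notin> K" using S_pos[OF that] N[of x] by auto
  qed
  have \<kappa>id: "\<kappa> x = x" if "x \<notin> K" for x using that by (simp add: K_def)
  have \<sigma>id: "\<sigma> x = x" "finv \<sigma> x = x" if "x \<notin> S" for x
    using that \<sigma>(1) permutes_inv[OF \<sigma>(1)] by (auto simp: permutes_not_in)
  define \<alpha> where "\<alpha> = (\<sigma> \<circ> v) \<circ> u \<circ> finv (\<sigma> \<circ> v) \<circ> finv u"
  have "finv (\<sigma> \<circ> v) = finv v \<circ> finv \<sigma>"
    using \<sigma>X v permutes_bij by (intro o_inv_distrib) blast+
  \<comment> \<open>So \<alpha> is the product of \<sigma>, of \<kappa>, and of the conjugate by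
    \<open>u\<close> of the inverse of \<sigma>. Their supports \<open>S\<close>, \<open>K\<close>
    and the image of \<open>S\<close> under \<open>u\<close> are pairwise disjoint.\<close>
  then have \<alpha>_eq: "\<alpha> x = \<sigma> (\<kappa> (u (finv \<sigma> (finv u x))))" for x
    by (simp add: \<alpha>_def \<kappa>_def inv_u inv_v)
  have \<alpha>_S: "\<alpha> x = \<sigma> x" if "x \<in> S" for x
  proof -
    have "finv u x \<notin> S" using SuS(1)[of "finv u x"] that inv_u by auto
    then show ?thesis using SuS(3)[OF that] by (simp add: \<alpha>_eq \<sigma>id inv_u \<kappa>id)
  qed
  have \<alpha>_uS: "\<alpha> (u x) = u (finv \<sigma> x)" if "x \<in> S" for x
  proof -
    have "finv \<sigma> x \<in> S" using that \<sigma>(1) permutes_inv permutes_in_image by metis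
    then show ?thesis using SuS by (simp add: \<alpha>_eq inv_u \<kappa>id \<sigma>id)
  qed
  have \<alpha>_supp: "x \<in> S \<or> x \<in> K \<or> (\<exists>y\<in>S. x = u y)" if "\<alpha> x \<noteq> x" for x
  proof (rule ccontr)
    assume no: "\<not> ?thesis"
    then have "finv u x \<notin> S" using inv_u by metis
    then show False using that no by (simp add: \<alpha>_eq \<sigma>id inv_u \<kappa>id)
  qed
  \<comment> \<open>All positions that \<alpha> can move, where a point of \<open>S\<close>
    contributes its own position and the next one. This turns the intersection of the supports into
    linear arithmetic.\<close>
  define P where "P x \<longleftrightarrow> x \<in> X \<and> (\<bar>pos x\<bar> < int N \<or> pos x = int N \<or> pos x = int N + 1 \<or> rep x = b0 \<and>
      (pos x = int N + int d \<or> pos x = int N + int d + 1 \<or> pos x = int N + 3 * int d + 1 \<or>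
       pos x = int N + 3 * int d + 2 \<or> pos x = int N + 9 * int d \<or> pos x = int N + 9 * int d + 1))" for x
  have \<alpha>_P: "P x" if "\<alpha> x \<noteq> x" for x
    using \<alpha>_supp[OF that]
  proof (elim disjE bexE)
    assume "x \<in> K"
    then show "P x" using N KX by (auto simp: P_def)
  next
    assume "x \<in> S"
    from S_pos[OF this] show "P x" unfolding P_def by auto
  next
    fix y assume "y \<in> S" "x = u y"
    then show "P x" using S_pos[of y] uX[of y] pos_step[of y] rep_step[of y] by (auto simp: P_def)
  qed
  \<comment> \<open>This is \<open>d - 1\<close>. The only coincidence between the moved positions
    and their shifts by \<open>m\<close> is \<open>N + 1 + m = N + d\<close>, on the orbit of
    \<open>b0\<close>.\<close>
  define m where "m = 2 * N + 5"
  define \<beta> where "\<beta> = (u ^^ m) \<circ> \<alpha> \<circ> finv (u ^^ m)"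
  have um: "bij (u ^^ m)" using u_permutes permutes_bij bij_fn by blast
  have \<beta>_eq: "\<beta> ((u ^^ m) x) = (u ^^ m) (\<alpha> x)" for x using um by (simp add: \<beta>_def bij_def)
  define p where "p = pt b0 (N + d)"
  have mv: "\<sigma> x \<noteq> x" if "x \<in> S" for x
  proof -
    have "pos (pt b0 (N + d)) \<noteq> pos (pt b0 (N + 3 * d + 1))"
      by (simp add: pt(3)[OF b0] d_def)
    then show ?thesis using transitive_on_moves[OF \<sigma>(3) that] S_mem(1,2) by metis
  qed
  have p_eq: "p = (u ^^ m) (u (pt b0 N))"
  proof -
    have "(u ^^ m) (u (pt b0 N)) = (u ^^ (m + Suc N)) b0"
      by (simp add: pt_def funpow_add funpow_swap1)
    then show ?thesis by (simp add: p_def pt_def d_def m_def add.commute)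
  qed
  have meet: "{x. \<alpha> x \<noteq> x} \<inter> {x. \<beta> x \<noteq> x} = {p}"
  proof (intro equalityI subsetI)
    fix x assume x: "x \<in> {x. \<alpha> x \<noteq> x} \<inter> {x. \<beta> x \<noteq> x}"
    obtain y where y: "x = (u ^^ m) y" using um by (meson bij_pointE)
    have "P x" using x \<alpha>_P by blast
    moreover have "\<alpha> y \<noteq> y" using x y \<beta>_eq[of y] by auto
    then have "P y" by (rule \<alpha>_P)
    moreover have "rep x = rep y \<and> pos x = pos y + int m"
      using rep_power[of y m] y \<open>P y\<close> by (simp add: P_def)
    ultimately have "rep x = b0 \<and> pos x = int N + int d"
      unfolding P_def d_def m_def by (elim conjE disjE) auto
    then show "x \<in> {p}" using coordinates_inj[of x p] \<open>P x\<close> pt[OF b0] by (auto simp: P_def p_def)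
  next
    fix x assume "x \<in> {p}"
    then have x: "x = p" by simp
    have "\<alpha> p \<noteq> p" using \<alpha>_S mv S_mem(1) by (simp add: p_def)
    moreover have "\<beta> p = (u ^^ m) (u (finv \<sigma> (pt b0 N)))"
      unfolding p_eq \<beta>_eq using \<alpha>_uS S_mem(3)[OF b0] by simp
    moreover have "finv \<sigma> (pt b0 N) \<noteq> pt b0 N" using mv S_mem(3)[OF b0] inv_\<sigma> by metis
    moreover have "inj (u ^^ m)" "inj u" using um u_permutes permutes_inj by (auto simp: bij_def)
    ultimately have "\<beta> p \<noteq> p" using p_eq by (simp add: inj_eq)
    with \<open>\<alpha> p \<noteq> p\<close> show "x \<in> {x. \<alpha> x \<noteq> x} \<inter> {x. \<beta> x \<noteq> x}" by (simp add: x)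
  qed
  have "{f \<in> fsym X. evenperm f} \<subseteq> \<Gamma>" if \<Gamma>: "bij_group X \<Gamma>" "u \<in> \<Gamma>" "\<sigma> \<circ> v \<in> \<Gamma>" for \<Gamma>
  proof -
    interpret bij_group X \<Gamma> by (rule \<Gamma>(1))
    have \<alpha>: "\<alpha> \<in> \<Gamma>" unfolding \<alpha>_def
      by (rule comp_mem[OF comp_mem[OF comp_mem[OF \<Gamma>(3,2)] inv_mem[OF \<Gamma>(3)]] inv_mem[OF \<Gamma>(2)]])
    have \<beta>: "\<beta> \<in> \<Gamma>" unfolding \<beta>_def using \<Gamma> \<alpha> by (intro comp_mem inv_mem power_mem)
    have p\<alpha>: "conn p (\<alpha> p)" by (rule conn_of_single_meet[OF \<alpha> \<beta> meet])
    have Sp: "S \<subseteq> {x. conn p x}"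
    proof (rule transitive_onD[OF \<sigma>(3)])
      show "p \<in> S" using S_mem(1) by (simp add: p_def)
      show "\<sigma> y \<in> {x. conn p x}" if "y \<in> {x. conn p x}" "y \<in> S" for y
        using conn_closed[OF \<alpha> p\<alpha>, of y] that \<alpha>_S by simp
    qed simp
    define a where "a = pt b0 N"
    have aS: "conn a x" if "x \<in> S" for x
      using Sp that S_mem(3)[OF b0] conn_sym conn_trans unfolding a_def by blast
    have ud: "(u ^^ d) (pt b k) = pt b (k + d)" for b k
      by (simp add: pt_def funpow_apply_add add.commute)
    have inv_d: "conn a ((u ^^ d) x) \<longleftrightarrow> conn a x" for x
      by (rule conn_invariant[OF power_mem[OF \<Gamma>(2)]]) (use aS S_mem(1) in \<open>simp add: a_def ud\<close>)
    \<comment> \<open>Two shifts by \<open>d\<close> lead from \<open>N + d\<close> to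
      \<open>N + 3 * d\<close>, and the image of that point under \<open>u\<close> lies in
      \<open>S\<close>. So the class contains a point together with its image under
      \<open>u\<close>.\<close>
    define z where "z = pt b0 (N + d + d + d)"
    have az: "conn a z" unfolding z_def using inv_d ud aS[OF S_mem(1)] by metis
    have "u z = pt b0 (N + 3 * d + 1)" by (simp add: z_def pt_def mult_ac numeral_3_eq_3 add_ac)
    then have "conn a (u z)" using aS[OF S_mem(2)] by simp
    then have zz: "conn z (u z)" using az conn_sym conn_trans by blast
    have zS: "S \<subseteq> {x. conn z x}" using aS az conn_sym conn_trans by blast
    show ?thesis
    proof
      fix f assume f: "f \<in> {f \<in> fsym X. evenperm f}"
      show "f \<in> \<Gamma>"
      proof (rule finite_even_mem_of_class[OF \<Gamma>(2) zz zS])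
        fix C assume "S \<subseteq> C" "\<And>x. u x \<in> C \<longleftrightarrow> x \<in> C"
        then show "X \<subseteq> C"
          using S_mem(3) by (intro invariant_covers[of C N]) (auto simp: pt_def)
      qed (use f in auto)
    qed
  qed
  then show ?thesis using \<sigma>_sym \<sigma>(2) by blast
qed

end

section \<open>Removing finite orbits\<close>

definition periodic :: "('a \<Rightarrow> 'a) \<Rightarrow> 'a \<Rightarrow> bool" where
  "periodic f x \<longleftrightarrow> (\<exists>k>0. (f ^^ k) x = x)"

lemma aperiodicD: "\<not> periodic f x \<Longrightarrow> k > 0 \<Longrightarrow> (f ^^ k) x \<noteq> x"
  unfolding periodic_def by blast

lemma periodic_finite_orbit:
  assumes "periodic f x"
  shows "\<exists>O'. finite O' \<and> x \<in> O' \<and> f ` O' = O' \<and> (\<forall>y\<in>O'. periodic f y)"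
proof -
  obtain k where k: "k > 0" "(f ^^ k) x = x" using assms by (auto simp: periodic_def)
  let ?O = "(\<lambda>j. (f ^^ j) x) ` {..<k}"
  have "f ` ?O = (\<lambda>j. (f ^^ j) x) ` (Suc ` {..<k})" by (auto simp: image_image)
  also have "Suc ` {..<k} = {1..k}" by (simp add: image_Suc_lessThan)
  also have "(\<lambda>j. (f ^^ j) x) ` {1..k} = ?O"
  proof
    show "(\<lambda>j. (f ^^ j) x) ` {1..k} \<subseteq> ?O"
    proof
      fix z assume "z \<in> (\<lambda>j. (f ^^ j) x) ` {1..k}"
      then obtain j where j: "j \<in> {1..k}" "z = (f ^^ j) x" by blast
      show "z \<in> ?O"
        by (rule image_eqI[of _ _ "if j = k then 0 else j"]) (use j k in auto)
    qed
    show "?O \<subseteq> (\<lambda>j. (f ^^ j) x) ` {1..k}"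
    proof
      fix z assume "z \<in> ?O"
      then obtain j where j: "j < k" "z = (f ^^ j) x" by blast
      show "z \<in> (\<lambda>j. (f ^^ j) x) ` {1..k}"
        by (rule image_eqI[of _ _ "if j = 0 then k else j"]) (use j k in auto)
    qed
  qed
  finally have "f ` ?O = ?O" .
  moreover have "periodic f ((f ^^ j) x)" for j
  proof -
    have "(f ^^ k) ((f ^^ j) x) = (f ^^ j) ((f ^^ k) x)" by (simp add: funpow_apply_add add.commute)
    then show ?thesis using k by (auto simp: periodic_def)
  qed
  moreover have "x \<in> ?O" by (rule image_eqI[of _ _ 0]) (use k in auto)
  ultimately show ?thesis by (intro exI[of _ ?O]) auto
qed

lemma periodic_of_finite:
  assumes "inj f" "finite S" "f ` S \<subseteq> S" "x \<in> S"
  shows "periodic f x"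
proof (rule ccontr)
  assume "\<not> periodic f x"
  then have "inj (\<lambda>k. (f ^^ k) x)"
    by (intro injI) (rule funpow_inj_on_exponent[OF assms(1) aperiodicD])
  moreover have "(f ^^ k) x \<in> S" for k by (induction k) (use assms in auto)
  then have "range (\<lambda>k. (f ^^ k) x) \<subseteq> S" by blast
  ultimately show False using assms(2) finite_subset range_inj_infinite by blast
qed

lemma transpose_image: "transpose x y ` S = (if (x \<in> S) = (y \<in> S) then S
    else if x \<in> S then insert y (S - {x}) else insert x (S - {y}))"
  by (auto simp: transpose_def image_iff split: if_splits)

text \<open>The finite orbit of \<open>y\<close> is spliced into the infinite orbit of
  \<open>x\<close>. If a finite set \<open>S\<close> were stable under the product, \<open>f\<close>
  would map \<open>S\<close> to its image under the transposition, and this is refuted for each way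
  in which \<open>S\<close> can contain \<open>x\<close> and \<open>y\<close>.\<close>

lemma transpose_merges_orbits:
  assumes f: "bij f" and x: "\<not> periodic f x" and y: "periodic f y"
    and z: "\<not> periodic f z \<or> z = y"
  shows "\<not> periodic (transpose x y \<circ> f) z"
proof
  assume "periodic (transpose x y \<circ> f) z"
  then obtain S where S: "finite S" "z \<in> S" "(transpose x y \<circ> f) ` S = S"
    using periodic_finite_orbit by metis
  obtain R where R: "finite R" "y \<in> R" "f ` R = R" "\<forall>w\<in>R. periodic f w"
    using periodic_finite_orbit[OF y] by blast
  have inj: "inj f" using f by (simp add: bij_def)
  have "f = transpose x y \<circ> (transpose x y \<circ> f)" by (simp add: fun_eq_iff)
  then have fS: "f ` S = transpose x y ` S" using S(3) by (metis image_comp)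
  consider "(x \<in> S) = (y \<in> S)" | "x \<in> S" "y \<notin> S" | "x \<notin> S" "y \<in> S" by blast
  then show False
  proof cases
    case 1
    then have per: "periodic f w" if "w \<in> S" for w
      using that fS by (intro periodic_of_finite[OF inj S(1)]) (auto simp: transpose_image)
    then have "z = y" using z S(2) by blast
    then show False using per 1 S(2) x by blast
  next
    case 2
    \<comment> \<open>Adding the orbit \<open>R\<close> of \<open>y\<close> gives a finite set
      stable under \<open>f\<close> that contains the aperiodic point \<open>x\<close>.\<close>
    then have "f ` (S \<union> R) \<subseteq> S \<union> R" using fS R by (auto simp: transpose_image image_Un)
    then show False using periodic_of_finite[OF inj, of "S \<union> R" x] S(1) R(1) 2 x by simp
  next
    case 3
    \<comment> \<open>Here \<open>f\<close> would map the finite set \<open>S \<inter> R\<close>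
      injectively into itself without \<open>y\<close>.\<close>
    have "x \<notin> R" using R(4) x by blast
    then have "f ` (S \<inter> R) \<subseteq> S \<inter> R - {y}"
    proof -
      have "f w \<in> S \<inter> R - {y}" if "w \<in> S" "w \<in> R" for w
      proof -
        have "f w \<in> insert x (S - {y})" using fS 3 that by (auto simp: transpose_image)
        moreover have "f w \<in> R" using R(3) that by blast
        ultimately show ?thesis using \<open>x \<notin> R\<close> by auto
      qed
      then show ?thesis by blast
    qed
    moreover have "card (f ` (S \<inter> R)) = card (S \<inter> R)"
      using inj by (intro card_image) (simp add: inj_on_def)
    moreover have "card (S \<inter> R - {y}) < card (S \<inter> R)"
      using 3 R S by (intro psubset_card_mono) auto
    ultimately show False using card_mono[of "S \<inter> R - {y}" "f ` (S \<inter> R)"] S(1) by simp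
  qed
qed

text \<open>The forward tails of \<open>x\<close> and \<open>y\<close> are exchanged, so the parity
  changes but infinite orbits stay infinite. The tails never return to \<open>x\<close> or
  \<open>y\<close>, hence both maps agree along them, and a finite set stable under the product
  contains neither point.\<close>

lemma transpose_swaps_tails:
  assumes f: "bij f"
    and x: "\<And>k. k > 0 \<Longrightarrow> (f ^^ k) x \<notin> {x, y}" and y: "\<And>k. k > 0 \<Longrightarrow> (f ^^ k) y \<notin> {x, y}"
    and z: "\<not> periodic f z"
  shows "\<not> periodic (transpose x y \<circ> f) z"
proof
  let ?g = "transpose x y \<circ> f"
  assume "periodic ?g z"
  then obtain S where S: "finite S" "z \<in> S" "?g ` S = S" "\<forall>w\<in>S. periodic ?g w"
    using periodic_finite_orbit by metis
  have same: "(?g ^^ k) w = (f ^^ k) w" if "w = x \<or> w = y" for k w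
  proof (induction k)
    case (Suc k)
    have "(f ^^ Suc k) w \<notin> {x, y}"
      using that by (elim disjE) (simp_all only: x y zero_less_Suc not_False_eq_True)
    then show ?case using Suc by (simp add: transpose_def)
  qed simp
  have "w \<notin> S" if "w = x \<or> w = y" for w
  proof
    assume "w \<in> S"
    then obtain k where "k > 0" "(?g ^^ k) w = w" using S(4) by (auto simp: periodic_def)
    then show False using same[OF that] x[of k] y[of k] that by auto
  qed
  then have xy: "x \<notin> S" "y \<notin> S" by auto
  have "f = transpose x y \<circ> ?g" by (simp add: fun_eq_iff)
  then have "f ` S = transpose x y ` S" using S(3) by (metis image_comp)
  then have "f ` S = S" using xy by (simp add: transpose_image)
  then show False using periodic_of_finite[of f S z] f S z by (simp add: bij_def)
qed

section \<open>Translations\<close>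

lemma translation_comp:
  assumes "n \<ge> 2" "p \<in> carrier (houghton n)" "q \<in> carrier (houghton n)"
  shows "translation (p \<circ> q) i = translation p i + translation q i"
proof -
  have "translates (p \<circ> q) i (translation q i + translation p i)"
    using assms by (intro translates_comp translates_translation)
  then show ?thesis using translation_eq by fastforce
qed

lemma translation_fsym: "f \<in> fsym X \<Longrightarrow> translation f i = 0"
  by (rule translation_eq, rule translates_finite_support) (simp add: fsym_def)

lemma translation_id: "translation id i = 0"
  by (rule translation_eq, rule translates_finite_support) simp

lemma translation_inv:
  assumes "n \<ge> 2" "p \<in> carrier (houghton n)"
  shows "translation (finv p) i = - translation p i"
  using translates_inv[OF houghton_permutes[OF assms] translates_translation[OF assms]]
  by (rule translation_eq)

lemma translation_fsym_comp:
  assumes "n \<ge> 2" "p \<in> carrier (houghton n)" "f \<in> fsym (rays n)"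
  shows "translation (f \<circ> p) i = translation p i"
  using translation_comp[OF assms(1) _ assms(2), of f] fsym_subset_houghton[OF assms(1)] assms(3)
    translation_fsym[OF assms(3)] by auto

lemma translation_threshold:
  assumes n: "n \<ge> 2" and p: "p \<in> carrier (houghton n)"
  shows "\<exists>M\<ge>1. \<forall>i\<in>{1..n}. \<forall>m\<ge>M. fst (p (i, m)) = i \<and> int (snd (p (i, m))) = int m + translation p i"
proof -
  have "\<exists>M. \<forall>m\<ge>M. fst (p (i, m)) = i \<and> int (snd (p (i, m))) = int m + translation p i" for i
    using translates_translation[OF n p, of i] by (simp add: translates_def eventually_sequentially)
  then obtain M where M: "\<And>i m. m \<ge> M i \<Longrightarrow> fst (p (i, m)) = i \<and>
      int (snd (p (i, m))) = int m + translation p i" by metis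
  have "M i \<le> Max (M ` {1..n})" if "i \<in> {1..n}" for i using that by simp
  then have "fst (p (i, m)) = i \<and> int (snd (p (i, m))) = int m + translation p i"
    if "i \<in> {1..n}" "m \<ge> Suc (Max (M ` {1..n}))" for i m
    using M[of i m] that by (meson Suc_leD le_trans)
  then show ?thesis by (intro exI[of _ "Suc (Max (M ` {1..n}))"]) simp
qed

lemma fsym_if_translations_zero:
  assumes n: "n \<ge> 2" and p: "p \<in> carrier (houghton n)" and z: "\<And>i. i \<in> {1..n} \<Longrightarrow> translation p i = 0"
  shows "p \<in> fsym (rays n)"
proof -
  obtain M where M: "\<forall>i\<in>{1..n}. \<forall>m\<ge>M. fst (p (i, m)) = i \<and> int (snd (p (i, m))) = int m + translation p i"
    using translation_threshold[OF n p] by blast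
  have perm: "p permutes rays n" by (rule houghton_permutes[OF n p])
  have "{x. p x \<noteq> x} \<subseteq> {1..n} \<times> {..<M}"
  proof
    fix x assume x: "x \<in> {x. p x \<noteq> x}"
    then have "x \<in> rays n" using permutes_not_in[OF perm, of x] by blast
    then have i: "fst x \<in> {1..n}" by (auto simp: rays_def)
    have "snd x < M"
    proof (rule ccontr)
      assume "\<not> snd x < M"
      then have "fst (p (fst x, snd x)) = fst x \<and> int (snd (p (fst x, snd x))) = int (snd x) + 0"
        using M i z[OF i] by (metis not_less)
      then have "p x = x" by (simp add: prod_eq_iff)
      then show False using x by simp
    qed
    then show "x \<in> {1..n} \<times> {..<M}" using i by (cases x) auto
  qed
  then have "finite {x. p x \<noteq> x}" by (rule finite_subset) auto
  then show ?thesis using perm by (simp add: fsym_def)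
qed

lemma fsym_comp: "p \<in> fsym X \<Longrightarrow> q \<in> fsym X \<Longrightarrow> p \<circ> q \<in> fsym X"
proof -
  assume a: "p \<in> fsym X" "q \<in> fsym X"
  have "{x. (p \<circ> q) x \<noteq> x} \<subseteq> {x. p x \<noteq> x} \<union> {x. q x \<noteq> x}" by (auto; metis)
  then have "finite {x. (p \<circ> q) x \<noteq> x}" using a by (auto simp: fsym_def intro: finite_subset)
  then show ?thesis using a permutes_compose by (auto simp: fsym_def)
qed

lemma transpose_fsym: "x \<in> X \<Longrightarrow> y \<in> X \<Longrightarrow> transpose x y \<in> fsym X"
proof -
  assume "x \<in> X" "y \<in> X"
  moreover have "{z. transpose x y z \<noteq> z} \<subseteq> {x, y}" by (auto simp: transpose_def)
  then have "finite {z. transpose x y z \<noteq> z}" by (rule finite_subset) simp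
  ultimately show ?thesis by (simp add: fsym_def permutes_swap_id)
qed

lemma fsym_permutation: "p \<in> fsym X \<Longrightarrow> permutation p"
  using permutes_bij by (auto simp: fsym_def permutation)

text \<open>Beyond \<open>M\<close> the map is a nonzero shift along each ray. Hence orbits of far
  points are infinite, and every orbit meets a bounded window, which makes the orbits finite in
  number.\<close>

locale moving =
  fixes n :: nat and u :: "nat \<times> nat \<Rightarrow> nat \<times> nat" and M :: nat
  assumes n: "n \<ge> 2" and mem: "u \<in> carrier (houghton n)"
    and nonzero: "i \<in> {1..n} \<Longrightarrow> translation u i \<noteq> 0"
    and M_pos: "M \<ge> 1"
    and shift: "i \<in> {1..n} \<Longrightarrow> m \<ge> M \<Longrightarrow> fst (u (i, m)) = i \<and> int (snd (u (i, m))) = int m + translation u i"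
begin

lemma bij: "bij u"
  using houghton_permutes[OF n mem] permutes_bij by blast

lemma shift_outgoing:
  assumes "i \<in> {1..n}" "m \<ge> M" "translation u i > 0"
  shows "u (i, m) = (i, m + nat (translation u i))"
proof -
  have "int (snd (u (i, m))) = int (m + nat (translation u i))" using shift[of i m] assms by simp
  then show ?thesis using shift[of i m] assms by (simp only: prod_eq_iff fst_conv snd_conv of_nat_eq_iff)
qed

lemma shift_incoming:
  assumes "i \<in> {1..n}" "m \<ge> M" "translation u i < 0"
  shows "u (i, m + nat (- translation u i)) = (i, m)"
proof -
  let ?m = "m + nat (- translation u i)"
  have s: "fst (u (i, ?m)) = i \<and> int (snd (u (i, ?m))) = int ?m + translation u i"
    using shift[of i ?m] assms by simp
  then have "int (snd (u (i, ?m))) = int m" using assms by simp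
  then show ?thesis using s by (simp only: prod_eq_iff fst_conv snd_conv of_nat_eq_iff)
qed

lemma outgoing:
  assumes "i \<in> {1..n}" "m \<ge> M" "translation u i > 0"
  shows "(u ^^ k) (i, m) = (i, m + k * nat (translation u i))"
proof (induction k)
  case (Suc k)
  then show ?case using shift_outgoing[OF assms(1), of "m + k * nat (translation u i)"] assms
    by (simp add: add_ac)
qed simp

lemma incoming:
  assumes "i \<in> {1..n}" "m \<ge> M" "translation u i < 0"
  shows "(u ^^ k) (i, m + k * nat (- translation u i)) = (i, m)"
proof (induction k)
  case (Suc k)
  have "u (i, m + Suc k * nat (- translation u i)) = (i, m + k * nat (- translation u i))"
    using shift_incoming[OF assms(1), of "m + k * nat (- translation u i)"] assms
    by (simp add: add_ac)
  then show ?case using Suc by (simp add: funpow_Suc_right del: funpow.simps)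
qed simp

text \<open>On an incoming ray the argument runs backwards: the same power of \<open>u\<close> sends
  a point farther out to \<open>(i, m)\<close>, so a period would contradict injectivity.\<close>

lemma far_aperiodic:
  assumes "i \<in> {1..n}" "m \<ge> M"
  shows "\<not> periodic u (i, m)"
proof
  assume "periodic u (i, m)"
  then obtain k where k: "k > 0" "(u ^^ k) (i, m) = (i, m)" by (auto simp: periodic_def)
  show False
  proof (cases "translation u i > 0")
    case True
    then show ?thesis using outgoing[OF assms True, of k] k by simp
  next
    case False
    then have neg: "translation u i < 0" using nonzero[OF assms(1)] by simp
    have "(u ^^ k) (i, m + k * nat (- translation u i)) = (u ^^ k) (i, m)"
      using incoming[OF assms neg] k by simp
    moreover have "inj (u ^^ k)" using bij by (simp add: bij_def inj_fn)
    ultimately have "(i, m + k * nat (- translation u i)) = (i, m)" by (metis injD)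
    then show ?thesis using k neg by simp
  qed
qed

text \<open>A point beyond the window shares its orbit with the point one translation length closer
  to the start of the ray, its predecessor on an outgoing ray and its successor on an incoming
  one.\<close>

lemma reach_window:
  assumes "i \<in> {1..n}" "m \<ge> 1"
  shows "\<exists>b \<in> {1..n} \<times> {1..<M + nat \<bar>translation u i\<bar>}. \<exists>j k. (u ^^ j) (i, m) = (u ^^ k) b"
  using assms(2)
proof (induction m rule: less_induct)
  case (less m)
  let ?t = "nat \<bar>translation u i\<bar>"
  show ?case
  proof (cases "m < M + ?t")
    case True
    then show ?thesis using assms(1) less.prems
      by (intro bexI[of _ "(i, m)"] exI[of _ 0]) auto
  next
    case False
    have t: "?t > 0" using nonzero[OF assms(1)] by simp
    obtain b j k where b: "b \<in> {1..n} \<times> {1..<M + ?t}" "(u ^^ j) (i, m - ?t) = (u ^^ k) b"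
      using less.IH[of "m - ?t"] False t M_pos by fastforce
    show ?thesis
    proof (cases "translation u i > 0")
      case True
      then have "u (i, m - ?t) = (i, m)"
        using shift_outgoing[OF assms(1), of "m - ?t"] False by simp
      then have "(u ^^ j) (i, m) = (u ^^ Suc k) b" using b(2) by (metis funpow.simps(2) comp_apply funpow_swap1)
      then show ?thesis using b(1) by blast
    next
      case neg: False
      then have "u (i, m) = (i, m - ?t)"
        using shift_incoming[OF assms(1), of "m - ?t"] False t by simp
      then have "(u ^^ Suc j) (i, m) = (u ^^ k) b" using b(2) by (metis funpow.simps(2) comp_apply funpow_swap1)
      then show ?thesis using b(1) by blast
    qed
  qed
qed

lemma coordinates:
  assumes "\<And>x. x \<in> rays n \<Longrightarrow> \<not> periodic u x"
  shows "\<exists>B rep pos. orbit_coordinates (rays n) u B rep pos"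
proof (rule orbit_coordinates_exist[OF houghton_permutes[OF n mem],
    of "\<Union>i\<in>{1..n}. {1..n} \<times> {1..<M + nat \<bar>translation u i\<bar>}"])
  fix x assume x: "x \<in> rays n"
  show "(u ^^ k) x \<noteq> x" if "k > 0" for k by (rule aperiodicD[OF assms[OF x] that])
  obtain i m where "x = (i, m)" "i \<in> {1..n}" "m \<ge> 1" using x by (auto simp: rays_def)
  then show "\<exists>b\<in>\<Union>i\<in>{1..n}. {1..n} \<times> {1..<M + nat \<bar>translation u i\<bar>}. \<exists>i j. (u ^^ i) x = (u ^^ j) b"
    using reach_window[of i m] by blast
qed (auto simp: rays_def)

lemma finite_periodic: "finite {x \<in> rays n. periodic u x}"
proof (rule finite_subset)
  show "{x \<in> rays n. periodic u x} \<subseteq> {1..n} \<times> {..<M}"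
  proof
    fix x assume x: "x \<in> {x \<in> rays n. periodic u x}"
    then have "fst x \<in> {1..n}" by (auto simp: rays_def)
    moreover from this x have "snd x < M" using far_aperiodic[of "fst x" "snd x"] by fastforce
    ultimately show "x \<in> {1..n} \<times> {..<M}" by (cases x) auto
  qed
qed auto

end

section \<open>Removing finite orbits with control of the parity\<close>

lemma moving_exists:
  assumes "n \<ge> 2" "u \<in> carrier (houghton n)" "\<And>i. i \<in> {1..n} \<Longrightarrow> translation u i \<noteq> 0"
  shows "\<exists>M. moving n u M"
proof -
  obtain M where "M \<ge> 1" "\<forall>i\<in>{1..n}. \<forall>m\<ge>M. fst (u (i, m)) = i \<and> int (snd (u (i, m))) = int m + translation u i"
    using translation_threshold[OF assms(1,2)] by blast
  then have "moving n u M" using assms by unfold_locales simp_all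
  then show ?thesis ..
qed

text \<open>Induction on the number of periodic points, which is finite: swapping one of them with a
  far point absorbs it and creates no new ones.\<close>

lemma remove_finite_orbits:
  assumes "n \<ge> 2" "u \<in> carrier (houghton n)" "\<And>i. i \<in> {1..n} \<Longrightarrow> translation u i \<noteq> 0"
  shows "\<exists>f\<in>fsym (rays n). \<forall>x\<in>rays n. \<not> periodic (f \<circ> u) x"
  using assms(2,3)
proof (induction "card {x \<in> rays n. periodic u x}" arbitrary: u rule: less_induct)
  case less
  then obtain M where "moving n u M" using moving_exists[OF assms(1)] by blast
  then interpret moving n u M .
  show ?case
  proof (cases "\<exists>y\<in>rays n. periodic u y")
    case False
    then show ?thesis by (intro bexI[of _ id]) (auto simp: fsym_def permutes_id)
  next
    case True
    then obtain y where y: "y \<in> rays n" "periodic u y" by blast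
    define x where "x = (1::nat, M)"
    have x: "\<not> periodic u x" "x \<in> rays n"
      using far_aperiodic n M_pos by (auto simp: x_def rays_def)
    let ?t = "transpose x y"
    have t: "?t \<in> fsym (rays n)" by (rule transpose_fsym[OF x(2) y(1)])
    have "{z \<in> rays n. periodic (?t \<circ> u) z} \<subseteq> {z \<in> rays n. periodic u z} - {y}"
      using transpose_merges_orbits[OF bij x(1) y(2)] by blast
    also have "\<dots> \<subset> {z \<in> rays n. periodic u z}" using y by blast
    finally have "card {z \<in> rays n. periodic (?t \<circ> u) z} < card {z \<in> rays n. periodic u z}"
      by (rule psubset_card_mono[OF finite_periodic])
    then have "\<exists>f\<in>fsym (rays n). \<forall>x\<in>rays n. \<not> periodic (f \<circ> (?t \<circ> u)) x"
    proof (rule less.hyps)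
      have "?t \<in> carrier (houghton n)" using t fsym_subset_houghton[OF n] by (rule rev_subsetD)
      then show "?t \<circ> u \<in> carrier (houghton n)" by (rule houghton_comp[OF n _ mem])
      show "translation (?t \<circ> u) i \<noteq> 0" if "i \<in> {1..n}" for i
        unfolding translation_fsym_comp[OF n mem t] by (rule nonzero[OF that])
    qed
    then obtain f where f: "f \<in> fsym (rays n)" "\<forall>x\<in>rays n. \<not> periodic (f \<circ> (?t \<circ> u)) x" ..
    then have "\<forall>x\<in>rays n. \<not> periodic ((f \<circ> ?t) \<circ> u) x" by (simp add: comp_assoc)
    then show ?thesis using fsym_comp[OF f(1) t] by blast
  qed
qed

text \<open>If the permutation found so far is odd, two tails are exchanged. They start at
  \<open>(i, M)\<close> and \<open>(j, M)\<close>, and because both rays are outgoing, each stays on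
  its own ray and moves strictly outwards.\<close>

lemma even_remove_finite_orbits:
  assumes n: "n \<ge> 2" and u: "u \<in> carrier (houghton n)"
    and nz: "\<And>i. i \<in> {1..n} \<Longrightarrow> translation u i \<noteq> 0"
    and ij: "i \<in> {1..n}" "j \<in> {1..n}" "i \<noteq> j" "translation u i > 0" "translation u j > 0"
  shows "\<exists>f\<in>fsym (rays n). evenperm f \<and> (\<exists>B rep pos. orbit_coordinates (rays n) (f \<circ> u) B rep pos)"
proof -
  have coord: "\<exists>B rep pos. orbit_coordinates (rays n) (f \<circ> u) B rep pos"
    if f: "f \<in> fsym (rays n)" "\<forall>x\<in>rays n. \<not> periodic (f \<circ> u) x" for f
  proof -
    have "f \<circ> u \<in> carrier (houghton n)" using houghton_comp[OF n _ u] f fsym_subset_houghton[OF n] by blast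
    then obtain M where "moving n (f \<circ> u) M"
      using moving_exists[OF n] translation_fsym_comp[OF n u f(1)] nz by metis
    then show ?thesis using f(2) moving.coordinates by blast
  qed
  obtain f where f: "f \<in> fsym (rays n)" "\<forall>x\<in>rays n. \<not> periodic (f \<circ> u) x"
    using remove_finite_orbits[OF n u nz] by blast
  show ?thesis
  proof (cases "evenperm f")
    case True
    then show ?thesis using f coord by blast
  next
    case False
    have fu: "f \<circ> u \<in> carrier (houghton n)" using houghton_comp[OF n _ u] f fsym_subset_houghton[OF n] by blast
    have tr: "translation (f \<circ> u) k = translation u k" for k by (rule translation_fsym_comp[OF n u f(1)])
    obtain M where "moving n (f \<circ> u) M" using moving_exists[OF n fu] tr nz by metis
    then interpret moving n "f \<circ> u" M .
    define x y where "x = (i, M)" and "y = (j, M)"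
    have xy: "x \<in> rays n" "y \<in> rays n" "x \<noteq> y" using ij M_pos by (auto simp: x_def y_def rays_def)
    let ?t = "transpose x y"
    have t: "?t \<in> fsym (rays n)" by (rule transpose_fsym[OF xy(1,2)])
    have "\<not> periodic (?t \<circ> (f \<circ> u)) z" if "z \<in> rays n" for z
    proof (rule transpose_swaps_tails[OF bij])
      show "((f \<circ> u) ^^ k) x \<notin> {x, y}" "((f \<circ> u) ^^ k) y \<notin> {x, y}" if "k > 0" for k
        using outgoing[of i M k] outgoing[of j M k] ij that by (auto simp: x_def y_def tr)
      show "\<not> periodic (f \<circ> u) z" using f(2) that by blast
    qed
    then have "\<forall>z\<in>rays n. \<not> periodic ((?t \<circ> f) \<circ> u) z" by (simp add: comp_assoc)
    moreover have "?t \<circ> f \<in> fsym (rays n)" by (rule fsym_comp[OF t f(1)])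
    moreover have "evenperm (?t \<circ> f)"
      using False xy(3) by (simp add: evenperm_comp fsym_permutation[OF t] fsym_permutation[OF f(1)] evenperm_swap)
    ultimately show ?thesis using coord by blast
  qed
qed

section \<open>Subgroups of the Houghton group\<close>

locale houghton_sub = bij_group "rays n" U for n :: nat and U :: "(nat \<times> nat \<Rightarrow> nat \<times> nat) set" +
  assumes n_ge: "n \<ge> 2" and subset: "U \<subseteq> carrier (houghton n)"

lemma houghton_one: "\<one>\<^bsub>houghton n\<^esub> = id"
  by (simp add: houghton_def perm_group_def)

lemma houghton_m_inv:
  assumes "n \<ge> 2" "p \<in> carrier (houghton n)"
  shows "inv\<^bsub>houghton n\<^esub> p = finv p"
  using assms houghton_inv[OF assms] permutes_inv_o[OF houghton_permutes[OF assms]]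
  by (intro group.inv_equality[OF group_houghton]) (simp_all add: houghton_one)

lemma houghton_sub_of_subgroup:
  assumes "n \<ge> 2" "subgroup U (houghton n)"
  shows "houghton_sub n U"
proof
  have sub: "U \<subseteq> carrier (houghton n)" by (rule subgroup.subset[OF assms(2)])
  show "U \<subseteq> carrier (houghton n)" by (rule sub)
  show "p permutes rays n" if "p \<in> U" for p using houghton_permutes[OF assms(1)] sub that by blast
  show "id \<in> U" using subgroup.one_closed[OF assms(2)] by (simp add: houghton_one)
  show "p \<circ> q \<in> U" if "p \<in> U" "q \<in> U" for p q
    using subgroup.m_closed[OF assms(2) that(2,1)] by simp
  show "finv p \<in> U" if "p \<in> U" for p
    using subgroup.m_inv_closed[OF assms(2) that] houghton_m_inv[OF assms(1)] sub that by auto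
qed (rule assms(1))

lemma subgroup_m_inv:
  assumes "n \<ge> 2" "subgroup U (houghton n)" "p \<in> U"
  shows "inv\<^bsub>(houghton n)\<lparr>carrier := U\<rparr>\<^esub> p = finv p"
proof -
  interpret houghton_sub n U by (rule houghton_sub_of_subgroup[OF assms(1,2)])
  show ?thesis
    using assms(3) inv_mem permutes_inv_o[OF permutes_mem[OF assms(3)]]
    by (intro group.inv_equality[OF subgroup.subgroup_is_group[OF assms(2) group_houghton]])
       (simp_all add: houghton_one)
qed

lemma generate_houghton_sub:
  assumes "n \<ge> 2" "subgroup U (houghton n)" "S \<subseteq> U"
  shows "houghton_sub n (generate ((houghton n)\<lparr>carrier := U\<rparr>) S)"
proof -
  let ?G = "(houghton n)\<lparr>carrier := U\<rparr>"
  have G: "group ?G" by (rule subgroup.subgroup_is_group[OF assms(2) group_houghton])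
  have "subgroup (generate ?G S) ?G" by (rule group.generate_is_subgroup[OF G]) (simp add: assms(3))
  then have "subgroup (generate ?G S) (houghton n)"
    by (rule group.incl_subgroup[OF group_houghton assms(2)])
  then show ?thesis by (rule houghton_sub_of_subgroup[OF assms(1)])
qed

text \<open>Reduces generation to a statement about every intermediate group \<Gamma>, which is the
  form in which the orbit arguments deliver their results.\<close>

lemma generate_eqI:
  assumes "n \<ge> 2" "subgroup U (houghton n)" "S \<subseteq> U"
    and "\<And>\<Gamma>. houghton_sub n \<Gamma> \<Longrightarrow> S \<subseteq> \<Gamma> \<Longrightarrow> \<Gamma> \<subseteq> U \<Longrightarrow> U \<subseteq> \<Gamma>"
  shows "generate ((houghton n)\<lparr>carrier := U\<rparr>) S = U"
proof -
  let ?G = "(houghton n)\<lparr>carrier := U\<rparr>"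
  have G: "group ?G" by (rule subgroup.subgroup_is_group[OF assms(2) group_houghton])
  have "generate ?G S \<subseteq> U" using group.generate_incl[OF G, of S] assms(3) by simp
  moreover have "U \<subseteq> generate ?G S"
    using generate_houghton_sub[OF assms(1-3)] calculation
    by (intro assms(4)) (auto intro: generate.incl)
  ultimately show ?thesis by blast
qed

lemma min_generators_le:
  assumes "S \<subseteq> carrier G" "finite S" "generate G S = carrier G" "card S \<le> k"
  shows "min_generators G \<le> enat k"
proof -
  have "min_generators G \<le> enat (card S)"
    unfolding min_generators_def by (rule INF_lower) (use assms in auto)
  also have "\<dots> \<le> enat k" using assms(4) by simp
  finally show ?thesis .
qed

lemma min_generators_ge:
  assumes "\<And>S. S \<subseteq> carrier G \<Longrightarrow> finite S \<Longrightarrow> generate G S = carrier G \<Longrightarrow> k \<le> card S"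
  shows "enat k \<le> min_generators G"
  unfolding min_generators_def by (rule INF_greatest) (use assms in auto)

context houghton_sub begin

lemma mem_houghton: "p \<in> U \<Longrightarrow> p \<in> carrier (houghton n)"
  using subset by blast

lemma trans_comp: "p \<in> U \<Longrightarrow> q \<in> U \<Longrightarrow> translation (p \<circ> q) i = translation p i + translation q i"
  using translation_comp[OF n_ge] mem_houghton by blast

lemma trans_inv: "p \<in> U \<Longrightarrow> translation (finv p) i = - translation p i"
  using translation_inv[OF n_ge] mem_houghton by blast

lemma trans_power: "p \<in> U \<Longrightarrow> translation (p ^^ k) i = int k * translation p i"
  by (induction k) (auto simp: translation_id trans_comp power_mem ring_distribs)

lemma multiple_mem:
  assumes "p \<in> U"
  shows "\<exists>q\<in>U. \<forall>i. translation q i = k * translation p i"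
proof (cases "k \<ge> 0")
  case True
  then show ?thesis using trans_power[OF assms, of "nat k"] power_mem[OF assms]
    by (intro bexI[of _ "p ^^ nat k"]) auto
next
  case False
  then show ?thesis using trans_power[OF inv_mem[OF assms], of "nat (- k)"] power_mem[OF inv_mem[OF assms]]
    by (intro bexI[of _ "finv p ^^ nat (- k)"]) (auto simp: trans_inv[OF assms])
qed

text \<open>The values of one translation coordinate form a subgroup of the integers; by division
  with remainder its least positive element divides all the others.\<close>

lemma divisor_exists:
  assumes x: "x \<in> U" "translation x i \<noteq> 0"
  shows "\<exists>h\<in>U. translation h i > 0 \<and> (\<forall>y\<in>U. translation h i dvd translation y i)"
proof -
  let ?P = "\<lambda>d. d > 0 \<and> (\<exists>h\<in>U. translation h i = int d)"
  have "\<exists>d. ?P d"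
  proof (cases "translation x i > 0")
    case True
    then show ?thesis by (intro exI[of _ "nat (translation x i)"]) (use x in auto)
  next
    case False
    then show ?thesis by (intro exI[of _ "nat (- translation x i)"])
      (use x in \<open>auto intro!: bexI[of _ "finv x"] simp: trans_inv inv_mem\<close>)
  qed
  define d where "d = (LEAST d. ?P d)"
  have d: "?P d" unfolding d_def by (rule LeastI_ex) fact
  then obtain h where h: "h \<in> U" "translation h i = int d" "d > 0" by blast
  have "int d dvd translation y i" if y: "y \<in> U" for y
  proof -
    obtain q where q: "q \<in> U" "\<forall>j. translation q j = (- (translation y i div int d)) * translation h j"
      using multiple_mem[OF h(1)] by blast
    have "translation (y \<circ> q) i = translation y i mod int d"
      using y q h by (simp add: trans_comp minus_mult_div_eq_mod mult.commute)
    moreover have "\<not> ?P (nat (translation y i mod int d))"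
      using not_less_Least[of "nat (translation y i mod int d)" ?P] h(3) unfolding d_def[symmetric]
      by (simp add: nat_less_iff)
    moreover have "translation y i mod int d \<ge> 0" using h(3) by simp
    ultimately have "translation y i mod int d = 0"
      using comp_mem[OF y q(1)] by force
    then show ?thesis by presburger
  qed
  then show ?thesis using h by (intro bexI[OF _ h(1)]) simp
qed

text \<open>The translations over all rays add up to zero, so ray 1 is determined by the
  others.\<close>

lemma fsym_of_zero:
  assumes "p \<in> U" "\<And>i. i \<in> {2..n} \<Longrightarrow> translation p i = 0"
  shows "p \<in> fsym (rays n)"
proof (rule fsym_if_translations_zero[OF n_ge mem_houghton[OF assms(1)]])
  fix i assume i: "i \<in> {1..n}"
  have "{1..n} = insert 1 {2..n}" using n_ge by auto
  then have "translation p 1 = 0"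
    using sum_translation[OF n_ge mem_houghton[OF assms(1)]] assms(2) by simp
  then show "translation p i = 0" using assms(2)[of i] i by (cases "i = 1") auto
qed

lemma kernel_sub: "houghton_sub n {x \<in> U. \<forall>j\<in>J. translation x j = 0}"
  by unfold_locales
     (auto simp: permutes_mem id_mem comp_mem inv_mem translation_id trans_comp trans_inv n_ge mem_houghton)

end

section \<open>Finite index\<close>

locale finite_index = houghton_sub +
  assumes fin: "finite (rcosets\<^bsub>houghton n\<^esub> U)"
begin

section \<open>The finitary alternating group inside a subgroup of finite index\<close>

lemma pigeonhole_mem:
  assumes "\<And>i::nat. \<tau> i \<in> carrier (houghton n)"
  shows "\<exists>i j. i \<noteq> j \<and> finv (\<tau> j) \<circ> \<tau> i \<in> U"
proof -
  let ?c = "\<lambda>i. U #>\<^bsub>houghton n\<^esub> \<tau> i"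
  have "range ?c \<subseteq> rcosets\<^bsub>houghton n\<^esub> U" using assms by (auto simp: RCOSETS_def)
  then have "finite (range ?c)" using fin finite_subset by blast
  then have "\<not> inj ?c" using range_inj_infinite by blast
  then obtain i j where ij: "i \<noteq> j" "?c i = ?c j" by (auto simp: inj_def)
  have "\<tau> i \<in> ?c i" using id_mem by (auto simp: r_coset_def intro!: bexI[of _ id])
  then have "\<tau> i \<in> ?c j" using ij by simp
  then obtain h where h: "h \<in> U" "\<tau> i = \<tau> j \<circ> h" by (auto simp: r_coset_def)
  have "finv (\<tau> j) \<circ> \<tau> i = h"
    using permutes_inv_o(2)[OF houghton_permutes[OF n_ge assms[of j]]] h(2) by (simp add: o_assoc)
  then show ?thesis using ij h by blast
qed

lemma transpose_pigeonhole:
  assumes "\<And>i::nat. p i \<in> rays n" "\<And>i. q i \<in> rays n"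
  shows "\<exists>i j. i \<noteq> j \<and> transpose (p j) (q j) \<circ> transpose (p i) (q i) \<in> U"
proof -
  have "transpose (p i) (q i) \<in> carrier (houghton n)" for i
    using transpose_fsym[OF assms] fsym_subset_houghton[OF n_ge] by blast
  from pigeonhole_mem[of "\<lambda>i. transpose (p i) (q i)", OF this] show ?thesis by simp
qed

text \<open>Two transpositions that move \<open>a\<close> and lie in the same coset yield a 3-cycle
  through \<open>a\<close> and two points of \<open>Y\<close>. Applied to the complement of a
  supposedly finite class, this shows that classes are infinite.\<close>

lemma conn_infinite:
  assumes "a \<in> rays n" "Y \<subseteq> rays n" "infinite Y" "a \<notin> Y"
  shows "\<exists>x\<in>Y. conn a x"
proof -
  obtain y :: "nat \<Rightarrow> _" where y: "inj y" "range y \<subseteq> Y"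
    using infinite_countable_subset[OF assms(3)] by blast
  then have yY: "y i \<in> Y" for i by blast
  obtain i j where ij: "i \<noteq> j" "transpose a (y j) \<circ> transpose a (y i) \<in> U"
    using transpose_pigeonhole[of "\<lambda>_. a" y] assms(1,2) yY by blast
  have "y i \<noteq> y j" using y ij by (auto simp: inj_eq)
  then have "three (y j) a (y i)"
    using ij(2) assms(4) yY by (auto simp: three_def transpose_commute)
  then have "conn a (y j)" using three_swap unfolding conn_def by blast
  then show ?thesis using yY by blast
qed

lemma infinite_rays: "infinite (rays n)"
proof
  assume "finite (rays n)"
  then have "finite (snd ` rays n)" by simp
  moreover have "snd ` rays n = {1..}" using n_ge by (force simp: rays_def)
  ultimately show False using infinite_Ici[of "1::nat"] by simp
qed

lemma class_infinite:
  assumes "a \<in> rays n"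
  shows "infinite {x \<in> rays n. conn a x}"
proof
  assume "finite {x \<in> rays n. conn a x}"
  then have "infinite (rays n - {x \<in> rays n. conn a x})" using infinite_rays by simp
  then show False using conn_infinite[OF assms, of "rays n - {x \<in> rays n. conn a x}"] assms by auto
qed

text \<open>If the classes differed, some product of two transpositions between them would lie in U.
  It sends \<open>p i\<close> into the class of \<open>b\<close> but fixes \<open>p k\<close> in the
  class of \<open>a\<close>, although elements of U preserve \<open>conn\<close>.\<close>

lemma all_conn:
  assumes a: "a \<in> rays n" and b: "b \<in> rays n"
  shows "conn a b"
proof (rule ccontr)
  assume no: "\<not> conn a b"
  obtain p :: "nat \<Rightarrow> _" where p: "inj p" "range p \<subseteq> {x \<in> rays n. conn a x}"
    using infinite_countable_subset[OF class_infinite[OF a]] by blast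
  obtain q :: "nat \<Rightarrow> _" where q: "inj q" "range q \<subseteq> {x \<in> rays n. conn b x}"
    using infinite_countable_subset[OF class_infinite[OF b]] by blast
  have pa: "p i \<in> rays n" "conn a (p i)" and qb: "q i \<in> rays n" "conn b (q i)" for i
    using p(2) q(2) by blast+
  have pq: "p i \<noteq> q j" for i j using no pa(2)[of i] qb(2)[of j] conn_sym conn_trans by metis
  obtain i j where ij: "i \<noteq> j" and g: "transpose (p j) (q j) \<circ> transpose (p i) (q i) \<in> U"
    using transpose_pigeonhole[of p q] pa qb by blast
  let ?g = "transpose (p j) (q j) \<circ> transpose (p i) (q i)"
  define k where "k = i + j + 1"
  have ne: "p k \<noteq> p i" "p k \<noteq> p j" "q i \<noteq> q j" "q i \<noteq> p j" "p k \<noteq> q i" "p k \<noteq> q j"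
    using p(1) q(1) ij pq pq[symmetric] by (auto simp: inj_eq k_def)
  have "?g (p i) = q i" "?g (p k) = p k" using ne by (auto simp: transpose_def)
  moreover have "conn (p i) (p k)" using pa conn_sym conn_trans by blast
  ultimately have "conn (q i) (p k)" using conn_image[OF _ g] by metis
  then show False using no pa(2)[of k] qb(2)[of i] conn_sym conn_trans by metis
qed

lemma even_fsym_mem: "f \<in> fsym (rays n) \<Longrightarrow> evenperm f \<Longrightarrow> f \<in> U"
  using all_conn by (intro finite_even_mem) auto

text \<open>Pigeonhole on the powers of \<open>ray_shift k\<close>. The sign is normalized so that
  ray \<open>k\<close> is outgoing, contrary to \<open>ray_shift k\<close> itself.\<close>

lemma axis_element:
  assumes "k \<in> {2..n}"
  shows "\<exists>x\<in>U. \<exists>c>0. \<forall>i. translation x i = (if i = k then c else if i = 1 then - c else 0)"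
proof -
  let ?g = "ray_shift k"
  interpret H: houghton_sub n "carrier (houghton n)"
    by (rule houghton_sub_of_subgroup[OF n_ge group.subgroup_self[OF group_houghton]])
  have g: "?g \<in> carrier (houghton n)" by (rule ray_shift_in_houghton[OF n_ge assms])
  have tg: "translation ?g i = (if i = 1 then 1 else if i = k then - 1 else 0)" for i
    by (rule translation_eq, rule translates_ray_shift) (use assms in auto)
  obtain i j :: nat where ij: "i \<noteq> j" "finv (?g ^^ j) \<circ> ?g ^^ i \<in> U"
    using pigeonhole_mem[of "\<lambda>i. ?g ^^ i"] H.power_mem[OF g] by blast
  let ?y = "finv (?g ^^ j) \<circ> ?g ^^ i"
  have ty: "translation ?y l = (int i - int j) * translation ?g l" for l
    using H.power_mem[OF g] H.inv_mem[OF H.power_mem[OF g]]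
    by (simp add: H.trans_comp H.trans_inv H.trans_power[OF g] left_diff_distrib)
  show ?thesis
  proof (cases "i < j")
    case True
    then show ?thesis using assms
      by (intro bexI[OF _ ij(2)] exI[of _ "int j - int i"]) (auto simp: ty tg)
  next
    case False
    then show ?thesis using assms ij(1)
      by (intro bexI[OF _ inv_mem[OF ij(2)]] exI[of _ "int i - int j"])
         (auto simp: trans_inv[OF ij(2)] ty tg)
  qed
qed

text \<open>A Hermite-type basis of the lattice of translation vectors of U, with ray 1 left out
  because the other rays determine it. The entry at \<open>i\<close> generates the values taken
  there by the elements of U that vanish on the rays 2 to \<open>i - 1\<close>.\<close>

definition triangular :: "(nat \<Rightarrow> nat \<times> nat \<Rightarrow> nat \<times> nat) \<Rightarrow> bool" where
  "triangular h \<longleftrightarrow> (\<forall>i\<in>{2..n}. h i \<in> U \<and> (\<forall>j\<in>{2..<i}. translation (h i) j = 0) \<and>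
     (\<forall>y\<in>U. (\<forall>j\<in>{2..<i}. translation y j = 0) \<longrightarrow> translation (h i) i dvd translation y i))"

text \<open>Positive multiples of axis elements for the rays from 3 on make all entries of
  \<open>h 2\<close> positive. Its entry at ray 2 stays the same, and that is all that triangularity
  asks of the first row.\<close>

lemma triangular_exists:
  shows "\<exists>h. triangular h \<and> (\<forall>k\<in>{2..n}. translation (h 2) k > 0)"
proof -
  have "\<exists>h\<in>U. (\<forall>j\<in>{2..<i}. translation h j = 0) \<and> translation h i > 0 \<and>
     (\<forall>y\<in>U. (\<forall>j\<in>{2..<i}. translation y j = 0) \<longrightarrow> translation h i dvd translation y i)"
    if i: "i \<in> {2..n}" for i
  proof -
    let ?A = "{x \<in> U. \<forall>j\<in>{2..<i}. translation x j = 0}"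
    interpret A: houghton_sub n ?A by (rule kernel_sub)
    obtain x c where x: "x \<in> U" "c > 0"
      "\<forall>j. translation x j = (if j = i then c else if j = 1 then - c else 0)"
      using axis_element[OF i] by blast
    then have "x \<in> ?A" "translation x i \<noteq> 0" by auto
    from A.divisor_exists[OF this] show ?thesis by auto
  qed
  then obtain h where h: "\<And>i. i \<in> {2..n} \<Longrightarrow> h i \<in> U \<and> (\<forall>j\<in>{2..<i}. translation (h i) j = 0) \<and>
     translation (h i) i > 0 \<and>
     (\<forall>y\<in>U. (\<forall>j\<in>{2..<i}. translation y j = 0) \<longrightarrow> translation (h i) i dvd translation y i)"
    by metis
  have "\<exists>x\<in>U. translation x 2 = translation (h 2) 2 \<and> (\<forall>k\<in>{2..r}. translation x k > 0)"
    if "2 \<le> r" "r \<le> n" for r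
    using that
  proof (induction r rule: dec_induct)
    case base
    then show ?case using h[of 2] n_ge by (intro bexI[of _ "h 2"]) auto
  next
    case (step r)
    then obtain x where x: "x \<in> U" "translation x 2 = translation (h 2) 2" "\<forall>k\<in>{2..r}. translation x k > 0"
      by auto
    obtain y c where y: "y \<in> U" "c > 0"
      "\<forall>j. translation y j = (if j = Suc r then c else if j = 1 then - c else 0)"
      using axis_element[of "Suc r"] step by auto
    \<comment> \<open>Large enough to outweigh a negative entry, since \<open>c\<close> is at least
      1.\<close>
    define m where "m = \<bar>translation x (Suc r)\<bar> + 1"
    obtain q where q: "q \<in> U" "\<forall>j. translation q j = m * translation y j"
      using multiple_mem[OF y(1)] by blast
    have "m * 1 \<le> m * c" using y(2) by (intro mult_left_mono) (auto simp: m_def)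
    moreover have "translation x (Suc r) + m > 0" unfolding m_def by linarith
    ultimately have pos: "translation x (Suc r) + m * c > 0" by linarith
    have tr: "translation (x \<circ> q) j = translation x j + m * translation y j" for j
      using trans_comp[OF x(1) q(1)] q(2) by simp
    have "translation (x \<circ> q) 2 = translation (h 2) 2" using step(1) x(2) y(3) by (simp add: tr)
    moreover have "translation (x \<circ> q) k > 0" if "k \<in> {2..Suc r}" for k
      using that x(3) y(3) pos by (cases "k = Suc r") (simp_all add: tr)
    ultimately show ?case using comp_mem[OF x(1) q(1)] by blast
  qed
  then obtain x where x: "x \<in> U" "translation x 2 = translation (h 2) 2" "\<forall>k\<in>{2..n}. translation x k > 0"
    using n_ge by blast
  have "triangular (h(2 := x))" using h x unfolding triangular_def by auto
  then show ?thesis using x(3) by (intro exI[of _ "h(2 := x)"]) auto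
qed

text \<open>Elimination of one ray after the other. Only the translations of \<open>h'\<close>
  matter, so finitary corrections of the elements \<open>h i\<close> are allowed.\<close>

lemma triangular_generates:
  assumes h: "triangular h" and \<Gamma>: "houghton_sub n \<Gamma>" "\<Gamma> \<subseteq> U"
    and h': "\<And>i. i \<in> {2..n} \<Longrightarrow> h' i \<in> \<Gamma> \<and> (\<forall>j. translation (h' i) j = translation (h i) j)"
    and x: "x \<in> U"
  shows "\<exists>f\<in>fsym (rays n). \<exists>\<gamma>\<in>\<Gamma>. x = f \<circ> \<gamma>"
proof -
  interpret \<Gamma>: houghton_sub n \<Gamma> by (rule \<Gamma>(1))
  have "\<exists>\<gamma>\<in>\<Gamma>. \<forall>j\<in>{2..r}. translation (x \<circ> \<gamma>) j = 0" if "1 \<le> r" "r \<le> n" for r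
    using that
  proof (induction r rule: dec_induct)
    case base
    show ?case using \<Gamma>.id_mem by auto
  next
    case (step r)
    then obtain \<gamma> where \<gamma>: "\<gamma> \<in> \<Gamma>" "\<forall>j\<in>{2..r}. translation (x \<circ> \<gamma>) j = 0"
      by (meson Suc_leD)
    have r: "Suc r \<in> {2..n}" using step by auto
    have xg: "x \<circ> \<gamma> \<in> U" using x \<gamma> \<Gamma>(2) comp_mem by blast
    have "translation (h (Suc r)) (Suc r) dvd translation (x \<circ> \<gamma>) (Suc r)"
      and tr: "\<forall>j\<in>{2..r}. translation (h (Suc r)) j = 0"
      using h r xg \<gamma>(2) unfolding triangular_def by (auto simp: atLeastLessThanSuc_atLeastAtMost)
    then obtain q where q: "translation (x \<circ> \<gamma>) (Suc r) = translation (h (Suc r)) (Suc r) * q" by blast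
    obtain y where y: "y \<in> \<Gamma>" "\<forall>j. translation y j = (- q) * translation (h' (Suc r)) j"
      using \<Gamma>.multiple_mem h'[OF r] by blast
    have "translation (x \<circ> (\<gamma> \<circ> y)) j = translation (x \<circ> \<gamma>) j + translation y j" for j
      using trans_comp[OF xg, of y] y(1) \<Gamma>(2) by (auto simp: comp_assoc)
    then have "translation (x \<circ> (\<gamma> \<circ> y)) j = translation (x \<circ> \<gamma>) j - q * translation (h (Suc r)) j" for j
      using y(2) h'[OF r] by simp
    then have "translation (x \<circ> (\<gamma> \<circ> y)) j = 0" if "j \<in> {2..Suc r}" for j
      using that \<gamma>(2) tr q by (cases "j = Suc r") simp_all
    then show ?case using \<Gamma>.comp_mem[OF \<gamma>(1) y(1)] by blast
  qed
  from this[of n] obtain \<gamma> where \<gamma>: "\<gamma> \<in> \<Gamma>" "\<forall>j\<in>{2..n}. translation (x \<circ> \<gamma>) j = 0"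
    using n_ge by auto
  have "x \<circ> \<gamma> \<in> fsym (rays n)"
    using \<gamma> x \<Gamma>(2) comp_mem by (intro fsym_of_zero) auto
  moreover have "x = (x \<circ> \<gamma>) \<circ> finv \<gamma>"
    using permutes_inv_o(1)[OF \<Gamma>.permutes_mem[OF \<gamma>(1)]] by (simp add: comp_assoc)
  ultimately show ?thesis using \<Gamma>.inv_mem[OF \<gamma>(1)] by blast
qed

text \<open>Of the triangular elements only \<open>h 2\<close> and \<open>h 3\<close> are changed,
  the former to lose its finite orbits, the latter by the far cycle. Both corrections are even and
  finitary, so they keep the elements in U and their translations intact.\<close>

lemma almost_generators:
  assumes n3: "n \<ge> 3"
  shows "\<exists>S\<subseteq>U. finite S \<and> card S \<le> n - 1 \<and>
    (\<forall>\<Gamma>. houghton_sub n \<Gamma> \<longrightarrow> S \<subseteq> \<Gamma> \<longrightarrow> \<Gamma> \<subseteq> U \<longrightarrow>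
       {f \<in> fsym (rays n). evenperm f} \<subseteq> \<Gamma> \<and>
       (\<forall>x\<in>U. \<exists>f\<in>fsym (rays n). \<exists>\<gamma>\<in>\<Gamma>. x = f \<circ> \<gamma>))"
proof -
  obtain h where h: "triangular h" and pos: "\<And>k. k \<in> {2..n} \<Longrightarrow> translation (h 2) k > 0"
    using triangular_exists by blast
  have hU: "h i \<in> U" if "i \<in> {2..n}" for i using h that by (simp add: triangular_def)
  have h2: "h 2 \<in> U" using hU n_ge by simp
  have split1: "{1..n} = insert 1 {2..n}" using n_ge by auto
  \<comment> \<open>Ray 1 has to balance the positive entries of all other rays, so no entry
    vanishes.\<close>
  have "(\<Sum>i=2..n. translation (h 2) i) > 0" using pos n_ge by (intro sum_pos) auto
  then have neg: "translation (h 2) 1 < 0"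
    using sum_translation[OF n_ge mem_houghton[OF h2]] unfolding split1 by simp
  have "\<exists>f\<in>fsym (rays n). evenperm f \<and> (\<exists>B rep pos. orbit_coordinates (rays n) (f \<circ> h 2) B rep pos)"
  proof (rule even_remove_finite_orbits[OF n_ge mem_houghton[OF h2], of 2 3])
    show "translation (h 2) i \<noteq> 0" if "i \<in> {1..n}" for i
      using that pos[of i] neg unfolding split1 by auto
  qed (use pos n3 in auto)
  then obtain f B rep ps where f: "f \<in> fsym (rays n)" "evenperm f"
    and oc: "orbit_coordinates (rays n) (f \<circ> h 2) B rep ps" by blast
  define u where "u = f \<circ> h 2"
  interpret oc: orbit_coordinates "rays n" u B rep ps using oc by (simp add: u_def)
  have u: "u \<in> U" unfolding u_def using even_fsym_mem[OF f] h2 by (rule comp_mem)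
  have h3: "h 3 \<in> U" using hU n3 by simp
  have "h 3 \<circ> u \<circ> finv (h 3) \<circ> finv u \<in> fsym (rays n)"
  proof (rule fsym_of_zero)
    show "h 3 \<circ> u \<circ> finv (h 3) \<circ> finv u \<in> U" using h3 u by (simp add: comp_mem inv_mem)
    show "translation (h 3 \<circ> u \<circ> finv (h 3) \<circ> finv u) i = 0" for i
      using h3 u by (simp add: comp_mem inv_mem trans_comp trans_inv del: comp_apply)
  qed
  moreover have "B \<noteq> {}" using oc.rep_mem[of "(1,1)"] n_ge by (auto simp: rays_def)
  ultimately obtain \<sigma> where \<sigma>: "\<sigma> \<in> fsym (rays n)" "evenperm \<sigma>"
    "\<And>\<Gamma>. bij_group (rays n) \<Gamma> \<Longrightarrow> u \<in> \<Gamma> \<Longrightarrow> \<sigma> \<circ> h 3 \<in> \<Gamma> \<Longrightarrow> {f \<in> fsym (rays n). evenperm f} \<subseteq> \<Gamma>"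
    using oc.second_generator[OF permutes_mem[OF h3]] by (auto simp: fsym_def)
  define h' where "h' = h(2 := u, 3 := \<sigma> \<circ> h 3)"
  have h'_trans: "translation (h' i) j = translation (h i) j" for i j
    using translation_fsym_comp[OF n_ge mem_houghton[OF h2] f(1)]
      translation_fsym_comp[OF n_ge mem_houghton[OF h3] \<sigma>(1)] by (simp add: h'_def u_def)
  have h'U: "h' i \<in> U" if "i \<in> {2..n}" for i
    using that hU u comp_mem[OF even_fsym_mem[OF \<sigma>(1,2)] h3] by (simp add: h'_def)
  show ?thesis
  proof (intro exI[of _ "h' ` {2..n}"] conjI allI impI)
    show "h' ` {2..n} \<subseteq> U" using h'U by blast
    show "card (h' ` {2..n}) \<le> n - 1" using card_image_le[of "{2..n}" h'] by simp
    fix \<Gamma> assume \<Gamma>: "houghton_sub n \<Gamma>" "h' ` {2..n} \<subseteq> \<Gamma>" "\<Gamma> \<subseteq> U"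
    have "h' 2 \<in> \<Gamma>" "h' 3 \<in> \<Gamma>" using \<Gamma>(2) n3 by auto
    then show "{f \<in> fsym (rays n). evenperm f} \<subseteq> \<Gamma>"
      using \<Gamma>(1) by (intro \<sigma>(3)) (simp_all add: houghton_sub_def h'_def)
    show "\<forall>x\<in>U. \<exists>f\<in>fsym (rays n). \<exists>\<gamma>\<in>\<Gamma>. x = f \<circ> \<gamma>"
      using triangular_generates[OF h \<Gamma>(1,3), of h'] \<Gamma>(2) h'_trans by blast
  qed simp
qed

end

section \<open>Parity of commutators\<close>

text \<open>The conjugating bijection may have infinite support and then has no parity, so the
  conjugation is carried out transposition by transposition.\<close>

lemma swapidseq_conj:
  assumes "bij x" "swapidseq k p"
  shows "swapidseq k (x \<circ> p \<circ> finv x)"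
  using assms(2)
proof (induction rule: swapidseq.induct)
  case id
  have "x \<circ> id \<circ> finv x = id" using assms(1) by (metis bij_is_surj surj_iff comp_id)
  with swapidseq.id show ?case by (simp only:)
next
  case (comp_Suc k p a b)
  have "x \<circ> (transpose a b \<circ> p) \<circ> finv x = (x \<circ> transpose a b \<circ> finv x) \<circ> (x \<circ> p \<circ> finv x)"
    using assms(1) by (simp add: fun_eq_iff bij_is_inj)
  also have "\<dots> = transpose (x a) (x b) \<circ> (x \<circ> p \<circ> finv x)" by (simp only: conj_transpose[OF assms(1)])
  finally have "x \<circ> (transpose a b \<circ> p) \<circ> finv x = transpose (x a) (x b) \<circ> (x \<circ> p \<circ> finv x)" .
  moreover have "x a \<noteq> x b" using comp_Suc.hyps assms(1) by (auto simp: bij_def inj_eq)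
  ultimately show ?case using swapidseq.comp_Suc[OF comp_Suc.IH] by (simp only:)
qed

lemma evenperm_conj:
  assumes "bij x" "permutation p"
  shows "evenperm (x \<circ> p \<circ> finv x) \<longleftrightarrow> evenperm p"
proof -
  obtain k where k: "swapidseq k p" using assms(2) by (auto simp: permutation_def)
  show ?thesis
    using evenperm_unique[OF k refl] evenperm_unique[OF swapidseq_conj[OF assms(1) k] refl] by simp
qed

definition commutator :: "('a \<Rightarrow> 'a) \<Rightarrow> ('a \<Rightarrow> 'a) \<Rightarrow> 'a \<Rightarrow> 'a" where
  "commutator x y = x \<circ> y \<circ> finv x \<circ> finv y"

text \<open>As conjugation preserves parity, this identity makes the parity of a commutator additive
  in its first argument.\<close>

lemma commutator_comp:
  assumes "bij x" "bij x'" "bij y"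
  shows "commutator (x \<circ> x') y = (x \<circ> commutator x' y \<circ> finv x) \<circ> commutator x y"
  using assms by (simp add: commutator_def fun_eq_iff o_inv_distrib bij_is_inj)

lemma commutator_swap:
  assumes "bij x" "bij y"
  shows "commutator y x = finv (commutator x y)"
proof (rule sym, rule inv_unique_comp)
  show "commutator x y \<circ> commutator y x = id" "commutator y x \<circ> commutator x y = id"
    using assms by (simp_all add: commutator_def fun_eq_iff bij_is_inj bij_is_surj surj_f_inv_f)
qed

lemma fsym_bij: "f \<in> fsym X \<Longrightarrow> bij f"
  using permutes_bij by (auto simp: fsym_def)

lemma fsym_inv: "f \<in> fsym X \<Longrightarrow> finv f \<in> fsym X"
proof -
  assume f: "f \<in> fsym X"
  have "{x. finv f x \<noteq> x} = {x. f x \<noteq> x}"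
    using fsym_bij[OF f] by (metis bij_inv_eq_iff)
  then show ?thesis using f by (simp add: fsym_def permutes_inv)
qed

context houghton_sub begin

lemma commutator_mem: "x \<in> U \<Longrightarrow> y \<in> U \<Longrightarrow> commutator x y \<in> U"
  unfolding commutator_def by (intro comp_mem inv_mem)

lemma commutator_fsym:
  assumes "x \<in> U" "y \<in> U"
  shows "commutator x y \<in> fsym (rays n)"
proof (rule fsym_of_zero[OF commutator_mem[OF assms]])
  show "translation (commutator x y) i = 0" for i
    unfolding commutator_def using assms by (simp add: trans_comp trans_inv comp_mem inv_mem)
qed

lemma commutator_permutation: "x \<in> U \<Longrightarrow> y \<in> U \<Longrightarrow> permutation (commutator x y)"
  using commutator_fsym fsym_permutation by blast

lemma even_commutator_comp:
  assumes "x \<in> U" "x' \<in> U" "y \<in> U"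
  shows "evenperm (commutator (x \<circ> x') y) \<longleftrightarrow> (evenperm (commutator x' y) \<longleftrightarrow> evenperm (commutator x y))"
proof -
  have b: "bij x" "bij x'" "bij y" using assms bij_mem by auto
  have "x \<circ> commutator x' y \<circ> finv x \<in> fsym (rays n)"
  proof (rule fsym_of_zero)
    show "x \<circ> commutator x' y \<circ> finv x \<in> U" using assms by (intro comp_mem inv_mem commutator_mem)
    show "translation (x \<circ> commutator x' y \<circ> finv x) i = 0" for i
      using assms translation_fsym[OF commutator_fsym[OF assms(2,3)]]
      by (simp add: trans_comp trans_inv comp_mem inv_mem commutator_mem)
  qed
  from evenperm_comp[OF fsym_permutation[OF this] commutator_permutation[OF assms(1,3)]]
  show ?thesis
    unfolding commutator_comp[OF b] evenperm_conj[OF b(1) commutator_permutation[OF assms(2,3)]] .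
qed

lemma even_commutator_swap:
  assumes "x \<in> U" "y \<in> U"
  shows "evenperm (commutator y x) \<longleftrightarrow> evenperm (commutator x y)"
  using evenperm_inv[OF commutator_permutation[OF assms]] commutator_swap[of x y] assms bij_mem by auto

lemma even_commutator_inv:
  assumes "x \<in> U" "y \<in> U"
  shows "evenperm (commutator (finv x) y) \<longleftrightarrow> evenperm (commutator x y)"
proof -
  have "finv x \<circ> x = id" using permutes_inv_o(2)[OF permutes_mem[OF assms(1)]] .
  moreover have "commutator id y = id"
    using permutes_inv_o(1)[OF permutes_mem[OF assms(2)]] by (simp add: commutator_def)
  ultimately have "evenperm (commutator (finv x \<circ> x) y)" by (simp add: evenperm_id)
  then show ?thesis using even_commutator_comp[OF inv_mem[OF assms(1)] assms] by blast
qed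

text \<open>Both parities are additive in \<open>x\<close>, so the formula has to be checked on
  generators only.\<close>

lemma even_commutator_sub:
  assumes "y \<in> U"
  shows "houghton_sub n {x \<in> U. evenperm (commutator x y) \<longleftrightarrow> even (\<Sum>i=1..n. translation x i * translation y i)}"
    (is "houghton_sub n ?A")
proof
  have "commutator id y = id"
    using permutes_inv_o(1)[OF permutes_mem[OF assms]] by (simp add: commutator_def)
  then show "id \<in> ?A" by (simp add: id_mem evenperm_id translation_id)
  show "p \<circ> q \<in> ?A" if "p \<in> ?A" "q \<in> ?A" for p q
    using that assms by (simp add: comp_mem even_commutator_comp trans_comp ring_distribs sum.distrib) blast
  show "finv p \<in> ?A" if "p \<in> ?A" for p
    using that assms by (simp add: inv_mem even_commutator_inv trans_inv sum_negf)
qed (use permutes_mem n_ge mem_houghton in auto)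

end

section \<open>The parity formula, from the ray shifts to the whole group\<close>

lemma perm_group_generate_subset:
  assumes "bij_group X \<Gamma>" "S \<subseteq> \<Gamma>"
  shows "generate (perm_group X) S \<subseteq> \<Gamma>"
proof
  interpret bij_group X \<Gamma> by fact
  fix p assume "p \<in> generate (perm_group X) S"
  then show "p \<in> \<Gamma>"
  proof induction
    case one then show ?case using id_mem by (simp add: perm_group_def id_def)
  next
    case (incl h) then show ?case using assms(2) by blast
  next
    case (inv h)
    then have "h \<in> \<Gamma>" using assms(2) by blast
    then show ?case using inv_perm_group[OF permutes_mem] inv_mem by metis
  next
    case (eng p q) then show ?case using comp_mem by (simp add: perm_group_def o_def)
  qed
qed

lemma houghton_induct:
  assumes "n \<ge> 3" "houghton_sub n \<Gamma>" "\<And>k. k \<in> {2..n} \<Longrightarrow> ray_shift k \<in> \<Gamma>"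
  shows "carrier (houghton n) \<subseteq> \<Gamma>"
proof -
  have "houghton_gens n \<subseteq> \<Gamma>" using assms by (auto simp: houghton_gens_def)
  then show ?thesis
    using carrier_houghton[of n] assms(1) perm_group_generate_subset[of "rays n" \<Gamma>] assms(2)
    by (simp add: houghton_sub_def)
qed

lemma houghton_full: "n \<ge> 2 \<Longrightarrow> houghton_sub n (carrier (houghton n))"
  by (rule houghton_sub_of_subgroup[OF _ group.subgroup_self[OF group_houghton]])

lemma ray_shift_swap:
  assumes "k \<ge> 2" "l \<ge> 2" "k \<noteq> l"
  shows "ray_shift l \<circ> ray_shift k = transpose (1, 1) (1, 2) \<circ> (ray_shift k \<circ> ray_shift l)"
  by (rule ext) (use assms in \<open>auto simp: ray_shift_def transpose_def split: if_splits\<close>)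

lemma translation_ray_shift:
  "k \<ge> 2 \<Longrightarrow> translation (ray_shift k) i = (if i = 1 then 1 else if i = k then - 1 else 0)"
  by (rule translation_eq, rule translates_ray_shift)

text \<open>For equal shifts rays 1 and \<open>k\<close> contribute to the scalar product, which is
  2. For different shifts only ray 1 contributes, giving 1, and the commutator is a single
  transposition.\<close>

lemma even_commutator_ray_shift:
  assumes "n \<ge> 3" "k \<in> {2..n}" "l \<in> {2..n}"
  shows "evenperm (commutator (ray_shift l) (ray_shift k)) \<longleftrightarrow>
    even (\<Sum>i=1..n. translation (ray_shift l) i * translation (ray_shift k) i)"
proof -
  have b: "bij (ray_shift k)" "bij (ray_shift l)"
    using ray_shift_permutes assms permutes_bij by blast+
  have split1: "{1..n} = insert 1 {2..n}" using assms by auto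
  show ?thesis
  proof (cases "k = l")
    case True
    have "commutator (ray_shift l) (ray_shift k) = id"
      using b True by (simp add: commutator_def fun_eq_iff bij_is_surj surj_f_inv_f bij_is_inj)
    moreover have "(\<Sum>i=2..n. translation (ray_shift l) i * translation (ray_shift k) i)
        = (\<Sum>i=2..n. if i = k then 1 else 0)"
      using True assms by (intro sum.cong) (auto simp: translation_ray_shift)
    ultimately show ?thesis
      using True assms unfolding split1 by (simp add: evenperm_id translation_ray_shift)
  next
    case False
    have "commutator (ray_shift l) (ray_shift k) =
        (ray_shift l \<circ> ray_shift k) \<circ> finv (ray_shift l) \<circ> finv (ray_shift k)"
      by (simp add: commutator_def)
    also have "\<dots> = transpose (1, 1) (1, 2)"
      unfolding ray_shift_swap[of k l, OF _ _ False, OF atLeastAtMost_iff[THEN iffD1, THEN conjunct1, OF assms(2)]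
          atLeastAtMost_iff[THEN iffD1, THEN conjunct1, OF assms(3)]]
      using b by (simp add: fun_eq_iff bij_is_surj surj_f_inv_f)
    finally have "\<not> evenperm (commutator (ray_shift l) (ray_shift k))"
      by (simp add: evenperm_swap)
    moreover have "(\<Sum>i=2..n. translation (ray_shift l) i * translation (ray_shift k) i) = 0"
      using False assms by (intro sum.neutral) (auto simp: translation_ray_shift)
    ultimately show ?thesis
      using assms unfolding split1 by (simp add: translation_ray_shift)
  qed
qed

lemma even_commutator_iff:
  assumes n: "n \<ge> 3" and x: "x \<in> carrier (houghton n)" and y: "y \<in> carrier (houghton n)"
  shows "evenperm (commutator x y) \<longleftrightarrow> even (\<Sum>i=1..n. translation x i * translation y i)"
proof -
  interpret H: houghton_sub n "carrier (houghton n)" using n by (intro houghton_full) simp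
  have shift: "ray_shift k \<in> carrier (houghton n)" if "k \<in> {2..n}" for k
    using ray_shift_in_houghton[of n k] n that by simp
  have gen: "evenperm (commutator x (ray_shift k)) \<longleftrightarrow>
      even (\<Sum>i=1..n. translation x i * translation (ray_shift k) i)"
    if "x \<in> carrier (houghton n)" "k \<in> {2..n}" for x k
    using houghton_induct[OF n H.even_commutator_sub[OF shift[OF that(2)]]] that
      even_commutator_ray_shift[OF n that(2)] shift by blast
  have "carrier (houghton n) \<subseteq> {x \<in> carrier (houghton n). evenperm (commutator x y) \<longleftrightarrow>
      even (\<Sum>i=1..n. translation x i * translation y i)}"
    using gen[OF y] shift y H.even_commutator_swap[OF y]
    by (intro houghton_induct[OF n H.even_commutator_sub[OF y]]) (auto simp: mult.commute)
  then show ?thesis using x by blast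
qed

section \<open>Bounds on the number of generators\<close>

context houghton_sub begin

lemma subgroup_U: "subgroup U (houghton n)"
proof (rule group.subgroupI[OF group_houghton subset])
  show "U \<noteq> {}" using id_mem by blast
  show "inv\<^bsub>houghton n\<^esub> a \<in> U" if "a \<in> U" for a
    using houghton_m_inv[OF n_ge mem_houghton[OF that]] inv_mem[OF that] by simp
  show "a \<otimes>\<^bsub>houghton n\<^esub> b \<in> U" if "a \<in> U" "b \<in> U" for a b
    using comp_mem[OF that(2,1)] by simp
qed

abbreviation G where "G \<equiv> (houghton n)\<lparr>carrier := U\<rparr>"

lemma generate_least:
  assumes "S \<subseteq> U" "bij_group X \<Gamma>" "S \<subseteq> \<Gamma>"
  shows "generate G S \<subseteq> \<Gamma>"
proof
  interpret \<Gamma>: bij_group X \<Gamma> by fact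
  fix p assume "p \<in> generate G S"
  then show "p \<in> \<Gamma>"
  proof induction
    case one then show ?case using \<Gamma>.id_mem by (simp add: houghton_one id_def)
  next
    case (incl h) then show ?case using assms(3) by blast
  next
    case (inv h)
    then have h: "h \<in> \<Gamma>" "h \<in> U" using assms by blast+
    then show ?case using subgroup_m_inv[OF n_ge subgroup_U] \<Gamma>.inv_mem by metis
  next
    case (eng p q) then show ?case using \<Gamma>.comp_mem by (simp add: o_def)
  qed
qed

end

context finite_index begin

text \<open>A functional modulo \<open>p\<close> on translation vectors is determined by its values
  on a generating set. So \<open>p ^ (n - 1)\<close> functionals embed into the
  \<open>p ^ card S\<close> possible tables of values.\<close>

lemma rank_ge: "enat (n - 1) \<le> min_generators G"
proof (rule min_generators_ge)
  fix S assume S: "S \<subseteq> carrier G" "finite S" "generate G S = carrier G"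
  obtain a c where a: "\<And>k. k \<in> {2..n} \<Longrightarrow> a k \<in> U" and c: "\<And>k. k \<in> {2..n} \<Longrightarrow> c k > 0"
    and ac: "\<And>k i. k \<in> {2..n} \<Longrightarrow> translation (a k) i = (if i = k then c k else if i = 1 then - c k else 0)"
    using axis_element by metis
  \<comment> \<open>Coprime to every \<open>c k\<close> by construction, so that \<open>c k\<close>
    can be cancelled modulo \<open>p\<close>.\<close>
  define p where "p = (\<Prod>k\<in>{2..n}. c k) + 1"
  have "(\<Prod>k\<in>{2..n}. c k) > 0" using c by (intro prod_pos) auto
  then have p: "p \<ge> 2" by (simp add: p_def)
  have cop: "coprime p (c k)" if "k \<in> {2..n}" for k
  proof (rule coprimeI)
    fix d assume "d dvd p" "d dvd c k"
    moreover have "c k dvd (\<Prod>k\<in>{2..n}. c k)" using that by (intro dvd_prodI) auto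
    ultimately show "is_unit d" unfolding p_def by (metis dvd_add_right_iff dvd_trans)
  qed
  let ?V = "{2..n} \<rightarrow>\<^sub>E {0..<p}"
  define \<Phi> where "\<Phi> v = (\<lambda>s\<in>S. (\<Sum>k=2..n. v k * translation s k) mod p)" for v
  have "inj_on \<Phi> ?V"
  proof
    fix v w assume v: "v \<in> ?V" and w: "w \<in> ?V" and eq: "\<Phi> v = \<Phi> w"
    \<comment> \<open>The elements on which the two functionals agree form a group, which contains
      the generators and hence U.\<close>
    let ?A = "{x \<in> U. p dvd (\<Sum>k=2..n. (v k - w k) * translation x k)}"
    have "houghton_sub n ?A"
    proof
      show "x \<circ> y \<in> ?A" if "x \<in> ?A" "y \<in> ?A" for x y
        using that by (simp add: comp_mem trans_comp distrib_left sum.distrib)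
      show "finv x \<in> ?A" if "x \<in> ?A" for x
        using that by (auto simp: inv_mem trans_inv sum_negf)
    qed (auto simp: permutes_mem id_mem translation_id n_ge mem_houghton)
    moreover have "S \<subseteq> ?A"
    proof
      fix s assume s: "s \<in> S"
      then have "(\<Sum>k=2..n. v k * translation s k) mod p = (\<Sum>k=2..n. w k * translation s k) mod p"
        using eq by (simp add: \<Phi>_def fun_eq_iff restrict_def) metis
      then have "p dvd (\<Sum>k=2..n. v k * translation s k) - (\<Sum>k=2..n. w k * translation s k)"
        by (simp add: mod_eq_dvd_iff)
      then show "s \<in> ?A" using s S(1) by (auto simp: left_diff_distrib sum_subtractf)
    qed
    ultimately have "U \<subseteq> ?A"
      using generate_least[of S "rays n" ?A] S(1,3) by (simp add: houghton_sub_def)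
    then have dvd: "p dvd (\<Sum>k=2..n. (v k - w k) * translation x k)" if "x \<in> U" for x using that by blast
    have "v k = w k" if k: "k \<in> {2..n}" for k
    proof -
      have "(\<Sum>i=2..n. (v i - w i) * translation (a k) i) = (\<Sum>i=2..n. if i = k then (v k - w k) * c k else 0)"
        using k by (intro sum.cong) (auto simp: ac[OF k])
      also have "\<dots> = (v k - w k) * c k" using k by simp
      finally have "p dvd (v k - w k) * c k" using dvd[OF a[OF k]] by simp
      then have "p dvd v k - w k" using cop[OF k] by (simp add: coprime_dvd_mult_left_iff)
      moreover have "v k \<in> {0..<p}" "w k \<in> {0..<p}" using v w k by blast+
      then have "\<bar>v k - w k\<bar> < p" by auto
      ultimately show ?thesis using dvd_imp_le_int[of "v k - w k" p] by fastforce
    qed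
    then show "v = w" using v w by (intro PiE_ext) auto
  qed
  moreover have "\<Phi> ` ?V \<subseteq> S \<rightarrow>\<^sub>E {0..<p}" using p by (auto simp: \<Phi>_def)
  moreover have "finite (S \<rightarrow>\<^sub>E {0..<p})" using S(2) by (intro finite_PiE) auto
  ultimately have "card ?V \<le> card (S \<rightarrow>\<^sub>E {0..<p})" by (intro card_inj_on_le)
  then have "nat p ^ (n - 1) \<le> nat p ^ card S" using S(2) by (simp add: card_PiE)
  then show "n - 1 \<le> card S" using p power_increasing_iff[of "nat p" "n - 1" "card S"] by simp
qed

text \<open>The set \<open>T\<close> holds additional generators, in the applications none or one
  transposition. As \<Gamma> exhausts U modulo finitary permutations, only the finitary part of U
  remains to be reached.\<close>

lemma rank_le_if_fsym_covered:
  assumes "n \<ge> 3"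
    and cover: "\<And>\<Gamma>. houghton_sub n \<Gamma> \<Longrightarrow> \<Gamma> \<subseteq> U \<Longrightarrow> T \<subseteq> \<Gamma> \<Longrightarrow> {f \<in> fsym (rays n). evenperm f} \<subseteq> \<Gamma> \<Longrightarrow>
       (\<And>x. x \<in> U \<Longrightarrow> \<exists>f\<in>fsym (rays n). \<exists>\<gamma>\<in>\<Gamma>. x = f \<circ> \<gamma>) \<Longrightarrow> fsym (rays n) \<inter> U \<subseteq> \<Gamma>"
    and T: "T \<subseteq> U" "finite T"
  shows "min_generators G \<le> enat (n - 1 + card T)"
proof -
  obtain S where S: "S \<subseteq> U" "finite S" "card S \<le> n - 1"
    and gen: "\<And>\<Gamma>. houghton_sub n \<Gamma> \<Longrightarrow> S \<subseteq> \<Gamma> \<Longrightarrow> \<Gamma> \<subseteq> U \<Longrightarrow>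
       {f \<in> fsym (rays n). evenperm f} \<subseteq> \<Gamma> \<and> (\<forall>x\<in>U. \<exists>f\<in>fsym (rays n). \<exists>\<gamma>\<in>\<Gamma>. x = f \<circ> \<gamma>)"
    using almost_generators[OF assms(1)] by (elim exE conjE) presburger
  have "generate G (S \<union> T) = U"
  proof (rule generate_eqI[OF n_ge subgroup_U])
    show "S \<union> T \<subseteq> U" using S T by blast
    fix \<Gamma> assume \<Gamma>: "houghton_sub n \<Gamma>" "S \<union> T \<subseteq> \<Gamma>" "\<Gamma> \<subseteq> U"
    interpret \<Gamma>: houghton_sub n \<Gamma> by (rule \<Gamma>(1))
    have g: "{f \<in> fsym (rays n). evenperm f} \<subseteq> \<Gamma>" "\<And>x. x \<in> U \<Longrightarrow> \<exists>f\<in>fsym (rays n). \<exists>\<gamma>\<in>\<Gamma>. x = f \<circ> \<gamma>"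
      using gen[OF \<Gamma>(1) _ \<Gamma>(3)] \<Gamma>(2) by blast+
    have fU: "fsym (rays n) \<inter> U \<subseteq> \<Gamma>" by (rule cover[OF \<Gamma>(1,3) _ g]) (use \<Gamma>(2) in auto)
    show "U \<subseteq> \<Gamma>"
    proof
      fix x assume x: "x \<in> U"
      then obtain f \<gamma> where f: "f \<in> fsym (rays n)" "\<gamma> \<in> \<Gamma>" "x = f \<circ> \<gamma>" using g(2) by blast
      have "f = x \<circ> finv \<gamma>"
        using permutes_inv_o(1)[OF \<Gamma>.permutes_mem[OF f(2)]] f(3) by (simp add: comp_assoc)
      then have "f \<in> U" using x f(2) \<Gamma>(3) comp_mem inv_mem by blast
      then have "f \<in> \<Gamma>" using fU f(1) by blast
      then show "x \<in> \<Gamma>" using f \<Gamma>.comp_mem by simp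
    qed
  qed
  moreover have "card (S \<union> T) \<le> n - 1 + card T" using card_Un_le[of S T] S(3) by simp
  ultimately show ?thesis using S T by (intro min_generators_le[of "S \<union> T"]) auto
qed

lemma fsym_mem_if_odd:
  assumes "bij_group X \<Gamma>" "f0 \<in> \<Gamma>" "f0 \<in> fsym (rays n)" "\<not> evenperm f0"
    and even: "{f \<in> fsym (rays n). evenperm f} \<subseteq> \<Gamma>"
  shows "fsym (rays n) \<subseteq> \<Gamma>"
proof
  interpret \<Gamma>: bij_group X \<Gamma> by fact
  fix f assume f: "f \<in> fsym (rays n)"
  show "f \<in> \<Gamma>"
  proof (cases "evenperm f")
    case False
    have "f0 \<circ> f \<in> fsym (rays n)" "evenperm (f0 \<circ> f)"
      using fsym_comp[OF assms(3) f] False assms(4)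
        evenperm_comp[OF fsym_permutation[OF assms(3)] fsym_permutation[OF f]] by auto
    then have "finv f0 \<circ> (f0 \<circ> f) \<in> \<Gamma>" using even assms(2) \<Gamma>.comp_mem \<Gamma>.inv_mem by blast
    moreover have "finv f0 \<circ> (f0 \<circ> f) = f"
      using fsym_bij[OF assms(3)] by (simp add: fun_eq_iff bij_is_inj)
    ultimately show ?thesis by simp
  qed (use f even in blast)
qed

text \<open>One odd finitary permutation in U would bring in all of them, so here the finitary part
  of U is even and \<Gamma> already contains it.\<close>

lemma rank_le_if_even:
  assumes "n \<ge> 3" "\<not> fsym (rays n) \<subseteq> U"
  shows "min_generators G \<le> enat (n - 1)"
proof -
  have "bij_group (rays n) U" ..
  then have "evenperm f" if "f \<in> fsym (rays n) \<inter> U" for f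
    using fsym_mem_if_odd[of "rays n" U f] that assms(2) even_fsym_mem by blast
  then have "min_generators G \<le> enat (n - 1 + card ({} :: (nat \<times> nat \<Rightarrow> nat \<times> nat) set))"
    by (intro rank_le_if_fsym_covered[OF assms(1)]) auto
  then show ?thesis by simp
qed

lemma rank_le:
  assumes "n \<ge> 3"
  shows "min_generators G \<le> enat n"
proof (cases "fsym (rays n) \<subseteq> U")
  case True
  let ?t = "transpose (1, 1) (1, 2) :: nat \<times> nat \<Rightarrow> nat \<times> nat"
  have t: "?t \<in> fsym (rays n)" using n_ge by (intro transpose_fsym) (auto simp: rays_def)
  have "min_generators G \<le> enat (n - 1 + card {?t})"
  proof (rule rank_le_if_fsym_covered[OF assms])
    fix \<Gamma> assume "houghton_sub n \<Gamma>" "{?t} \<subseteq> \<Gamma>" "{f \<in> fsym (rays n). evenperm f} \<subseteq> \<Gamma>"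
    then show "fsym (rays n) \<inter> U \<subseteq> \<Gamma>"
      using fsym_mem_if_odd[of "rays n" \<Gamma> ?t] t by (auto simp: houghton_sub_def evenperm_swap)
  qed (use t True in auto)
  then show ?thesis using assms by simp
next
  case False
  then have "min_generators G \<le> enat (n - 1)" by (rule rank_le_if_even[OF assms])
  also have "\<dots> \<le> enat n" by simp
  finally show ?thesis .
qed

text \<open>The group \<Gamma> contains elements with the translations of \<open>x\<close> and
  \<open>y\<close>. Translations alone decide the parity, so the commutator of these elements is an
  odd finitary permutation in \<Gamma>.\<close>

lemma rank_le_if_odd_commutator:
  assumes n3: "n \<ge> 3" and xy: "x \<in> U" "y \<in> U" "\<not> evenperm (commutator x y)"
  shows "min_generators G \<le> enat (n - 1)"
proof -
  have "min_generators G \<le> enat (n - 1 + card ({} :: (nat \<times> nat \<Rightarrow> nat \<times> nat) set))"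
  proof (rule rank_le_if_fsym_covered[OF n3])
    fix \<Gamma> assume \<Gamma>: "houghton_sub n \<Gamma>" "\<Gamma> \<subseteq> U" "{f \<in> fsym (rays n). evenperm f} \<subseteq> \<Gamma>"
      and dec: "\<And>x. x \<in> U \<Longrightarrow> \<exists>f\<in>fsym (rays n). \<exists>\<gamma>\<in>\<Gamma>. x = f \<circ> \<gamma>"
    interpret \<Gamma>: houghton_sub n \<Gamma> by (rule \<Gamma>(1))
    obtain f a where a: "f \<in> fsym (rays n)" "a \<in> \<Gamma>" "x = f \<circ> a" using dec[OF xy(1)] by blast
    obtain g b where b: "g \<in> fsym (rays n)" "b \<in> \<Gamma>" "y = g \<circ> b" using dec[OF xy(2)] by blast
    have "translation x i = translation a i" "translation y i = translation b i" for i
      using translation_fsym_comp[OF n_ge \<Gamma>.mem_houghton] a b by auto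
    then have "\<not> evenperm (commutator a b)"
      using xy even_commutator_iff[OF n3] mem_houghton \<Gamma>.mem_houghton a(2) b(2) by simp
    then have "fsym (rays n) \<subseteq> \<Gamma>"
      using \<Gamma>.commutator_mem[OF a(2) b(2)] \<Gamma>.commutator_fsym[OF a(2) b(2)] \<Gamma>(1,3)
      by (intro fsym_mem_if_odd[of "rays n" \<Gamma>]) (auto simp: houghton_sub_def)
    then show "fsym (rays n) \<inter> U \<subseteq> \<Gamma>" by blast
  qed auto
  then show ?thesis by simp
qed

end

section \<open>Groups with even commutators\<close>

lemma fsym_conj:
  assumes "x permutes X" "f \<in> fsym X"
  shows "x \<circ> f \<circ> finv x \<in> fsym X"
proof -
  have b: "bij x" using assms(1) permutes_bij by blast
  have "{z. (x \<circ> f \<circ> finv x) z \<noteq> z} \<subseteq> x ` {z. f z \<noteq> z}"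
  proof
    fix z assume z: "z \<in> {z. (x \<circ> f \<circ> finv x) z \<noteq> z}"
    obtain w where w: "z = x w" using b by (meson bij_pointE)
    then show "z \<in> x ` {z. f z \<noteq> z}" using z b by (auto simp: bij_is_inj)
  qed
  moreover have "finite (x ` {z. f z \<noteq> z})" using assms(2) by (simp add: fsym_def)
  ultimately have "finite {z. (x \<circ> f \<circ> finv x) z \<noteq> z}" by (rule finite_subset)
  then show ?thesis using assms by (auto simp: fsym_def intro!: permutes_compose permutes_inv)
qed

context houghton_sub begin

text \<open>The relations \<open>sim\<close> and \<open>congr\<close> are congruence modulo the finitary alternating group and modulo
  its product with the squares of elements of \<open>U\<close>.\<close>

definition sim where
  "sim x y \<longleftrightarrow> (\<exists>e\<in>fsym (rays n). evenperm e \<and> x = e \<circ> y)"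

definition congr where
  "congr x y \<longleftrightarrow> (\<exists>z\<in>U. sim x (z \<circ> z \<circ> y))"

lemma sim_refl [simp]: "sim x x"
  unfolding sim_def by (rule bexI[of _ id]) (auto simp: evenperm_id fsym_def permutes_id)

lemma sim_sym: "sim x y \<Longrightarrow> sim y x"
proof -
  assume "sim x y"
  then obtain e where e: "e \<in> fsym (rays n)" "evenperm e" "x = e \<circ> y" by (auto simp: sim_def)
  have "y = finv e \<circ> x" using e fsym_bij[OF e(1)] by (simp add: fun_eq_iff bij_is_inj)
  then show ?thesis unfolding sim_def
    using fsym_inv[OF e(1)] evenperm_inv[OF fsym_permutation[OF e(1)]] e(2) by blast
qed

lemma sim_trans: "sim x y \<Longrightarrow> sim y z \<Longrightarrow> sim x z"
proof -
  assume "sim x y" "sim y z"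
  then obtain e f where e: "e \<in> fsym (rays n)" "evenperm e" "x = e \<circ> y"
    and f: "f \<in> fsym (rays n)" "evenperm f" "y = f \<circ> z" by (auto simp: sim_def)
  have "evenperm (e \<circ> f)"
    using e f evenperm_comp[OF fsym_permutation[OF e(1)] fsym_permutation[OF f(1)]] by simp
  moreover have "x = (e \<circ> f) \<circ> z" using e f by (simp add: comp_assoc)
  ultimately show ?thesis unfolding sim_def using fsym_comp[OF e(1) f(1)] by blast
qed

text \<open>The finitary factor of \<open>y\<close> is moved past \<open>x'\<close> by conjugation,
  which keeps it even.\<close>

lemma sim_comp:
  assumes "sim x x'" "sim y y'" "x' \<in> U"
  shows "sim (x \<circ> y) (x' \<circ> y')"
proof -
  obtain e f where e: "e \<in> fsym (rays n)" "evenperm e" "x = e \<circ> x'"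
    and f: "f \<in> fsym (rays n)" "evenperm f" "y = f \<circ> y'" using assms by (auto simp: sim_def)
  let ?f = "x' \<circ> f \<circ> finv x'"
  have F: "?f \<in> fsym (rays n)" by (rule fsym_conj[OF permutes_mem[OF assms(3)] f(1)])
  have "evenperm ?f" using evenperm_conj[OF bij_mem[OF assms(3)] fsym_permutation[OF f(1)]] f(2) by simp
  then have "evenperm (e \<circ> ?f)"
    using e evenperm_comp[OF fsym_permutation[OF e(1)] fsym_permutation[OF F]] by simp
  moreover have "x \<circ> y = (e \<circ> ?f) \<circ> (x' \<circ> y')"
    unfolding e(3) f(3) using bij_mem[OF assms(3)] by (auto simp: fun_eq_iff bij_is_inj)
  ultimately show ?thesis unfolding sim_def using fsym_comp[OF e(1) F] by blast
qed

lemma sim_translation: "sim x y \<Longrightarrow> y \<in> U \<Longrightarrow> translation x i = translation y i"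
  using translation_fsym_comp[OF n_ge mem_houghton] by (auto simp: sim_def)

end

locale even_commutators = houghton_sub +
  assumes even_commutator: "x \<in> U \<Longrightarrow> y \<in> U \<Longrightarrow> evenperm (commutator x y)"
begin

lemma sim_commute: "x \<in> U \<Longrightarrow> y \<in> U \<Longrightarrow> sim (x \<circ> y) (y \<circ> x)"
proof -
  assume "x \<in> U" "y \<in> U"
  moreover from this have "x \<circ> y = commutator x y \<circ> (y \<circ> x)"
    using bij_mem by (simp add: commutator_def fun_eq_iff bij_is_inj)
  ultimately show ?thesis unfolding sim_def using even_commutator commutator_fsym by blast
qed

lemma congr_refl: "congr x x"
  unfolding congr_def by (rule bexI[of _ id]) (auto simp: id_mem)

lemma sim_congr: "sim x y \<Longrightarrow> congr y z \<Longrightarrow> congr x z"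
  unfolding congr_def using sim_trans by blast

lemma congr_comp:
  assumes "congr x y" "s \<in> U" "y \<in> U"
  shows "congr (x \<circ> s) (y \<circ> s)"
proof -
  obtain z where z: "z \<in> U" "sim x (z \<circ> z \<circ> y)" using assms by (auto simp: congr_def)
  have "sim (x \<circ> s) ((z \<circ> z \<circ> y) \<circ> s)" using z assms by (intro sim_comp) (auto intro: comp_mem)
  then show ?thesis unfolding congr_def using z(1) by (metis comp_assoc)
qed

lemma sim_square:
  assumes "z \<in> U" "t \<in> U"
  shows "sim (z \<circ> z \<circ> (t \<circ> t)) ((z \<circ> t) \<circ> (z \<circ> t))"
proof -
  have "sim (z \<circ> ((z \<circ> t) \<circ> t)) (z \<circ> ((t \<circ> z) \<circ> t))"
    by (rule sim_comp[OF sim_refl sim_comp[OF sim_commute[OF assms] sim_refl comp_mem[OF assms(2,1)]] assms(1)])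
  then show ?thesis by (simp add: comp_assoc)
qed

lemma congr_trans:
  assumes "congr x y" "congr y w" "x \<in> U" "y \<in> U" "w \<in> U"
  shows "congr x w"
proof -
  obtain z t where z: "z \<in> U" "sim x (z \<circ> z \<circ> y)" and t: "t \<in> U" "sim y (t \<circ> t \<circ> w)"
    using assms by (auto simp: congr_def)
  have "sim (z \<circ> z \<circ> y) (z \<circ> z \<circ> (t \<circ> t \<circ> w))" using z t by (intro sim_comp sim_refl comp_mem)
  then have "sim x ((z \<circ> z \<circ> (t \<circ> t)) \<circ> w)" using z(2) sim_trans by (metis comp_assoc)
  moreover have "sim ((z \<circ> z \<circ> (t \<circ> t)) \<circ> w) (((z \<circ> t) \<circ> (z \<circ> t)) \<circ> w)"
    by (rule sim_comp[OF sim_square[OF z(1) t(1)] sim_refl]) (intro comp_mem z t)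
  ultimately show ?thesis unfolding congr_def using sim_trans comp_mem[OF z(1) t(1)] by blast
qed

text \<open>A new generator \<open>s\<close> at most doubles the set, adding the products of its
  elements with \<open>s\<close>: a second factor \<open>s\<close> completes a square, and factors
  commute modulo even finitary permutations.\<close>

lemma representatives:
  assumes "finite S" "S \<subseteq> U"
  shows "\<exists>R\<subseteq>U. finite R \<and> card R \<le> 2 ^ card S \<and> id \<in> R \<and> (\<forall>r\<in>R. \<forall>a\<in>S. \<exists>r'\<in>R. congr (r \<circ> a) r')"
  using assms
proof (induction S rule: finite_induct)
  case empty
  show ?case by (rule exI[of _ "{id}"]) (use id_mem in auto)
next
  case (insert s A)
  then obtain R where R: "R \<subseteq> U" "finite R" "card R \<le> 2 ^ card A" "id \<in> R"
    "\<forall>r\<in>R. \<forall>a\<in>A. \<exists>r'\<in>R. congr (r \<circ> a) r'" by (meson insert_subset)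
  have s: "s \<in> U" and A: "A \<subseteq> U" using insert by auto
  let ?R = "R \<union> (\<lambda>r. r \<circ> s) ` R"
  have "card ?R \<le> card R + card ((\<lambda>r. r \<circ> s) ` R)" by (rule card_Un_le)
  also have "\<dots> \<le> card R + card R" using card_image_le[OF R(2)] by simp
  also have "\<dots> \<le> 2 ^ card (insert s A)" using R(3) insert by simp
  finally have "card ?R \<le> 2 ^ card (insert s A)" .
  moreover have "\<exists>r'\<in>?R. congr (q \<circ> a) r'" if q: "q \<in> ?R" and a: "a \<in> insert s A" for q a
  proof -
    consider "q \<in> R" "a = s" | "q \<in> R" "a \<in> A" | r where "r \<in> R" "q = r \<circ> s" "a = s"
      | r where "r \<in> R" "q = r \<circ> s" "a \<in> A" using q a by blast
    then show ?thesis
    proof cases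
      case 1
      then show ?thesis using congr_refl by blast
    next
      case 2
      then show ?thesis using R(5) by blast
    next
      case 3
      have "r \<in> U" using 3 R(1) by blast
      then have "sim (r \<circ> (s \<circ> s)) ((s \<circ> s) \<circ> r)" by (intro sim_commute comp_mem s)
      then have "congr (q \<circ> a) r" unfolding congr_def using s 3 by (auto simp: comp_assoc)
      then show ?thesis using 3 by blast
    next
      case 4
      have ra: "r \<in> U" "a \<in> U" using 4 R(1) A by blast+
      obtain r' where r': "r' \<in> R" "congr (r \<circ> a) r'" using 4 R(5) by blast
      have "sim (r \<circ> (s \<circ> a)) (r \<circ> (a \<circ> s))"
        by (rule sim_comp[OF sim_refl sim_commute[OF s ra(2)] ra(1)])
      then have "sim (q \<circ> a) (r \<circ> a \<circ> s)" using 4 by (simp add: comp_assoc)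
      moreover have "congr (r \<circ> a \<circ> s) (r' \<circ> s)" using r' R(1) s by (intro congr_comp) auto
      ultimately show ?thesis using sim_congr r' by blast
    qed
  qed
  moreover have "?R \<subseteq> U" using R(1) s comp_mem by blast
  moreover have "finite ?R" "id \<in> ?R" using R by auto
  ultimately show ?case by blast
qed

text \<open>The elements whose right multiplication keeps \<open>R\<close> up to
  \<open>congr\<close> form a group containing \<open>S\<close>, hence all of U; applied to the
  identity in \<open>R\<close> this covers U.\<close>

lemma representatives_cover:
  assumes "S \<subseteq> U" "finite S" "generate G S = U"
  shows "\<exists>R\<subseteq>U. finite R \<and> card R \<le> 2 ^ card S \<and> (\<forall>x\<in>U. \<exists>r\<in>R. congr x r)"
proof -
  obtain R where R: "R \<subseteq> U" "finite R" "card R \<le> 2 ^ card S" "id \<in> R"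
    "\<forall>r\<in>R. \<forall>a\<in>S. \<exists>r'\<in>R. congr (r \<circ> a) r'" using representatives[OF assms(2,1)] by blast
  let ?A = "{x \<in> U. \<forall>r\<in>R. \<exists>r'\<in>R. congr (r \<circ> x) r'}"
  have RU: "r \<in> U" if "r \<in> R" for r using R(1) that by blast
  have "bij_group (rays n) ?A"
  proof
    show "id \<in> ?A" using id_mem congr_refl by auto
    fix x assume x: "x \<in> ?A"
    then have xU: "x \<in> U" by simp
    show "x permutes rays n" by (rule permutes_mem[OF xU])
    show "finv x \<in> ?A"
    proof (intro CollectI conjI ballI inv_mem[OF xU])
      fix r assume r: "r \<in> R"
      then obtain r' where r': "r' \<in> R" "congr (r \<circ> x) r'" using x by blast
      have ix: "finv x \<in> U" by (rule inv_mem[OF xU])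
      \<comment> \<open>Squares do not change the class, so the inverse of \<open>x\<close> acts on
        classes as \<open>x\<close> does.\<close>
      have "sim ((r \<circ> x) \<circ> (finv x \<circ> finv x)) ((finv x \<circ> finv x) \<circ> (r \<circ> x))"
        by (intro sim_commute comp_mem RU[OF r] xU ix)
      moreover have "(r \<circ> x) \<circ> (finv x \<circ> finv x) = r \<circ> finv x"
        using bij_mem[OF xU] by (simp add: fun_eq_iff bij_is_surj surj_f_inv_f)
      ultimately have "congr (r \<circ> finv x) (r \<circ> x)" unfolding congr_def using ix by auto
      then have "congr (r \<circ> finv x) r'"
        by (rule congr_trans[OF _ r'(2)]) (intro comp_mem RU[OF r] xU ix RU[OF r'(1)])+
      then show "\<exists>r'\<in>R. congr (r \<circ> finv x) r'" using r'(1) by blast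
    qed
    fix y assume y: "y \<in> ?A"
    then have yU: "y \<in> U" by simp
    show "x \<circ> y \<in> ?A"
    proof (intro CollectI conjI ballI comp_mem[OF xU yU])
      fix r assume r: "r \<in> R"
      then obtain r' where r': "r' \<in> R" "congr (r \<circ> x) r'" using x by blast
      obtain r'' where r'': "r'' \<in> R" "congr (r' \<circ> y) r''" using y r'(1) by blast
      have "congr (r \<circ> x \<circ> y) (r' \<circ> y)" by (rule congr_comp[OF r'(2) yU RU[OF r'(1)]])
      then have "congr (r \<circ> x \<circ> y) r''"
        by (rule congr_trans[OF _ r''(2)]) (intro comp_mem RU[OF r] xU yU RU[OF r'(1)] RU[OF r''(1)])+
      then show "\<exists>r'\<in>R. congr (r \<circ> (x \<circ> y)) r'" using r''(1) by (auto simp: comp_assoc)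
    qed
  qed
  moreover have "S \<subseteq> ?A" using R(5) assms(1) by blast
  ultimately have "U \<subseteq> ?A" using generate_least[OF assms(1)] unfolding assms(3) by blast
  then have "\<exists>r\<in>R. congr (id \<circ> x) r" if "x \<in> U" for x using that R(4) by blast
  then have "\<exists>r\<in>R. congr x r" if "x \<in> U" for x using that by (metis id_comp)
  then show ?thesis using R by blast
qed

text \<open>There are \<open>2 ^ n\<close> pairwise incongruent elements: \<open>n - 1\<close>
  binary digits come from the translations divided by \<open>c k\<close>, and the last one records a
  factor \<open>?t\<close>.\<close>

lemma rank_ge_full:
  assumes fsym: "fsym (rays n) \<subseteq> U"
    and c: "\<And>k. k \<in> {2..n} \<Longrightarrow> c k > 0"
    and dvd: "\<And>x k. x \<in> U \<Longrightarrow> k \<in> {2..n} \<Longrightarrow> c k dvd translation x k"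
    and ex: "\<And>v :: nat \<Rightarrow> int. \<exists>x\<in>U. \<forall>k\<in>{2..n}. translation x k = c k * v k"
  shows "enat n \<le> min_generators G"
proof (rule min_generators_ge)
  fix S assume S: "S \<subseteq> carrier G" "finite S" "generate G S = carrier G"
  then obtain R where R: "R \<subseteq> U" "finite R" "card R \<le> 2 ^ card S" "\<forall>x\<in>U. \<exists>r\<in>R. congr x r"
    using representatives_cover[of S] by auto
  let ?t = "transpose (1, 1) (1, 2) :: nat \<times> nat \<Rightarrow> nat \<times> nat"
  have t: "?t \<in> fsym (rays n)" using n_ge by (intro transpose_fsym) (auto simp: rays_def)
  have tU: "?t \<in> U" using t fsym by blast
  obtain y where y: "\<And>v. y v \<in> U" "\<And>v k. k \<in> {2..n} \<Longrightarrow> translation (y v) k = c k * v k"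
    using ex by metis
  define el where "el p = (if snd p then y (fst p) \<circ> ?t else y (fst p))" for p :: "(nat \<Rightarrow> int) \<times> bool"
  have elU: "el p \<in> U" for p using y(1) comp_mem tU by (auto simp: el_def)
  have el_tr: "translation (el p) k = c k * fst p k" if "k \<in> {2..n}" for p k
    using that y trans_comp[OF y(1) tU] translation_fsym[OF t] by (simp add: el_def)
  have "\<forall>p. \<exists>r. r \<in> R \<and> congr (el p) r" using R(4) elU by blast
  then obtain \<rho> where \<rho>: "\<And>p. \<rho> p \<in> R" "\<And>p. congr (el p) (\<rho> p)" by metis
  let ?I = "({2..n} \<rightarrow>\<^sub>E {0, 1::int}) \<times> (UNIV :: bool set)"
  have "inj_on \<rho> ?I"
  proof
    fix p q assume p: "p \<in> ?I" and q: "q \<in> ?I" and eq: "\<rho> p = \<rho> q"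
    have rU: "\<rho> q \<in> U" using \<rho>(1) R(1) by blast
    obtain z w where z: "z \<in> U" "sim (el p) (z \<circ> z \<circ> \<rho> q)" and w: "w \<in> U" "sim (el q) (w \<circ> w \<circ> \<rho> q)"
      using \<rho>(2)[of p] \<rho>(2)[of q] eq by (auto simp: congr_def)
    have tz: "c k * fst p k = 2 * translation z k + translation (\<rho> q) k"
      "c k * fst q k = 2 * translation w k + translation (\<rho> q) k" if "k \<in> {2..n}" for k
      using sim_translation[OF z(2), of k] sim_translation[OF w(2), of k] z w rU
      by (simp_all add: comp_mem trans_comp flip: el_tr[OF that])
    have fst_eq: "fst p k = fst q k" if k: "k \<in> {2..n}" for k
    proof -
      \<comment> \<open>Divisibility of the translations of \<open>z\<close> and \<open>w\<close> by
        \<open>c k\<close> lets \<open>c k\<close> be cancelled, so the digits agree modulo 2 even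
        if \<open>c k\<close> is even.\<close>
      obtain a b where "translation z k = c k * a" "translation w k = c k * b"
        using dvd[OF z(1) k] dvd[OF w(1) k] by (auto simp: dvd_def)
      then have "c k * (fst p k - fst q k) = c k * (2 * (a - b))"
        using tz[OF k] by (simp add: algebra_simps)
      then have "fst p k - fst q k = 2 * (a - b)" using c[OF k] by simp
      moreover have "fst p k \<in> {0, 1}" "fst q k \<in> {0, 1}" using p q k by (auto simp: PiE_iff)
      ultimately show ?thesis by auto presburger+
    qed
    then have fst: "fst p = fst q" using p q by (intro PiE_ext[of _ "{2..n}" "\<lambda>_. {0, 1}"]) auto
    \<comment> \<open>Having equal translations, \<open>z\<close> and \<open>w\<close> differ by a
      finitary permutation \<open>g\<close>, whose square is even. So the squares of
      \<open>z\<close> and \<open>w\<close> agree modulo even finitary permutations.\<close>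
    define g where "g = z \<circ> finv w"
    have gU: "g \<in> U" unfolding g_def using z w by (intro comp_mem inv_mem)
    have g: "g \<in> fsym (rays n)"
    proof (rule fsym_of_zero[OF gU])
      show "translation g k = 0" if "k \<in> {2..n}" for k
        using tz[OF that] fst_eq[OF that] z w by (simp add: g_def trans_comp trans_inv inv_mem)
    qed
    have zg: "z = g \<circ> w" using bij_mem[OF w(1)] by (simp add: g_def fun_eq_iff bij_is_inj)
    have "sim ((g \<circ> g) \<circ> (w \<circ> w)) (w \<circ> w)"
      unfolding sim_def using fsym_comp[OF g g] evenperm_comp[OF fsym_permutation[OF g] fsym_permutation[OF g]]
      by blast
    then have "sim (z \<circ> z) (w \<circ> w)"
      using sim_trans[OF sim_sym[OF sim_square[OF gU w(1)]]] by (simp add: zg)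
    then have "sim (z \<circ> z \<circ> \<rho> q) (w \<circ> w \<circ> \<rho> q)"
      by (rule sim_comp[OF _ sim_refl comp_mem[OF w(1) w(1)]])
    then have pq: "sim (el p) (el q)" using z(2) w(2) sim_trans sim_sym by blast
    have no: "\<not> sim (y v) (y v \<circ> ?t)" for v
    proof
      assume "sim (y v) (y v \<circ> ?t)"
      then obtain e where e: "e \<in> fsym (rays n)" "evenperm e" "y v \<circ> ?t = e \<circ> y v"
        using sim_sym unfolding sim_def by blast
      have "y v \<circ> ?t \<circ> finv (y v) = e" unfolding e(3)
        using permutes_inv_o(1)[OF permutes_mem[OF y(1)]] by (simp add: comp_assoc)
      then have "evenperm (y v \<circ> ?t \<circ> finv (y v))" using e(2) by (simp only:)
      then have "evenperm ?t" unfolding evenperm_conj[OF bij_mem[OF y(1)] fsym_permutation[OF t]] .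
      then show False by (simp add: evenperm_swap)
    qed
    have "snd p = snd q"
    proof (rule ccontr)
      assume "snd p \<noteq> snd q"
      then have "sim (y (fst q)) (y (fst q) \<circ> ?t)"
        using pq sim_sym fst by (cases "snd p"; cases "snd q") (auto simp: el_def)
      then show False using no by blast
    qed
    then show "p = q" using fst by (simp add: prod_eq_iff)
  qed
  then have "card ?I \<le> card R" using \<rho>(1) R(2) by (intro card_inj_on_le[of \<rho>]) auto
  moreover have "card ?I = 2 ^ n"
  proof -
    obtain m where "n = Suc m" using n_ge by (cases n) auto
    then show ?thesis by (simp add: card_cartesian_product card_PiE flip: numeral_2_eq_2)
  qed
  ultimately have "(2::nat) ^ n \<le> 2 ^ card S" using R(3) by linarith
  then show "n \<le> card S" by simp
qed

end

section \<open>Two rays\<close>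

text \<open>Numbers the points of the two rays so that \<open>ray_shift 2\<close> becomes addition
  of 1; ray 1 carries the positive integers.\<close>

definition line :: "int \<Rightarrow> nat \<times> nat" where
  "line z = (if z > 0 then (1, nat z) else (2, nat (1 - z)))"

lemma line_rays: "line z \<in> rays 2"
  by (auto simp: line_def rays_def)

lemma line_inj: "line z = line w \<longleftrightarrow> z = w"
  by (auto simp: line_def)

lemma line_surj: "x \<in> rays 2 \<Longrightarrow> \<exists>z. x = line z"
proof -
  assume "x \<in> rays 2"
  then have "fst x = 1 \<or> fst x = 2" "snd x \<ge> 1" by (auto simp: rays_def)
  then obtain i m where x: "x = (i, m)" "i = 1 \<or> i = 2" "m \<ge> 1" by (cases x) auto
  show ?thesis
  proof (cases "i = 1")
    case True
    then show ?thesis using x by (intro exI[of _ "int m"]) (simp add: line_def)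
  next
    case False
    then show ?thesis using x by (intro exI[of _ "1 - int m"]) (simp add: line_def)
  qed
qed

lemma shift_line: "ray_shift 2 (line z) = line (z + 1)"
proof -
  consider "z > 0" | "z = 0" | "z < 0" by linarith
  then show ?thesis
  proof cases
    case 3
    then have "nat (1 - z) = Suc (nat (- z))" "nat (1 - (z + 1)) = nat (- z)" "nat (- z) \<noteq> 0" by auto
    then show ?thesis using 3 by (simp add: line_def ray_shift_def)
  qed (auto simp: line_def ray_shift_def nat_add_distrib)
qed

lemma shift_power_line: "(ray_shift 2 ^^ k) (line z) = line (z + int k)"
  by (induction k) (simp_all add: shift_line add_ac)

lemma shift_power_permutes: "ray_shift 2 ^^ k permutes rays 2"
proof (induction k)
  case 0
  show ?case unfolding funpow.simps by (rule permutes_id)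
next
  case (Suc k)
  show ?case unfolding funpow.simps by (rule permutes_compose[OF Suc ray_shift_permutes]) simp
qed

text \<open>Carries \<open>finite_even_mem_of_cycle\<close> over to integer coordinates, where the
  conditions on supports and orbits become arithmetic about \<open>D\<close> and \<mu>.\<close>

lemma line_generators:
  assumes u: "u permutes rays 2" "\<And>z. u (line z) = line (\<mu> z)" and D: "finite D"
    and meet: "D \<inter> \<mu> ` D = {p}" and "\<mu> p \<noteq> p"
    and inv: "\<And>C. D \<subseteq> C \<Longrightarrow> (\<And>z. \<mu> z \<in> C \<longleftrightarrow> z \<in> C) \<Longrightarrow> C = UNIV"
  shows "\<exists>\<sigma>\<in>fsym (rays 2). (evenperm \<sigma> \<longleftrightarrow> odd (card D)) \<and>
    (\<forall>\<Gamma>. bij_group (rays 2) \<Gamma> \<longrightarrow> u \<in> \<Gamma> \<longrightarrow> \<sigma> \<in> \<Gamma> \<longrightarrow> {f \<in> fsym (rays 2). evenperm f} \<subseteq> \<Gamma>)"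
proof -
  let ?S = "line ` D"
  have inj: "inj_on line D" by (simp add: inj_on_def line_inj)
  have SX: "?S \<subseteq> rays 2" using line_rays by blast
  have "D \<noteq> {}" using meet by blast
  then obtain \<sigma> where \<sigma>: "\<sigma> permutes ?S" "evenperm \<sigma> \<longleftrightarrow> odd (card ?S)" "transitive_on \<sigma> ?S"
    using cycle_exists[of ?S] D by auto
  have "finite {x. \<sigma> x \<noteq> x}"
    by (rule finite_subset[of _ ?S]) (use \<sigma>(1) D in \<open>auto simp: permutes_def\<close>)
  then have sym: "\<sigma> \<in> fsym (rays 2)" using permutes_subset[OF \<sigma>(1) SX] by (simp add: fsym_def)
  have "u ` ?S = line ` (\<mu> ` D)" by (simp add: image_image u(2))
  then have "?S \<inter> u ` ?S = line ` (D \<inter> \<mu> ` D)" using line_inj by (auto simp: image_iff)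
  then have meet': "?S \<inter> u ` ?S = {line p}" using meet by simp
  have "{f \<in> fsym (rays 2). evenperm f} \<subseteq> \<Gamma>"
    if \<Gamma>: "bij_group (rays 2) \<Gamma>" "u \<in> \<Gamma>" "\<sigma> \<in> \<Gamma>" for \<Gamma>
  proof
    interpret bij_group "rays 2" \<Gamma> by fact
    fix f assume f: "f \<in> {f \<in> fsym (rays 2). evenperm f}"
    show "f \<in> \<Gamma>"
    proof (rule finite_even_mem_of_cycle[OF \<Gamma>(2,3) \<sigma>(1,3) meet'])
      show "u (line p) \<noteq> line p" using assms(5) by (simp add: u(2) line_inj)
      fix C assume C: "?S \<subseteq> C" "\<And>x. u x \<in> C \<longleftrightarrow> x \<in> C"
      have "{z. line z \<in> C} = UNIV"
      proof (rule inv)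
        show "\<mu> z \<in> {z. line z \<in> C} \<longleftrightarrow> z \<in> {z. line z \<in> C}" for z
          using C(2)[of "line z"] by (simp add: u(2))
      qed (use C(1) in auto)
      then show "rays 2 \<subseteq> C" using line_surj by blast
    qed (use f in auto)
  qed
  then show ?thesis using sym \<sigma>(2) card_image[OF inj] by (intro bexI[of _ \<sigma>]) auto
qed

lemma shift_invariant_UNIV:
  assumes c: "(c::int) > 0" and "{0..<c} \<subseteq> C" and inv: "\<And>z. z + c \<in> C \<longleftrightarrow> z \<in> C"
  shows "C = UNIV"
proof -
  have k: "z + int k * c \<in> C \<longleftrightarrow> z \<in> C" for z k
  proof (induction k)
    case (Suc k)
    then show ?case using inv[of "z + int k * c"] by (simp add: algebra_simps)
  qed simp
  have "z \<in> C" for z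
  proof (cases "z \<ge> 0")
    case True
    have "z mod c + int (nat (z div c)) * c = z" using True c by (simp add: pos_imp_zdiv_nonneg_iff)
    moreover have "z mod c \<in> C" using assms(2) c by auto
    ultimately show ?thesis using k by metis
  next
    case False
    then have "z div c < 0" using c by (simp add: pos_imp_zdiv_neg_iff)
    then have "z + int (nat (- (z div c))) * c = z mod c"
      using div_mult_mod_eq[of z c] by (simp add: algebra_simps)
    moreover have "z mod c \<in> C" using assms(2) c by auto
    ultimately show ?thesis using k by metis
  qed
  then show ?thesis by blast
qed

lemma shift_generators:
  assumes c: "c > 0"
  shows "\<exists>\<sigma>\<in>fsym (rays 2). (evenperm \<sigma> \<longleftrightarrow> b) \<and>
    (\<forall>\<Gamma>. bij_group (rays 2) \<Gamma> \<longrightarrow> ray_shift 2 ^^ c \<in> \<Gamma> \<longrightarrow> \<sigma> \<in> \<Gamma> \<longrightarrow> {f \<in> fsym (rays 2). evenperm f} \<subseteq> \<Gamma>)"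
proof -
  let ?c = "int c"
  \<comment> \<open>The interval contains all residues modulo \<open>c\<close> and meets its
    translate only in \<open>c\<close>. The parity point is \<open>3 * c\<close>, because
    \<open>2 * c\<close> already lies in the translate.\<close>
  define D where "D = {0..?c} \<union> (if odd (c + 1) = b then {} else {3 * ?c})"
  have "D \<inter> (\<lambda>z. z + ?c) ` D = {?c}"
    using c by (auto simp: D_def split: if_splits)
  moreover have "nat (?c + 1) = Suc c" by simp
  then have "odd (card D) = b"
    using c by (auto simp: D_def)
  moreover have "C = UNIV" if "D \<subseteq> C" "\<And>z. z + ?c \<in> C \<longleftrightarrow> z \<in> C" for C
  proof (rule shift_invariant_UNIV[of ?c C])
    have "{0..<?c} \<subseteq> D" by (auto simp: D_def)
    then show "{0..<?c} \<subseteq> C" using that(1) by blast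
  qed (use c that(2) in simp_all)
  moreover have "finite D" by (simp add: D_def)
  ultimately show ?thesis
    using line_generators[of "ray_shift 2 ^^ c" "\<lambda>z. z + ?c" D ?c] shift_power_permutes shift_power_line c by auto
qed

text \<open>The transposition creates one finite orbit \<open>{0, c}\<close>, so the cycle has to link it to the
  infinite ones.\<close>

lemma twisted_shift_generators:
  assumes c: "c > 0"
  defines "u \<equiv> transpose (line 0) (line (2 * int c)) \<circ> ray_shift 2 ^^ c"
  shows "\<exists>\<sigma>\<in>fsym (rays 2). (evenperm \<sigma> \<longleftrightarrow> b) \<and>
    (\<forall>\<Gamma>. bij_group (rays 2) \<Gamma> \<longrightarrow> u \<in> \<Gamma> \<longrightarrow> \<sigma> \<in> \<Gamma> \<longrightarrow> {f \<in> fsym (rays 2). evenperm f} \<subseteq> \<Gamma>)"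
proof -
  let ?c = "int c"
  define \<mu> where "\<mu> z = (if z = - ?c then 2 * ?c else if z = ?c then 0 else z + ?c)" for z
  \<comment> \<open>The point 0 stands for the finite orbit, \<open>2 * c\<close> and
    \<open>3 * c\<close> are consecutive on the infinite orbit of multiples of \<open>c\<close>, and
    the other residues stand for the other orbits. The parity point is \<open>5 * c\<close>, because
    \<open>4 * c\<close> is the image of \<open>3 * c\<close>.\<close>
  define D where "D = {0..<?c} \<union> {2 * ?c, 3 * ?c} \<union> (if odd (c + 2) = b then {} else {5 * ?c})"
  have u: "u permutes rays 2" unfolding u_def
    by (rule permutes_compose[OF shift_power_permutes permutes_swap_id[OF line_rays line_rays]])
  have u\<mu>: "u (line z) = line (\<mu> z)" for z
    using c by (auto simp: u_def shift_power_line \<mu>_def transpose_def line_inj)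
  have "D \<inter> \<mu> ` D = {3 * ?c}"
    using c by (auto simp: D_def \<mu>_def split: if_splits)
  moreover have "odd (card D) = b"
    using c by (auto simp: D_def)
  moreover have "C = UNIV" if D: "D \<subseteq> C" and inv: "\<And>z. \<mu> z \<in> C \<longleftrightarrow> z \<in> C" for C
  proof (rule shift_invariant_UNIV)
    show "{0..<?c} \<subseteq> C" using D by (auto simp: D_def)
    have m: "0 \<in> C" "2 * ?c \<in> C" using D c by (auto simp: D_def)
    then have "?c \<in> C" "- ?c \<in> C" using inv[of 0] inv[of "- ?c"] c by (auto simp: \<mu>_def)
    then show "z + ?c \<in> C \<longleftrightarrow> z \<in> C" for z
      using inv[of z] m by (cases "z = ?c"; cases "z = - ?c") (auto simp: \<mu>_def)
  qed (use c in simp)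
  moreover have "finite D" by (simp add: D_def)
  moreover have "\<mu> (3 * ?c) \<noteq> 3 * ?c" using c by (simp add: \<mu>_def)
  ultimately show ?thesis
    using line_generators[of u \<mu> D "3 * ?c"] u u\<mu> by auto
qed

section \<open>The number of generators for two rays\<close>

context finite_index begin

text \<open>With at most one generator U would be commutative, which two overlapping 3-cycles in U
  refute. Commutativity follows by taking centralizers twice, of the elements of \<open>S\<close>
  and then of arbitrary elements.\<close>

lemma rank_ge_two: "2 \<le> min_generators G"
proof -
  have "enat 2 \<le> min_generators G"
  proof (rule min_generators_ge, rule ccontr)
    fix S assume S: "S \<subseteq> carrier G" "finite S" "generate G S = carrier G" "\<not> 2 \<le> card S"
    then have "card S = 0 \<or> card S = 1" by linarith
    then have "\<exists>s. S \<subseteq> {s}" using S(2) by (auto simp: card_1_singleton_iff)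
    then obtain s where s: "S \<subseteq> {s}" by blast
    have centr: "U \<subseteq> {x \<in> U. x \<circ> t = t \<circ> x}" if t: "t \<in> U" "\<And>x. x \<in> S \<Longrightarrow> x \<circ> t = t \<circ> x" for t
    proof -
      have "bij_group (rays n) {x \<in> U. x \<circ> t = t \<circ> x}"
      proof
        fix p q assume p: "p \<in> {x \<in> U. x \<circ> t = t \<circ> x}" and q: "q \<in> {x \<in> U. x \<circ> t = t \<circ> x}"
        show "p \<circ> q \<in> {x \<in> U. x \<circ> t = t \<circ> x}" using p q comp_mem by (simp add: comp_assoc) (metis comp_assoc)
      next
        fix p assume p: "p \<in> {x \<in> U. x \<circ> t = t \<circ> x}"
        then have i: "finv p \<circ> p = id" "p \<circ> finv p = id" using permutes_inv_o permutes_mem by blast+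
        have "finv p \<circ> t = finv p \<circ> (t \<circ> p) \<circ> finv p" using i by (simp add: comp_assoc)
        also have "\<dots> = finv p \<circ> (p \<circ> t) \<circ> finv p" using p by simp
        also have "\<dots> = t \<circ> finv p" using i by (simp add: o_assoc)
        finally show "finv p \<in> {x \<in> U. x \<circ> t = t \<circ> x}" using p inv_mem by simp
      qed (use permutes_mem id_mem in auto)
      moreover have "S \<subseteq> {x \<in> U. x \<circ> t = t \<circ> x}" using S(1) t by auto
      ultimately show ?thesis using generate_least[of S "rays n"] S(1,3) by simp
    qed
    have comm: "x \<circ> y = y \<circ> x" if x: "x \<in> U" and y: "y \<in> U" for x y
    proof -
      have "s' \<circ> x = x \<circ> s'" if "s' \<in> S" for s'
      proof -
        have "s' \<in> U" using that S(1) by auto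
        moreover have "a \<circ> s' = s' \<circ> a" if "a \<in> S" for a using that \<open>s' \<in> S\<close> s by blast
        ultimately show ?thesis using centr[of s'] x by auto
      qed
      then show ?thesis using centr[OF x] y by auto
    qed
    define a b c d :: "nat \<times> nat" where "a = (1, 1)" and "b = (1, 2)" and "c = (1, 3)" and "d = (1, 4)"
    note defs = a_def b_def c_def d_def
    have mem: "transpose x y \<circ> transpose y z \<in> U" if "x \<in> {a, b, c, d}" "y \<in> {a, b, c, d}" "z \<in> {a, b, c, d}"
      "x \<noteq> y" "y \<noteq> z" for x y z
    proof -
      have "x \<in> rays n" "y \<in> rays n" "z \<in> rays n" using that n_ge by (auto simp: defs rays_def)
      then have f: "transpose x y \<in> fsym (rays n)" "transpose y z \<in> fsym (rays n)" by (auto intro: transpose_fsym)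
      show ?thesis
        by (rule even_fsym_mem[OF fsym_comp[OF f]])
           (use that evenperm_comp[OF fsym_permutation[OF f(1)] fsym_permutation[OF f(2)]] in \<open>simp add: evenperm_swap\<close>)
    qed
    have "(transpose a b \<circ> transpose b c) \<circ> (transpose b c \<circ> transpose c d)
        = (transpose b c \<circ> transpose c d) \<circ> (transpose a b \<circ> transpose b c)"
      by (rule comm; rule mem) (auto simp: defs)
    then have "((transpose a b \<circ> transpose b c) \<circ> (transpose b c \<circ> transpose c d)) a
        = ((transpose b c \<circ> transpose c d) \<circ> (transpose a b \<circ> transpose b c)) a" by (rule fun_cong)
    then show False by (simp add: defs transpose_def)
  qed
  then show ?thesis by (simp add: numeral_eq_enat)
qed

end

lemma rank_two_rays:
  assumes "finite_index 2 U"
  shows "min_generators ((houghton 2)\<lparr>carrier := U\<rparr>) = 2"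
proof -
  interpret finite_index 2 U by fact
  obtain x0 c0 where "x0 \<in> U" "c0 > 0"
    "\<forall>i. translation x0 i = (if i = 2 then c0 else if i = 1 then - c0 else 0)"
    using axis_element[of 2] by auto
  then have "x0 \<in> U" "translation x0 2 \<noteq> 0" by auto
  from divisor_exists[OF this] obtain h where h: "h \<in> U" "translation h 2 > 0"
    "\<forall>y\<in>U. translation h 2 dvd translation y 2" by blast
  define c where "c = nat (translation h 2)"
  have c: "c > 0" "int c = translation h 2" using h(2) by (auto simp: c_def)
  interpret H: houghton_sub 2 "carrier (houghton 2)" by (rule houghton_full) simp
  \<comment> \<open>The inverse is taken because \<open>ray_shift 2\<close> has translation
    \<open>- 1\<close> on ray 2.\<close>
  define x where "x = finv h"
  have x: "x \<in> U" "translation x 2 = - int c" using h(1) inv_mem trans_inv c(2) by (auto simp: x_def)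
  let ?g = "ray_shift 2 ^^ c"
  have g0: "ray_shift 2 \<in> carrier (houghton 2)" by (rule ray_shift_in_houghton) auto
  then have g: "?g \<in> carrier (houghton 2)" "translation ?g 2 = - int c"
    using H.power_mem H.trans_power translation_ray_shift[of 2 2] by auto
  \<comment> \<open>The finitary discrepancy between \<open>x\<close> and the pure shift
    \<open>?g\<close>. If U has only even finitary elements, the parity of \<open>f\<close> decides
    whether \<open>?g\<close> or its product with a transposition lies in U.\<close>
  define f where "f = x \<circ> finv ?g"
  have f: "f \<in> fsym (rays 2)"
    unfolding f_def
  proof (rule H.fsym_of_zero)
    show "x \<circ> finv ?g \<in> carrier (houghton 2)" by (intro H.comp_mem H.inv_mem g mem_houghton x)
    show "translation (x \<circ> finv ?g) i = 0" if "i \<in> {2..2}" for i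
      using that x g mem_houghton by (simp add: H.trans_comp H.trans_inv H.inv_mem)
  qed
  have gx: "?g = finv f \<circ> x"
  proof -
    have "x = f \<circ> ?g" using H.bij_mem[OF g(1)] by (simp add: f_def fun_eq_iff bij_is_inj)
    then show ?thesis using fsym_bij[OF f] by (simp add: fun_eq_iff bij_is_inj)
  qed
  let ?ok = "\<lambda>u \<sigma>. u \<in> U \<and> translation u 2 = - int c \<and> \<sigma> \<in> U \<and>
    (\<forall>\<Gamma>. bij_group (rays 2) \<Gamma> \<longrightarrow> u \<in> \<Gamma> \<longrightarrow> \<sigma> \<in> \<Gamma> \<longrightarrow> fsym (rays 2) \<inter> U \<subseteq> \<Gamma>)"
  have "\<exists>u \<sigma>. ?ok u \<sigma>"
  proof (cases "fsym (rays 2) \<subseteq> U")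
    case True
    obtain \<sigma> where \<sigma>: "\<sigma> \<in> fsym (rays 2)" "\<not> evenperm \<sigma>"
      "\<And>\<Gamma>. bij_group (rays 2) \<Gamma> \<Longrightarrow> ?g \<in> \<Gamma> \<Longrightarrow> \<sigma> \<in> \<Gamma> \<Longrightarrow> {f \<in> fsym (rays 2). evenperm f} \<subseteq> \<Gamma>"
      using shift_generators[OF c(1), of False] by blast
    have "?g \<in> U" unfolding gx using True fsym_inv[OF f] x(1) by (intro comp_mem) auto
    moreover have "fsym (rays 2) \<subseteq> \<Gamma>" if "bij_group (rays 2) \<Gamma>" "?g \<in> \<Gamma>" "\<sigma> \<in> \<Gamma>" for \<Gamma>
      using fsym_mem_if_odd[OF that(1,3) \<sigma>(1,2) \<sigma>(3)[OF that]] .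
    moreover have "\<sigma> \<in> U" using \<sigma>(1) True by blast
    ultimately show ?thesis using g(2) by (intro exI[of _ ?g] exI[of _ \<sigma>] conjI allI impI) auto
  next
    case False
    have "bij_group (rays 2) U" ..
    then have ev: "evenperm p" if "p \<in> fsym (rays 2) \<inter> U" for p
      using fsym_mem_if_odd[of "rays 2" U p] that False even_fsym_mem by blast
    show ?thesis
    proof (cases "evenperm f")
      case True
      obtain \<sigma> where \<sigma>: "\<sigma> \<in> fsym (rays 2)" "evenperm \<sigma>"
        "\<And>\<Gamma>. bij_group (rays 2) \<Gamma> \<Longrightarrow> ?g \<in> \<Gamma> \<Longrightarrow> \<sigma> \<in> \<Gamma> \<Longrightarrow> {f \<in> fsym (rays 2). evenperm f} \<subseteq> \<Gamma>"
        using shift_generators[OF c(1), of True] by blast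
      have "finv f \<in> U"
        using even_fsym_mem[OF fsym_inv[OF f]] evenperm_inv[OF fsym_permutation[OF f]] True by simp
      then have "?g \<in> U" unfolding gx using x(1) by (intro comp_mem)
      moreover have "\<sigma> \<in> U" by (rule even_fsym_mem[OF \<sigma>(1,2)])
      moreover have "fsym (rays 2) \<inter> U \<subseteq> \<Gamma>" if "bij_group (rays 2) \<Gamma>" "?g \<in> \<Gamma>" "\<sigma> \<in> \<Gamma>" for \<Gamma>
        using \<sigma>(3)[OF that] ev by blast
      ultimately show ?thesis using g(2) by (intro exI[of _ ?g] exI[of _ \<sigma>] conjI allI impI) auto
    next
      case odd: False
      let ?t = "transpose (line 0) (line (2 * int c))"
      obtain \<sigma> where \<sigma>: "\<sigma> \<in> fsym (rays 2)" "evenperm \<sigma>"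
        "\<And>\<Gamma>. bij_group (rays 2) \<Gamma> \<Longrightarrow> ?t \<circ> ?g \<in> \<Gamma> \<Longrightarrow> \<sigma> \<in> \<Gamma> \<Longrightarrow> {f \<in> fsym (rays 2). evenperm f} \<subseteq> \<Gamma>"
        using twisted_shift_generators[OF c(1), of True] by blast
      have t: "?t \<in> fsym (rays 2)" by (intro transpose_fsym line_rays)
      have "\<not> evenperm ?t" using c(1) by (simp add: evenperm_swap line_inj)
      then have "evenperm (?t \<circ> finv f)"
        using odd evenperm_comp[OF fsym_permutation[OF t] fsym_permutation[OF fsym_inv[OF f]]]
          evenperm_inv[OF fsym_permutation[OF f]] by simp
      then have "?t \<circ> finv f \<in> U" by (intro even_fsym_mem fsym_comp t fsym_inv f)
      then have "(?t \<circ> finv f) \<circ> x \<in> U" using x(1) by (rule comp_mem)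
      then have "?t \<circ> ?g \<in> U" unfolding gx by (simp only: comp_assoc)
      moreover have "translation (?t \<circ> ?g) 2 = - int c"
        using translation_fsym_comp[OF _ g(1) t] g(2) by simp
      moreover have "\<sigma> \<in> U" by (rule even_fsym_mem[OF \<sigma>(1,2)])
      moreover have "fsym (rays 2) \<inter> U \<subseteq> \<Gamma>"
        if "bij_group (rays 2) \<Gamma>" "?t \<circ> ?g \<in> \<Gamma>" "\<sigma> \<in> \<Gamma>" for \<Gamma>
        using \<sigma>(3)[OF that] ev by blast
      ultimately have "?ok (?t \<circ> ?g) \<sigma>" by blast
      then show ?thesis by blast
    qed
  qed
  then obtain u \<sigma> where u: "u \<in> U" "translation u 2 = - int c" and \<sigma>: "\<sigma> \<in> U"
    and gen: "\<And>\<Gamma>. bij_group (rays 2) \<Gamma> \<Longrightarrow> u \<in> \<Gamma> \<Longrightarrow> \<sigma> \<in> \<Gamma> \<Longrightarrow> fsym (rays 2) \<inter> U \<subseteq> \<Gamma>" by blast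
  have "generate G {u, \<sigma>} = U"
  proof (rule generate_eqI[OF n_ge subgroup_U])
    show "{u, \<sigma>} \<subseteq> U" using u \<sigma> by blast
    fix \<Gamma> assume \<Gamma>: "houghton_sub 2 \<Gamma>" "{u, \<sigma>} \<subseteq> \<Gamma>" "\<Gamma> \<subseteq> U"
    interpret \<Gamma>: houghton_sub 2 \<Gamma> by (rule \<Gamma>(1))
    have "bij_group (rays 2) \<Gamma>" ..
    then have fin: "fsym (rays 2) \<inter> U \<subseteq> \<Gamma>" using \<Gamma>(2) by (intro gen) auto
    show "U \<subseteq> \<Gamma>"
    proof
      fix y assume y: "y \<in> U"
      then obtain k where k: "translation y 2 = int c * k" using h(3) c(2) by (auto simp: dvd_def)
      obtain z where z: "z \<in> \<Gamma>" "\<forall>i. translation z i = k * translation u i"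
        using \<Gamma>.multiple_mem \<Gamma>(2) by blast
      have zU: "z \<in> U" using z(1) \<Gamma>(3) by blast
      have "y \<circ> z \<in> fsym (rays 2)"
        using k z(2) u(2) y zU by (intro fsym_of_zero comp_mem) (auto simp: trans_comp)
      then have "y \<circ> z \<in> \<Gamma>" using fin comp_mem[OF y zU] by blast
      then have "(y \<circ> z) \<circ> finv z \<in> \<Gamma>" by (rule \<Gamma>.comp_mem[OF _ \<Gamma>.inv_mem[OF z(1)]])
      moreover have "(y \<circ> z) \<circ> finv z = y"
        using bij_mem[OF zU] by (simp add: fun_eq_iff bij_is_surj surj_f_inv_f)
      ultimately show "y \<in> \<Gamma>" by (simp only:)
    qed
  qed
  then have "min_generators G \<le> enat 2"
    using u \<sigma> card_insert_le_m1[of 2 "{\<sigma>}" u] by (intro min_generators_le[of "{u, \<sigma>}"]) auto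
  then show ?thesis using rank_ge_two by (simp add: numeral_eq_enat antisym)
qed

section \<open>The image under the projection\<close>

text \<open>Both sides are additive and agree on the generators. The sign appears because
  \<open>ray_shift k\<close> moves ray \<open>k\<close> inwards while its image is a positive basis
  vector.\<close>

lemma projection_eq:
  assumes n: "n \<ge> 3" and \<pi>: "\<pi> \<in> houghton_projections n" and x: "x \<in> carrier (houghton n)"
    and j: "j \<in> {1..n - 1}"
  shows "\<pi> x j = - translation x (Suc j)"
proof -
  interpret H: houghton_sub n "carrier (houghton n)" using n by (intro houghton_full) simp
  have hom: "\<pi> \<in> hom (houghton n) (int_power_group (n - 1))" using \<pi> by (auto simp: houghton_projections_def epi_def)
  have mult: "\<pi> (p \<circ> q) j = \<pi> p j + \<pi> q j"
    if "p \<in> carrier (houghton n)" "q \<in> carrier (houghton n)" "j \<in> {1..n - 1}" for p q j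
    using hom_mult[OF hom that(2,1)] that(3) by (simp add: int_power_group_def product_group_def)
  have id0: "\<pi> id j = 0" if "j \<in> {1..n - 1}" for j
    using mult[OF H.id_mem H.id_mem that] by simp
  let ?A = "{x \<in> carrier (houghton n). \<forall>j\<in>{1..n - 1}. \<pi> x j = - translation x (Suc j)}"
  have "houghton_sub n ?A"
  proof
    show "id \<in> ?A" using H.id_mem id0 by (auto simp: translation_id)
    show "p \<circ> q \<in> ?A" if "p \<in> ?A" "q \<in> ?A" for p q
      using that mult H.comp_mem by (auto simp: H.trans_comp)
    show "finv p \<in> ?A" if p: "p \<in> ?A" for p
    proof -
      have pH: "p \<in> carrier (houghton n)" using p by simp
      have "\<pi> (p \<circ> finv p) j = 0" if "j \<in> {1..n - 1}" for j
        using id0[OF that] permutes_inv_o(1)[OF H.permutes_mem[OF pH]] by simp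
      then have "\<pi> p j + \<pi> (finv p) j = 0" if "j \<in> {1..n - 1}" for j
        using mult[OF pH H.inv_mem[OF pH] that] that by simp
      then show ?thesis using p H.inv_mem[OF pH] by (force simp: H.trans_inv)
    qed
  qed (use H.permutes_mem n in auto)
  moreover have "ray_shift k \<in> ?A" if k: "k \<in> {2..n}" for k
  proof -
    have "\<pi> (ray_shift k) = std_basis (n - 1) (k - 1)" using \<pi> k by (auto simp: houghton_projections_def)
    then show ?thesis
      using k ray_shift_in_houghton[of n k] n by (auto simp: std_basis_def translation_ray_shift)
  qed
  ultimately show ?thesis using houghton_induct[OF n, of ?A] x j by blast
qed

lemma std_basis_pow:
  assumes "j \<in> {1..r}"
  shows "std_basis r j [^]\<^bsub>int_power_group r\<^esub> (m::nat) = (\<lambda>i\<in>{1..r}. if i = j then int m else 0)"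
proof (induction m)
  case 0
  show ?case by (auto simp: int_power_group_def product_group_def fun_eq_iff)
next
  case (Suc m)
  have "std_basis r j [^]\<^bsub>int_power_group r\<^esub> Suc m
      = (std_basis r j [^]\<^bsub>int_power_group r\<^esub> m) \<otimes>\<^bsub>int_power_group r\<^esub> std_basis r j"
    by simp
  also have "\<dots> = (\<lambda>i\<in>{1..r}. if i = j then int (Suc m) else 0)"
    unfolding Suc by (auto simp: int_power_group_def product_group_def fun_eq_iff std_basis_def)
  finally show ?case .
qed

lemma int_power_group_inv:
  assumes "x \<in> carrier (int_power_group r)"
  shows "inv\<^bsub>int_power_group r\<^esub> x = (\<lambda>i\<in>{1..r}. - x i)"
  using assms unfolding int_power_group_def by (subst inv_product_group) auto

lemma int_power_group_mult:
  "x \<otimes>\<^bsub>int_power_group r\<^esub> y = (\<lambda>i\<in>{1..r}. x i + y i)"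
  by (simp add: int_power_group_def product_group_def)

lemma carrier_int_power_group: "carrier (int_power_group r) = extensional {1..r}"
  by (simp add: int_power_group_def PiE_def)

lemma int_power_subgroupI:
  assumes "H \<subseteq> extensional {1..r}" "(\<lambda>i\<in>{1..r}. 0) \<in> H"
    and "\<And>x. x \<in> H \<Longrightarrow> (\<lambda>i\<in>{1..r}. - x i) \<in> H"
    and "\<And>x y. x \<in> H \<Longrightarrow> y \<in> H \<Longrightarrow> (\<lambda>i\<in>{1..r}. x i + y i) \<in> H"
  shows "subgroup H (int_power_group r)"
  using assms int_power_group_inv
  by (intro group.subgroupI[OF group_int_power_group])
     (auto simp: carrier_int_power_group int_power_group_mult subset_iff)

text \<open>For the inclusion from right to left, the vectors whose coordinatewise scaling
  \<open>sc\<close> lies in the generated subgroup form a subgroup containing the standard basis,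
  hence everything.\<close>

lemma generate_multiples:
  fixes c :: "nat \<Rightarrow> nat"
  shows "generate (int_power_group (n - 1))
      {std_basis (n - 1) (k - 1) [^]\<^bsub>int_power_group (n - 1)\<^esub> c k | k. k \<in> {2..n}}
    = {v \<in> extensional {1..n - 1}. \<forall>j\<in>{1..n - 1}. int (c (Suc j)) dvd v j}"
    (is "generate ?Z ?S = ?L")
proof
  interpret Z: group ?Z by (rule group_int_power_group)
  have S: "?S = (\<lambda>j. std_basis (n - 1) j [^]\<^bsub>?Z\<^esub> c (Suc j)) ` {1..n - 1}"
  proof
    show "?S \<subseteq> (\<lambda>j. std_basis (n - 1) j [^]\<^bsub>?Z\<^esub> c (Suc j)) ` {1..n - 1}"
    proof
      fix v assume "v \<in> ?S"
      then obtain k where k: "k \<in> {2..n}" "v = std_basis (n - 1) (k - 1) [^]\<^bsub>?Z\<^esub> c k" by blast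
      then show "v \<in> (\<lambda>j. std_basis (n - 1) j [^]\<^bsub>?Z\<^esub> c (Suc j)) ` {1..n - 1}"
        by (intro image_eqI[of _ _ "k - 1"]) auto
    qed
    show "(\<lambda>j. std_basis (n - 1) j [^]\<^bsub>?Z\<^esub> c (Suc j)) ` {1..n - 1} \<subseteq> ?S"
    proof
      fix v assume "v \<in> (\<lambda>j. std_basis (n - 1) j [^]\<^bsub>?Z\<^esub> c (Suc j)) ` {1..n - 1}"
      then obtain j where "j \<in> {1..n - 1}" "v = std_basis (n - 1) j [^]\<^bsub>?Z\<^esub> c (Suc j)" by blast
      then show "v \<in> ?S" by (intro CollectI exI[of _ "Suc j"]) auto
    qed
  qed
  have "subgroup ?L ?Z" by (rule int_power_subgroupI) auto
  moreover have "?S \<subseteq> ?L" unfolding S by (auto simp: std_basis_pow)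
  ultimately show "generate ?Z ?S \<subseteq> ?L" by (intro Z.generate_subgroup_incl)
  have "?S \<subseteq> carrier ?Z" unfolding S by (auto simp: std_basis_pow carrier_int_power_group)
  then have gen: "subgroup (generate ?Z ?S) ?Z" by (rule Z.generate_is_subgroup)
  define sc where "sc w = (\<lambda>i\<in>{1..n - 1}. int (c (Suc i)) * w i)" for w :: "nat \<Rightarrow> int"
  let ?H = "{w \<in> extensional {1..n - 1}. sc w \<in> generate ?Z ?S}"
  have "subgroup ?H ?Z"
  proof (rule int_power_subgroupI)
    have "sc (\<lambda>i\<in>{1..n - 1}. 0) = \<one>\<^bsub>?Z\<^esub>"
      by (auto simp: sc_def int_power_group_def product_group_def fun_eq_iff)
    then show "(\<lambda>i\<in>{1..n - 1}. 0) \<in> ?H" using subgroup.one_closed[OF gen] by simp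
    show "(\<lambda>i\<in>{1..n - 1}. - x i) \<in> ?H" if "x \<in> ?H" for x
    proof -
      have "sc x \<in> carrier ?Z" by (simp add: sc_def carrier_int_power_group)
      then have "inv\<^bsub>?Z\<^esub> (sc x) = (\<lambda>i\<in>{1..n - 1}. - sc x i)" by (rule int_power_group_inv)
      also have "\<dots> = sc (\<lambda>i\<in>{1..n - 1}. - x i)" by (auto simp: sc_def fun_eq_iff)
      finally have "inv\<^bsub>?Z\<^esub> (sc x) = sc (\<lambda>i\<in>{1..n - 1}. - x i)" .
      then show ?thesis using subgroup.m_inv_closed[OF gen, of "sc x"] that by simp
    qed
    show "(\<lambda>i\<in>{1..n - 1}. x i + y i) \<in> ?H" if "x \<in> ?H" "y \<in> ?H" for x y
    proof -
      have "sc x \<otimes>\<^bsub>?Z\<^esub> sc y = sc (\<lambda>i\<in>{1..n - 1}. x i + y i)"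
        by (auto simp: int_power_group_mult sc_def fun_eq_iff ring_distribs)
      then show ?thesis using subgroup.m_closed[OF gen, of "sc x" "sc y"] that by simp
    qed
  qed auto
  moreover have "std_basis (n - 1) j \<in> ?H" if "j \<in> {1..n - 1}" for j
  proof -
    have "sc (std_basis (n - 1) j) = std_basis (n - 1) j [^]\<^bsub>?Z\<^esub> c (Suc j)"
      unfolding std_basis_pow[OF that] by (auto simp: sc_def std_basis_def fun_eq_iff)
    then have "sc (std_basis (n - 1) j) \<in> ?S" using that unfolding S by blast
    then show ?thesis by (auto simp: std_basis_def intro: generate.incl)
  qed
  ultimately have H: "?H = carrier ?Z" by (rule int_power_group_generated)
  show "?L \<subseteq> generate ?Z ?S"
  proof
    fix v assume v: "v \<in> ?L"
    define w where "w = (\<lambda>i\<in>{1..n - 1}. v i div int (c (Suc i)))"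
    have "w \<in> carrier ?Z" by (simp add: w_def carrier_int_power_group)
    then have "sc w \<in> generate ?Z ?S" using H by blast
    moreover have "sc w = v"
      using v by (auto simp: sc_def w_def extensional_def fun_eq_iff)
    ultimately show "v \<in> generate ?Z ?S" by simp
  qed
qed

section \<open>Finite index subgroups\<close>

lemma finite_index_of_subgroup:
  assumes "n \<ge> 2" "finite_index_subgroup U (houghton n)"
  shows "finite_index n U"
  using assms houghton_sub_of_subgroup
  unfolding finite_index_subgroup_def finite_index_def finite_index_axioms_def by blast

lemma finite_index_full:
  assumes "n \<ge> 2"
  shows "finite_index n (carrier (houghton n))"
proof -
  have "carrier (houghton n) #>\<^bsub>houghton n\<^esub> a = carrier (houghton n)" if "a \<in> carrier (houghton n)" for a
    by (rule group.coset_join2[OF group_houghton that group.subgroup_self[OF group_houghton] that])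
  then have "rcosets\<^bsub>houghton n\<^esub> (carrier (houghton n)) \<subseteq> {carrier (houghton n)}"
    by (auto simp: RCOSETS_def)
  then have "finite (rcosets\<^bsub>houghton n\<^esub> (carrier (houghton n)))" by (rule finite_subset) simp
  then show ?thesis using houghton_full[OF assms] by (simp add: finite_index_def finite_index_axioms_def)
qed

lemma rank_houghton_two: "min_generators (houghton 2) = 2"
  using rank_two_rays[OF finite_index_full] by simp

lemma rank_houghton:
  assumes n: "n \<ge> 3"
  shows "min_generators (houghton n) = enat (n - 1)"
proof (rule antisym)
  interpret finite_index n "carrier (houghton n)" using n by (intro finite_index_full) simp
  have gens: "houghton_gens n = ray_shift ` {2..n}" using n by (simp add: houghton_gens_def)
  have mem: "houghton_gens n \<subseteq> carrier (houghton n)"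
    unfolding gens using ray_shift_in_houghton[OF n_ge] by blast
  have "generate G (houghton_gens n) = carrier (houghton n)"
    by (rule generate_eqI[OF n_ge subgroup_U mem]) (rule houghton_induct[OF n], auto simp: gens)
  then show "min_generators (houghton n) \<le> enat (n - 1)"
    using mem card_image_le[of "{2..n}" ray_shift]
    by (intro min_generators_le[of "houghton_gens n"]) (auto simp: gens)
  show "enat (n - 1) \<le> min_generators (houghton n)" using rank_ge by simp
qed

lemma sum_even_but_one:
  fixes a :: "nat \<Rightarrow> int"
  assumes "finite A" "k \<in> A" "\<And>i. i \<in> A \<Longrightarrow> i \<noteq> k \<Longrightarrow> even (a i)"
  shows "even (\<Sum>i\<in>A. a i) \<longleftrightarrow> even (a k)"
proof -
  have "even (\<Sum>i\<in>A - {k}. a i)" using assms by (intro dvd_sum) auto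
  then show ?thesis using assms by (simp add: sum.remove[of A k])
qed

text \<open>Two odd entries \<open>c i\<close> and \<open>c j\<close> give translation vectors that
  overlap only on ray 1, with odd product. With at most one odd entry, every vector is supported
  modulo 2 on ray 1 and one further ray with equal values there, so all scalar products are
  even.\<close>

lemma (in finite_index) rank_iff:
  fixes c :: "nat \<Rightarrow> nat"
  assumes n: "n \<ge> 3" and c: "\<And>k. k \<in> {2..n} \<Longrightarrow> c k \<ge> 1"
    and dvd: "\<And>x k. x \<in> U \<Longrightarrow> k \<in> {2..n} \<Longrightarrow> int (c k) dvd translation x k"
    and ex: "\<And>v :: nat \<Rightarrow> int. \<exists>x\<in>U. \<forall>k\<in>{2..n}. translation x k = int (c k) * v k"
  shows "min_generators G = enat n \<longleftrightarrow> fsym (rays n) \<subseteq> U \<and> card {k \<in> {2..n}. odd (c k)} \<in> {0, 1}"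
proof
  have split1: "{1..n} = insert 1 {2..n}" using n by auto
  {
    assume d: "min_generators G = enat n"
    have no: "\<not> min_generators G \<le> enat (n - 1)" using n by (simp add: d)
    then have "fsym (rays n) \<subseteq> U" using rank_le_if_even[OF n] by blast
    moreover have "card {k \<in> {2..n}. odd (c k)} \<in> {0, 1}"
    proof (rule ccontr)
      assume "card {k \<in> {2..n}. odd (c k)} \<notin> {0, 1}"
      then have "card {k \<in> {2..n}. odd (c k)} \<noteq> 0" "card {k \<in> {2..n}. odd (c k)} \<noteq> 1"
        unfolding insert_iff empty_iff by argo+
      then have two: "2 \<le> card {k \<in> {2..n}. odd (c k)}" by linarith
      have "\<exists>i j. i \<in> {k \<in> {2..n}. odd (c k)} \<and> j \<in> {k \<in> {2..n}. odd (c k)} \<and> i \<noteq> j"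
        using two card_le_Suc0_iff_eq[of "{k \<in> {2..n}. odd (c k)}"] by force
      then obtain i j where ij: "i \<in> {2..n}" "j \<in> {2..n}" "odd (c i)" "odd (c j)" "i \<noteq> j" by blast
      obtain x where x: "x \<in> U" "\<forall>k\<in>{2..n}. translation x k = int (c k) * (if k = i then 1 else 0)"
        using ex[of "\<lambda>k. if k = i then 1 else 0"] by blast
      obtain y where y: "y \<in> U" "\<forall>k\<in>{2..n}. translation y k = int (c k) * (if k = j then 1 else 0)"
        using ex[of "\<lambda>k. if k = j then 1 else 0"] by blast
      have t1: "translation z 1 = - (\<Sum>k=2..n. translation z k)" if "z \<in> U" for z
        using sum_translation[OF n_ge mem_houghton[OF that]] unfolding split1 by simp
      have "(\<Sum>k=2..n. translation x k) = (\<Sum>k=2..n. if k = i then int (c i) else 0)"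
        by (rule sum.cong) (use x in auto)
      then have "translation x 1 = - int (c i)" using t1[OF x(1)] ij by simp
      moreover have "(\<Sum>k=2..n. translation y k) = (\<Sum>k=2..n. if k = j then int (c j) else 0)"
        by (rule sum.cong) (use y in auto)
      then have "translation y 1 = - int (c j)" using t1[OF y(1)] ij by simp
      moreover have "(\<Sum>k=2..n. translation x k * translation y k) = 0"
        by (rule sum.neutral) (use x y ij in auto)
      ultimately have "odd (\<Sum>k=1..n. translation x k * translation y k)"
        unfolding split1 using ij by simp
      then have "\<not> evenperm (commutator x y)"
        using even_commutator_iff[OF n] x y mem_houghton by blast
      then show False using no rank_le_if_odd_commutator[OF n x(1) y(1)] by blast
    qed
    ultimately show "fsym (rays n) \<subseteq> U \<and> card {k \<in> {2..n}. odd (c k)} \<in> {0, 1}" by blast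
  next
    assume *: "fsym (rays n) \<subseteq> U \<and> card {k \<in> {2..n}. odd (c k)} \<in> {0, 1}"
    have "\<exists>k0\<in>{2..n}. \<forall>k\<in>{2..n}. k \<noteq> k0 \<longrightarrow> even (c k)"
    proof (cases "\<exists>k\<in>{2..n}. odd (c k)")
      case False
      \<comment> \<open>Without odd entries any ray can play the part of \<open>k0\<close>.\<close>
      then show ?thesis using n by (intro bexI[of _ 2]) auto
    next
      case True
      then obtain k0 where k0: "k0 \<in> {2..n}" "odd (c k0)" by blast
      have "card {k \<in> {2..n}. odd (c k)} \<le> Suc 0" using * unfolding insert_iff empty_iff
        by (elim conjE disjE FalseE) linarith+
      then have "k = k0" if "k \<in> {2..n}" "odd (c k)" for k
        using card_le_Suc0_iff_eq[of "{k \<in> {2..n}. odd (c k)}"] that k0 by auto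
      then show ?thesis using k0 by blast
    qed
    then obtain k0 where k0: "k0 \<in> {2..n}" "\<And>k. k \<in> {2..n} \<Longrightarrow> k \<noteq> k0 \<Longrightarrow> even (c k)" by blast
    have ev: "even (translation x k)" if "x \<in> U" "k \<in> {2..n}" "k \<noteq> k0" for x k
      using dvd[OF that(1,2)] k0(2)[OF that(2,3)] by (meson dvd_trans even_of_nat)
    have "evenperm (commutator x y)" if x: "x \<in> U" and y: "y \<in> U" for x y
    proof -
      have one: "even (translation z 1) \<longleftrightarrow> even (translation z k0)" if z: "z \<in> U" for z
      proof -
        have "translation z 1 = - (\<Sum>k=2..n. translation z k)"
          using sum_translation[OF n_ge mem_houghton[OF z]] unfolding split1 by simp
        then show ?thesis using sum_even_but_one[OF _ k0(1), of "translation z"] ev[OF z] by simp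
      qed
      have "even (\<Sum>k=2..n. translation x k * translation y k) \<longleftrightarrow> even (translation x k0 * translation y k0)"
        by (rule sum_even_but_one) (use k0 ev x y in auto)
      then have "even (\<Sum>k=1..n. translation x k * translation y k)"
        unfolding split1 using one[OF x] one[OF y] by simp
      then show ?thesis using even_commutator_iff[OF n] mem_houghton x y by blast
    qed
    then interpret even_commutators n U by unfold_locales
    have "enat n \<le> min_generators G"
    proof (rule rank_ge_full[of "\<lambda>k. int (c k)"])
      show "fsym (rays n) \<subseteq> U" using * by blast
      show "int (c k) > 0" if "k \<in> {2..n}" for k using c[OF that] by simp
    qed (rule dvd ex; assumption)+
    then show "min_generators G = enat n" using rank_le[OF n] by simp
  }
qed

theorem theorem3:
  shows "(\<forall>U. finite_index_subgroup U (houghton 2) \<longrightarrow>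
            min_generators ((houghton 2)\<lparr>carrier := U\<rparr>) = min_generators (houghton 2)) \<and>
         (\<forall>n\<ge>3. \<forall>U. finite_index_subgroup U (houghton n) \<longrightarrow>
            min_generators ((houghton n)\<lparr>carrier := U\<rparr>)
              \<in> {min_generators (houghton n), min_generators (houghton n) + 1} \<and>
            (\<forall>\<pi> \<in> houghton_projections n. \<forall>c :: nat \<Rightarrow> nat.
               (\<forall>k\<in>{2..n}. c k \<ge> 1) \<and>
               \<pi> ` U = generate (int_power_group (n - 1))
                 {std_basis (n - 1) (k - 1) [^]\<^bsub>int_power_group (n - 1)\<^esub> c k | k. k \<in> {2..n}}
               \<longrightarrow>
               (min_generators ((houghton n)\<lparr>carrier := U\<rparr>) = min_generators (houghton n) + 1 \<longleftrightarrow>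
                  fsym (rays n) \<subseteq> U \<and> card {k \<in> {2..n}. odd (c k)} \<in> {0, 1})))"
proof (intro conjI allI impI ballI)
  fix U assume "finite_index_subgroup U (houghton 2)"
  then show "min_generators ((houghton 2)\<lparr>carrier := U\<rparr>) = min_generators (houghton 2)"
    using rank_two_rays[OF finite_index_of_subgroup] rank_houghton_two by simp
next
  fix n :: nat and U
  assume n: "3 \<le> n" and U: "finite_index_subgroup U (houghton n)"
  interpret finite_index n U using n U by (intro finite_index_of_subgroup) simp_all
  have succ: "min_generators (houghton n) + 1 = enat n"
    using n by (simp add: rank_houghton one_enat_def)
  show "min_generators G \<in> {min_generators (houghton n), min_generators (houghton n) + 1}"
  proof -
    obtain d where d: "min_generators G = enat d" using rank_le[OF n] by (cases "min_generators G") auto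
    then have "n - 1 \<le> d" "d \<le> n" using rank_ge rank_le[OF n] by simp_all
    then have "min_generators G = enat (n - 1) \<or> min_generators G = enat n" using d by auto
    then show ?thesis using succ rank_houghton[OF n] by (metis insertCI)
  qed
  fix \<pi> and c :: "nat \<Rightarrow> nat"
  assume \<pi>: "\<pi> \<in> houghton_projections n"
    and *: "(\<forall>k\<in>{2..n}. c k \<ge> 1) \<and> \<pi> ` U = generate (int_power_group (n - 1))
      {std_basis (n - 1) (k - 1) [^]\<^bsub>int_power_group (n - 1)\<^esub> c k | k. k \<in> {2..n}}"
  then have img: "\<pi> ` U = {v \<in> extensional {1..n - 1}. \<forall>j\<in>{1..n - 1}. int (c (Suc j)) dvd v j}"
    unfolding generate_multiples by blast
  have tr: "translation x k = - \<pi> x (k - 1)" if "x \<in> U" "k \<in> {2..n}" for x k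
  proof -
    have "k - 1 \<in> {1..n - 1}" "Suc (k - 1) = k" using that(2) by auto
    then show ?thesis using projection_eq[OF n \<pi> mem_houghton[OF that(1)], of "k - 1"] by simp
  qed
  show "min_generators G = min_generators (houghton n) + 1 \<longleftrightarrow>
      fsym (rays n) \<subseteq> U \<and> card {k \<in> {2..n}. odd (c k)} \<in> {0, 1}"
    unfolding succ
  proof (rule rank_iff[OF n])
    show "1 \<le> c k" if "k \<in> {2..n}" for k using * that by blast
    show "int (c k) dvd translation x k" if x: "x \<in> U" and k: "k \<in> {2..n}" for x k
    proof -
      have "\<pi> x \<in> \<pi> ` U" using x by blast
      moreover have "k - 1 \<in> {1..n - 1}" "Suc (k - 1) = k" using k by auto
      ultimately have "int (c k) dvd \<pi> x (k - 1)" unfolding img by force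
      then show ?thesis using tr[OF x k] by simp
    qed
    fix v :: "nat \<Rightarrow> int"
    \<comment> \<open>The minus sign compensates the one in \<open>projection_eq\<close>.\<close>
    have "(\<lambda>j\<in>{1..n - 1}. - (int (c (Suc j)) * v (Suc j))) \<in> \<pi> ` U" unfolding img by auto
    then obtain x where x: "x \<in> U" "\<pi> x = (\<lambda>j\<in>{1..n - 1}. - (int (c (Suc j)) * v (Suc j)))" by force
    have "translation x k = int (c k) * v k" if k: "k \<in> {2..n}" for k
    proof -
      have "k - 1 \<in> {1..n - 1}" "Suc (k - 1) = k" using k by auto
      then show ?thesis using tr[OF x(1) k] x(2) by simp
    qed
    then show "\<exists>x\<in>U. \<forall>k\<in>{2..n}. translation x k = int (c k) * v k" using x(1) by blast
  qed
qed

end
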